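(* Let $n\ge1$, let $m$ be a positive integer, and let $\eta=(\eta_1,\dots,\eta_n)$ be integers with $m>\eta_1>\dots>\eta_n\ge0$. Then, as $k\to\infty$, the number of walks on the $m$-circle which start at $\eta$ and consist of exactly $k$ standard steps (arbitrary end point), such that at no time two coordinates of a point of the walk are equal, is asymptotically $$\frac{2^{\binom n2}}{m^{n/2}}\left(2\frac{\sin\frac{n\pi}{m}}{\sin\frac{\pi}{m}}\right)^k\prod_{1\le h<t\le n}\sin\frac{\pi(\eta_h-\eta_t)}{m}\left(\prod_{h=1}^{n/2}\cot\frac{(2h-1)\pi}{2m}+(-1)^{|\eta|+k+\frac n2}\prod_{h=1}^{n/2}\tan\frac{(2h-1)\pi}{2m}\right)$$ if both $n$ and $m$ are even; asymptotically $$\frac{2^{\binom n2}}{m^{n/2}}\left(2\frac{\sin\frac{n\pi}{m}}{\sin\frac{\pi}{m}}\right)^k\prod_{1\le h<t\le n}\sin\frac{\pi(\eta_h-\eta_t)}{m}\prod_{h=1}^{n/2}\cot\frac{(2h-1)\pi}{2m}$$ if $n$ is even and $m$ is odd; and asymptotically $$\frac{2^{\binom n2}}{m^{(n-1)/2}}\left(2\frac{\sin\frac{n\pi}{m}}{\sin\frac{\pi}{m}}\right)^k\prod_{1\le h<t\le n}\sin\frac{\pi(\eta_h-\eta_t)}{m}\prod_{h=1}^{(n-1)/2}\cot\frac{h\pi}{m}$$ if $n$ is odd (regardless of $m$).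
   Context: For $\eta\in\mathbb R^n$, $|\eta|=\eta_1+\dots+\eta_n$. Walks on the $m$-circle are walks in $n$-space where each coordinate is taken modulo $m$. A walk with $k$ standard steps is a sequence $p_0,\dots,p_k$ of such points with $p_i-p_{i-1}\in\{\pm e_1,\dots,\pm e_n\}$; the condition is that for every $i$ and $h\ne t$ the $h$-th and $t$-th coordinates of $p_i$ are distinct modulo $m$. "Asymptotically $E$" means the ratio of the count to $E$ tends to $1$. *)

theory Defs
  imports "HOL-Analysis.Analysis" "HOL-Library.Landau_Symbols"
begin

(* Points are integer lists of length n; the list positions 0, ..., n - 1 hold
   the coordinates 1, ..., n. *)

definition standard_step :: "int list \<Rightarrow> int list \<Rightarrow> bool" where
  "standard_step p q \<longleftrightarrow> (\<exists>i<length p. q = p[i := p ! i + 1] \<or> q = p[i := p ! i - 1])"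

definition distinct_mod :: "nat \<Rightarrow> int list \<Rightarrow> bool" where
  "distinct_mod m p \<longleftrightarrow>
     (\<forall>h<length p. \<forall>t<length p. h \<noteq> t \<longrightarrow> p ! h mod int m \<noteq> p ! t mod int m)"

(* A walk is recorded by its points in Z^n, and coordinates are compared modulo m.
   For m >= 3, reduction modulo m is a bijection onto the sequences of points of
   (Z/m)^n whose successive differences are +e_i or -e_i.  For m <= 2 the steps +e_i
   and -e_i agree modulo m, and they are counted as two different steps here. *)

definition circle_walks :: "nat \<Rightarrow> nat \<Rightarrow> int list \<Rightarrow> int list list set" where
  "circle_walks m k \<eta> =
     {w. length w = k + 1 \<and> w ! 0 = \<eta> \<and>
         (\<forall>i<k. standard_step (w ! i) (w ! (i + 1))) \<and>
         (\<forall>i\<le>k. distinct_mod m (w ! i))}"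

(* The quotient sin (n x) / sin x at x = pi / m.  For n = 1 it is identically 1, which
   is also its value at the removable singularity m = 1, where literal division would
   give 0 / 0 = 0. *)

definition sin_quotient :: "nat \<Rightarrow> nat \<Rightarrow> real" where
  "sin_quotient n m =
     (if n = 1 then 1 else sin (real n * pi / real m) / sin (pi / real m))"

end

theory Submission
  imports Defs "HOL-Computational_Algebra.Polynomial" "HOL-Combinatorics.Permutations"
begin

text \<open>Reducing the coordinates modulo \<open>m\<close> turns a walk into a sequence of \<open>n\<close>-subsets of
  \<open>{0..<m}\<close> in which one element at a time hops to a free neighbouring place. So the number of walks
  is \<open>A\<^sup>k 1\<close> evaluated at the set of coordinates of \<open>\<eta>\<close>, where \<open>A\<close> is the symmetric hopping
  matrix. The function \<open>v(T) = \<Prod> \<bar>sin (\<pi>(x - y)/m)\<bar>\<close> (over pairs in \<open>T\<close>) is a Vandermonde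
  product, hence an alternating sum of exponentials, and therefore an eigenfunction of \<open>A\<close> with
  eigenvalue \<open>\<mu> = 2 sin (n\<pi>/m) / sin (\<pi>/m)\<close>. Since \<open>v\<close> is positive and the hopping graph is connected, a
  Perron--Frobenius argument gives \<open>A\<^sup>k 1 \<sim> \<mu>\<^sup>k v \<Sum>v / \<Sum>v\<^sup>2\<close>, with a further term from the eigenfunction
  \<open>\<epsilon>v\<close>, \<open>\<epsilon>(T) = (-1)\<^bsup>\<Sum>T\<^esup>\<close>, of eigenvalue \<open>-\<mu>\<close> if \<open>m\<close> is even, when the graph is bipartite.

  The sum \<open>\<Sum>v\<^sup>2\<close> follows from orthogonality of characters. For \<open>\<Sum>v\<close> and \<open>\<Sum>\<epsilon>v\<close> write \<open>v\<close> on
  ordered tuples as the product of the sign of the ordering and the alternating sum of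
  exponentials. The sign satisfies a Pfaffian expansion along its first argument, and only
  conjugate pairs of frequencies survive the summation; each pair contributes a factor
  \<open>\<i> m cot\<close> (or \<open>-\<i> m tan\<close> in the presence of \<open>\<epsilon>\<close>).\<close>

section \<open>Iterates of a symmetric nonnegative matrix\<close>

text \<open>The claim is a limit of ratios, and for even \<open>m\<close> the bracket oscillates
  with \<open>k\<close>. Additive convergence of the scaled iterates therefore suffices only because
  the bracket stays away from 0; this is the strict inequality \<bar>\<Sum>\<epsilon>v\<bar> <
  \<Sum>v, true since \<open>v\<close> is positive and \<epsilon> takes both values. No spectral
  theorem is used: contraction needs a positive eigenfunction and one path length that serves all
  pairs of equal \<epsilon>. That \<open>v\<close> is an eigenfunction although occupied places are
  forbidden has two reasons: the Vandermonde product vanishes on collisions, and one step never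
  reverses its sign, so absolute values can be taken. The frequencies (n - 1)/2 - j are symmetric
  about 0. For even n they are half-integers, whence the angles (2h - 1)\<pi>/(2m); for odd n they
  are integers, whence h\<pi>/m, and the unpaired frequency 0 contributes a bare factor m, which
  changes the power of m. Two boundary cases stand apart: for n = m nothing can move and both sides
  are eventually 0; for n = 1, which includes m = 1, walks are counted directly.\<close>

definition mat_op :: "('a \<Rightarrow> 'a \<Rightarrow> real) \<Rightarrow> 'a set \<Rightarrow> ('a \<Rightarrow> real) \<Rightarrow> 'a \<Rightarrow> real" where
  "mat_op a X f x = (\<Sum>y\<in>X. a x y * f y)"

lemma mat_op_power_mono:
  assumes "\<And>x y. x \<in> X \<Longrightarrow> y \<in> X \<Longrightarrow> a x y \<ge> 0"
    and "\<And>x. x \<in> X \<Longrightarrow> f x \<le> g x" and "x \<in> X"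
  shows "(mat_op a X ^^ k) f x \<le> (mat_op a X ^^ k) g x"
  using assms(3)
proof (induction k arbitrary: x)
  case (Suc k)
  then show ?case
    unfolding funpow.simps o_apply mat_op_def[of _ _ "(mat_op a X ^^ k) _"]
    by (intro sum_mono mult_left_mono Suc.IH assms(1)) auto
qed (use assms in simp)

lemma mat_op_power_linear:
  "(mat_op a X ^^ k) (\<lambda>x. \<alpha> * f x + \<beta> * g x) x
     = \<alpha> * (mat_op a X ^^ k) f x + \<beta> * (mat_op a X ^^ k) g x"
  by (induction k arbitrary: x)
     (simp_all add: mat_op_def[of a X "(mat_op a X ^^ _) _"] sum.distrib sum_distrib_left algebra_simps)

lemma mat_op_power_eigen:
  assumes "\<And>x. x \<in> X \<Longrightarrow> mat_op a X v x = \<mu> * v x" and "x \<in> X"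
  shows "(mat_op a X ^^ k) v x = \<mu> ^ k * v x"
  using assms(2)
proof (induction k arbitrary: x)
  case (Suc k)
  have "mat_op a X ((mat_op a X ^^ k) v) x = mat_op a X (\<lambda>x. \<mu> ^ k * v x) x"
    unfolding mat_op_def[of _ _ _ x] using Suc by (intro sum.cong) auto
  also have "\<dots> = \<mu> ^ k * mat_op a X v x"
    by (simp add: mat_op_def sum_distrib_left algebra_simps)
  finally show ?case using assms(1)[OF Suc.prems] by simp
qed simp

lemma mat_op_adjoint:
  assumes "\<And>x y. x \<in> X \<Longrightarrow> y \<in> X \<Longrightarrow> a x y = a y x"
  shows "(\<Sum>x\<in>X. v x * mat_op a X f x) = (\<Sum>x\<in>X. mat_op a X v x * f x)"
proof -
  have "(\<Sum>x\<in>X. v x * mat_op a X f x) = (\<Sum>x\<in>X. \<Sum>y\<in>X. v x * a x y * f y)"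
    by (simp add: mat_op_def sum_distrib_left mult.assoc)
  also have "\<dots> = (\<Sum>y\<in>X. \<Sum>x\<in>X. v x * a x y * f y)"
    by (rule sum.swap)
  also have "\<dots> = (\<Sum>y\<in>X. mat_op a X v y * f y)"
    unfolding mat_op_def sum_distrib_right using assms by (intro sum.cong) auto
  finally show ?thesis .
qed

lemma mat_op_power_adjoint:
  assumes "\<And>x y. x \<in> X \<Longrightarrow> y \<in> X \<Longrightarrow> a x y = a y x"
  shows "(\<Sum>x\<in>X. v x * (mat_op a X ^^ k) f x) = (\<Sum>x\<in>X. (mat_op a X ^^ k) v x * f x)"
proof (induction k arbitrary: f)
  case (Suc k)
  have "(\<Sum>x\<in>X. v x * (mat_op a X ^^ Suc k) f x) = (\<Sum>x\<in>X. v x * (mat_op a X ^^ k) (mat_op a X f) x)"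
    by (simp add: funpow_swap1)
  also have "\<dots> = (\<Sum>x\<in>X. (mat_op a X ^^ k) v x * mat_op a X f x)"
    by (rule Suc)
  also have "\<dots> = (\<Sum>x\<in>X. (mat_op a X ^^ Suc k) v x * f x)"
    by (simp add: mat_op_adjoint[OF assms])
  finally show ?case .
qed simp

text \<open>A function orthogonal to \<open>v\<close> on each level set of \<open>\<epsilon>\<close> is contracted in the
  \<open>v\<close>-weighted \<open>L\<^sup>1\<close> norm: subtracting from the operator the rank-one pieces
  \<open>\<kappa> v(x) v(y)\<close> on the level sets keeps it nonnegative and does not change its value at \<open>g\<close>.\<close>

lemma weighted_L1_contraction:
  fixes v g :: "'a \<Rightarrow> real" and \<epsilon> :: "'a \<Rightarrow> 'b"
  assumes fin: "finite X" and sym: "\<And>x y. x \<in> X \<Longrightarrow> y \<in> X \<Longrightarrow> a x y = a y x"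
    and v: "\<And>x. x \<in> X \<Longrightarrow> w \<le> v x" and w: "0 < w" and \<kappa>: "0 \<le> \<kappa>"
    and eig: "\<And>x. x \<in> X \<Longrightarrow> mat_op a X v x = \<mu> * v x"
    and lower: "\<And>f x. x \<in> X \<Longrightarrow> (\<And>y. y \<in> X \<Longrightarrow> 0 \<le> f y) \<Longrightarrow>
       \<kappa> * v x * (\<Sum>y\<in>{y\<in>X. \<epsilon> y = \<epsilon> x}. v y * f y) \<le> (mat_op a X ^^ N) f x"
    and orth: "\<And>x. x \<in> X \<Longrightarrow> (\<Sum>y\<in>{y\<in>X. \<epsilon> y = \<epsilon> x}. v y * g y) = 0"
  shows "(\<Sum>x\<in>X. v x * \<bar>(mat_op a X ^^ N) g x\<bar>) \<le> (\<mu> ^ N - \<kappa> * w\<^sup>2) * (\<Sum>x\<in>X. v x * \<bar>g x\<bar>)"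
proof -
  let ?B = "mat_op a X ^^ N" and ?S = "\<lambda>f x. \<Sum>y\<in>{y\<in>X. \<epsilon> y = \<epsilon> x}. v y * f y"
  let ?p = "\<lambda>y. max (g y) 0" and ?q = "\<lambda>y. max (- g y) 0"
  have gpq: "g = (\<lambda>y. 1 * ?p y + (-1) * ?q y)" by auto
  have apq: "(\<lambda>y. \<bar>g y\<bar>) = (\<lambda>y. 1 * ?p y + 1 * ?q y)" by auto
  have pt: "\<bar>?B g x\<bar> \<le> ?B (\<lambda>y. \<bar>g y\<bar>) x - \<kappa> * v x * ?S (\<lambda>y. \<bar>g y\<bar>) x" if x: "x \<in> X" for x
  proof -
    have p: "\<kappa> * v x * ?S ?p x \<le> ?B ?p x" and q: "\<kappa> * v x * ?S ?q x \<le> ?B ?q x"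
      by (rule lower[OF x]; simp)+
    have "?S ?p x - ?S ?q x = ?S g x"
      by (subst (3) gpq) (simp add: sum_subtractf[symmetric] algebra_simps)
    \<comment> \<open>Orthogonality makes the level-set sums of the positive and negative parts
      equal, so the same amount c can be taken off both: \<bar>Bp - Bq\<bar> = \<bar>(Bp - c) - (Bq
      - c)\<bar> \<le> Bp + Bq - 2c.\<close>
    then have eq: "?S ?p x = ?S ?q x" using orth[OF x] by simp
    have "?S (\<lambda>y. \<bar>g y\<bar>) x = ?S ?p x + ?S ?q x"
      by (simp add: sum.distrib[symmetric] distrib_left[symmetric] abs_if max_def cong: if_cong) (intro sum.cong, auto)
    moreover have "?B (\<lambda>y. \<bar>g y\<bar>) x = ?B ?p x + ?B ?q x"
      by (subst apq, subst mat_op_power_linear) simp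
    moreover have "?B g x = ?B ?p x - ?B ?q x"
      by (subst gpq, subst mat_op_power_linear) simp
    ultimately show ?thesis using p q eq by (simp add: algebra_simps)
  qed
  have "(\<Sum>x\<in>X. v x * \<bar>?B g x\<bar>)
      \<le> (\<Sum>x\<in>X. v x * (?B (\<lambda>y. \<bar>g y\<bar>) x - \<kappa> * v x * ?S (\<lambda>y. \<bar>g y\<bar>) x))"
    using v w by (intro sum_mono mult_left_mono pt) force+
  also have "\<dots> \<le> (\<Sum>x\<in>X. v x * (?B (\<lambda>y. \<bar>g y\<bar>) x) - \<kappa> * w\<^sup>2 * (v x * \<bar>g x\<bar>))"
  proof (intro sum_mono)
    fix x assume x: "x \<in> X"
    \<comment> \<open>Of the level-set sum only the term at \<open>x\<close> itself is kept; this
      already gains a fixed fraction of the norm.\<close>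
    have "v x * \<bar>g x\<bar> \<le> ?S (\<lambda>y. \<bar>g y\<bar>) x"
    proof (rule member_le_sum)
      show "0 \<le> v y * \<bar>g y\<bar>" if "y \<in> {y \<in> X. \<epsilon> y = \<epsilon> x} - {x}" for y
        using that v[of y] w by auto
    qed (use x fin in auto)
    moreover have "w\<^sup>2 \<le> v x * v x"
      using v[OF x] w by (simp add: power2_eq_square mult_mono)
    moreover have "0 \<le> v x * \<bar>g x\<bar>" using v[OF x] w by auto
    ultimately have "w\<^sup>2 * (v x * \<bar>g x\<bar>) \<le> v x * v x * ?S (\<lambda>y. \<bar>g y\<bar>) x"
      by (intro mult_mono) auto
    then have "\<kappa> * (w\<^sup>2 * (v x * \<bar>g x\<bar>)) \<le> \<kappa> * (v x * v x * ?S (\<lambda>y. \<bar>g y\<bar>) x)"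
      using \<kappa> by (rule mult_left_mono)
    then show "v x * (?B (\<lambda>y. \<bar>g y\<bar>) x - \<kappa> * v x * ?S (\<lambda>y. \<bar>g y\<bar>) x)
        \<le> v x * (?B (\<lambda>y. \<bar>g y\<bar>) x) - \<kappa> * w\<^sup>2 * (v x * \<bar>g x\<bar>)"
      by (simp add: algebra_simps)
  qed
  also have "\<dots> = (\<Sum>x\<in>X. ?B v x * \<bar>g x\<bar>) - \<kappa> * w\<^sup>2 * (\<Sum>x\<in>X. v x * \<bar>g x\<bar>)"
    by (simp add: sum_subtractf sum_distrib_left mat_op_power_adjoint[OF sym])
  also have "(\<Sum>x\<in>X. ?B v x * \<bar>g x\<bar>) = \<mu> ^ N * (\<Sum>x\<in>X. v x * \<bar>g x\<bar>)"
    unfolding sum_distrib_left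
    by (intro sum.cong refl) (simp add: mat_op_power_eigen[where \<mu> = \<mu>] eig)
  finally show ?thesis by (simp add: algebra_simps)
qed

text \<open>The contraction is available only over \<open>N\<close> steps. Monotonicity supplies a
  limit \<open>l\<close> of the whole sequence, and then l \<le> \<rho> l with \<rho> < 1.\<close>

lemma contracting_seq_tendsto_0:
  fixes e :: "nat \<Rightarrow> real"
  assumes "\<And>k. 0 \<le> e k" and "\<And>k. e (Suc k) \<le> e k" and "\<And>k. e (k + N) \<le> \<rho> * e k" and "\<rho> < 1"
  shows "e \<longlonglongrightarrow> 0"
proof -
  have "decseq e" using assms(2) by (rule decseq_SucI)
  then obtain l where l: "e \<longlonglongrightarrow> l"
    using decseq_convergent[of e 0] assms(1) by blast
  have "(\<lambda>k. e (k + N)) \<longlonglongrightarrow> l" using l by (rule LIMSEQ_ignore_initial_segment)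
  moreover have "(\<lambda>k. \<rho> * e k) \<longlonglongrightarrow> \<rho> * l" using l by (rule tendsto_mult_left)
  ultimately have "l \<le> \<rho> * l" using assms(3) by (intro LIMSEQ_le) auto
  then have "(1 - \<rho>) * l \<le> 0" by (simp add: algebra_simps)
  then have "l \<le> 0" using assms(4) by (simp add: mult_le_0_iff)
  moreover have "0 \<le> l" using l assms(1) by (intro LIMSEQ_le_const) auto
  ultimately show ?thesis using l by simp
qed

text \<open>The indicator of the level set of \<open>x\<close> is (1 +
  \<epsilon>(x)\<epsilon>(y))/2. Hence orthogonality to \<open>v\<close> and to \<epsilon>v amounts
  to orthogonality on each level set.\<close>

lemma two_point_level_sum:
  fixes \<epsilon> h :: "'a \<Rightarrow> real"
  assumes "finite X" "\<And>x. x \<in> X \<Longrightarrow> \<epsilon> x = 1 \<or> \<epsilon> x = -1" "x \<in> X"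
  shows "2 * (\<Sum>y\<in>{y\<in>X. \<epsilon> y = \<epsilon> x}. h y) = (\<Sum>y\<in>X. h y) + \<epsilon> x * (\<Sum>y\<in>X. \<epsilon> y * h y)"
proof -
  have "(\<Sum>y\<in>X. h y) + \<epsilon> x * (\<Sum>y\<in>X. \<epsilon> y * h y) = (\<Sum>y\<in>X. h y + \<epsilon> x * \<epsilon> y * h y)"
    by (simp add: sum.distrib sum_distrib_left mult.assoc)
  also have "\<dots> = (\<Sum>y\<in>X. if \<epsilon> y = \<epsilon> x then 2 * h y else 0)"
    using assms(2)[OF assms(3)] assms(2) by (intro sum.cong refl) fastforce
  also have "\<dots> = (\<Sum>y\<in>{y\<in>X. \<epsilon> y = \<epsilon> x}. 2 * h y)"
    using assms(1) by (simp add: sum.inter_filter)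
  finally show ?thesis by (simp add: sum_distrib_left)
qed

text \<open>Replaces a spectral gap: by \<open>lower\<close>, two points of the same level set are
  joined with weight at least 1 in \<open>N\<close> steps, which gives a contraction. The second
  eigenvalue \<mu>' carries the orthogonality to \<epsilon>v along the iterates. A constant
  \<epsilon> is allowed; this is the case of odd \<open>m\<close>.\<close>

lemma mat_op_power_negligible:
  fixes v g \<epsilon> :: "'a \<Rightarrow> real"
  assumes fin: "finite X" and nonneg: "\<And>x y. x \<in> X \<Longrightarrow> y \<in> X \<Longrightarrow> 0 \<le> a x y"
    and sym: "\<And>x y. x \<in> X \<Longrightarrow> y \<in> X \<Longrightarrow> a x y = a y x"
    and v: "\<And>x. x \<in> X \<Longrightarrow> 0 < v x" and \<mu>: "0 < \<mu>"
    and eig: "\<And>x. x \<in> X \<Longrightarrow> mat_op a X v x = \<mu> * v x"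
    and \<epsilon>: "\<And>x. x \<in> X \<Longrightarrow> \<epsilon> x = 1 \<or> \<epsilon> x = -1"
    and eig': "\<And>x. x \<in> X \<Longrightarrow> mat_op a X (\<lambda>x. \<epsilon> x * v x) x = \<mu>' * (\<epsilon> x * v x)"
    and lower: "\<And>f x y. x \<in> X \<Longrightarrow> y \<in> X \<Longrightarrow> \<epsilon> y = \<epsilon> x \<Longrightarrow> (\<And>y. y \<in> X \<Longrightarrow> 0 \<le> f y) \<Longrightarrow>
       f y \<le> (mat_op a X ^^ N) f x"
    and orth: "(\<Sum>x\<in>X. v x * g x) = 0" "(\<Sum>x\<in>X. \<epsilon> x * v x * g x) = 0" and x0: "x0 \<in> X"
  shows "(\<lambda>k. (mat_op a X ^^ k) g x0 / \<mu> ^ k) \<longlonglongrightarrow> 0"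
proof -
  define w where "w = Min (v ` X)"
  define M where "M = Max (v ` X)"
  \<comment> \<open>With F the value of the \<open>N\<close>-step iterate at \<open>x\<close>, each
    f(y) in the level set is at most F, so v(x) \<Sum>v f \<le> M * card X * M * F; \<open>K\<close>
    is the reciprocal of that constant.\<close>
  define K where "K = 1 / (real (card X) * M\<^sup>2)"
  have w: "w \<le> v x" and M: "v x \<le> M" if "x \<in> X" for x
    using that fin by (auto simp: w_def M_def)
  have "w \<in> v ` X" unfolding w_def using fin x0 by (intro Min_in) auto
  then have w0: "0 < w" using v by auto
  have M0: "0 < M" using M[OF x0] v[OF x0] by simp
  have card0: "0 < card X" using fin x0 card_gt_0_iff by blast
  then have K0: "0 < K" using M0 by (simp add: K_def)
  have low: "K * v x * (\<Sum>y\<in>{y\<in>X. \<epsilon> y = \<epsilon> x}. v y * f y) \<le> (mat_op a X ^^ N) f x"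
    if x: "x \<in> X" and f: "\<And>y. y \<in> X \<Longrightarrow> 0 \<le> f y" for f x
  proof -
    let ?F = "(mat_op a X ^^ N) f x"
    have "f x \<le> ?F" by (rule lower[OF x x refl f])
    then have F0: "0 \<le> ?F" using f[OF x] by linarith
    have "(\<Sum>y\<in>{y\<in>X. \<epsilon> y = \<epsilon> x}. v y * f y) \<le> (\<Sum>y\<in>{y\<in>X. \<epsilon> y = \<epsilon> x}. M * ?F)"
      using M0 by (intro sum_mono mult_mono lower x M f) (auto intro: f)
    also have "\<dots> = real (card {y\<in>X. \<epsilon> y = \<epsilon> x}) * (M * ?F)" by simp
    also have "\<dots> \<le> real (card X) * (M * ?F)"
      using fin M0 F0 by (intro mult_right_mono of_nat_mono card_mono) auto
    finally have 1: "(\<Sum>y\<in>{y\<in>X. \<epsilon> y = \<epsilon> x}. v y * f y) \<le> real (card X) * (M * ?F)" .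
    have "v x * (\<Sum>y\<in>{y\<in>X. \<epsilon> y = \<epsilon> x}. v y * f y) \<le> M * (real (card X) * (M * ?F))"
      using M[OF x] v f M0 by (intro mult_mono 1 sum_nonneg mult_nonneg_nonneg) (auto simp: less_imp_le)
    then have "K * (v x * (\<Sum>y\<in>{y\<in>X. \<epsilon> y = \<epsilon> x}. v y * f y)) \<le> K * (M * (real (card X) * (M * ?F)))"
      using K0 by (intro mult_left_mono) auto
    also have "\<dots> = ?F" using M0 card0 by (simp add: K_def power2_eq_square field_simps)
    finally show ?thesis by (simp add: mult.assoc)
  qed
  define G where "G k = (mat_op a X ^^ k) g" for k
  have orthG: "(\<Sum>x\<in>X. v x * G k x) = 0" "(\<Sum>x\<in>X. \<epsilon> x * v x * G k x) = 0" for k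
  proof -
    have "(\<Sum>x\<in>X. v x * G k x) = \<mu> ^ k * (\<Sum>x\<in>X. v x * g x)"
      unfolding G_def sum_distrib_left
      by (subst mat_op_power_adjoint[OF sym])
         (auto intro!: sum.cong simp: mat_op_power_eigen[where \<mu> = \<mu>] eig)
    then show "(\<Sum>x\<in>X. v x * G k x) = 0" using orth by simp
    have "(\<Sum>x\<in>X. \<epsilon> x * v x * G k x) = \<mu>' ^ k * (\<Sum>x\<in>X. \<epsilon> x * v x * g x)"
      unfolding G_def sum_distrib_left
      by (subst mat_op_power_adjoint[OF sym])
         (auto intro!: sum.cong simp: mat_op_power_eigen[where \<mu> = \<mu>' and v = "\<lambda>x. \<epsilon> x * v x"] eig')
    then show "(\<Sum>x\<in>X. \<epsilon> x * v x * G k x) = 0" using orth by simp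
  qed
  \<comment> \<open>The weighted norm measured against the growth of \<open>v\<close> itself: since
    \<bar>A g\<bar> \<le> A\<bar>g\<bar> and \<open>A\<close> is self-adjoint, \<open>e\<close>
    cannot increase.\<close>
  define e where "e k = (\<Sum>x\<in>X. v x * \<bar>G k x\<bar>) / \<mu> ^ k" for k
  have "e \<longlonglongrightarrow> 0"
  proof (rule contracting_seq_tendsto_0)
    show "0 \<le> e k" for k
      using \<mu> v by (auto simp: e_def less_imp_le intro!: divide_nonneg_nonneg sum_nonneg mult_nonneg_nonneg)
    have orthl: "(\<Sum>y\<in>{y\<in>X. \<epsilon> y = \<epsilon> x}. v y * G k y) = 0" if "x \<in> X" for k x
    proof -
      have "2 * (\<Sum>y\<in>{y\<in>X. \<epsilon> y = \<epsilon> x}. v y * G k y)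
          = (\<Sum>y\<in>X. v y * G k y) + \<epsilon> x * (\<Sum>y\<in>X. \<epsilon> y * (v y * G k y))"
        by (rule two_point_level_sum[OF fin \<epsilon> that])
      then show ?thesis using orthG[of k] by (simp add: mult.assoc)
    qed
    have G1: "(\<Sum>x\<in>X. v x * \<bar>G (Suc k) x\<bar>) \<le> \<mu> * (\<Sum>x\<in>X. v x * \<bar>G k x\<bar>)" for k
    proof -
      have "(\<Sum>x\<in>X. v x * \<bar>G (Suc k) x\<bar>) \<le> (\<Sum>x\<in>X. v x * mat_op a X (\<lambda>y. \<bar>G k y\<bar>) x)"
      proof (intro sum_mono mult_left_mono)
        fix x assume x: "x \<in> X"
        have "\<bar>G (Suc k) x\<bar> = \<bar>\<Sum>y\<in>X. a x y * G k y\<bar>" by (simp add: G_def mat_op_def)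
        also have "\<dots> \<le> (\<Sum>y\<in>X. \<bar>a x y * G k y\<bar>)" by (rule sum_abs)
        also have "\<dots> = mat_op a X (\<lambda>y. \<bar>G k y\<bar>) x"
          unfolding mat_op_def using nonneg[OF x] by (intro sum.cong) (auto simp: abs_mult)
        finally show "\<bar>G (Suc k) x\<bar> \<le> mat_op a X (\<lambda>y. \<bar>G k y\<bar>) x" .
      qed (use v in \<open>auto simp: less_imp_le\<close>)
      also have "\<dots> = \<mu> * (\<Sum>x\<in>X. v x * \<bar>G k x\<bar>)"
        unfolding sum_distrib_left
        by (subst mat_op_adjoint[OF sym]) (auto intro!: sum.cong simp: eig)
      finally show ?thesis .
    qed
    show "e (Suc k) \<le> e k" for k
      using G1[of k] \<mu> by (simp add: e_def field_simps)
    show "e (k + N) \<le> (1 - K * w\<^sup>2 / \<mu> ^ N) * e k" for k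
    proof -
      have "(\<Sum>x\<in>X. v x * \<bar>(mat_op a X ^^ N) (G k) x\<bar>) \<le> (\<mu> ^ N - K * w\<^sup>2) * (\<Sum>x\<in>X. v x * \<bar>G k x\<bar>)"
        using K0 w0 by (intro weighted_L1_contraction[where \<epsilon> = \<epsilon>] fin sym w eig low orthl) auto
      then show ?thesis
        using \<mu> by (simp add: e_def G_def funpow_add add.commute[of k] power_add field_simps)
    qed
    show "1 - K * w\<^sup>2 / \<mu> ^ N < 1" using K0 w0 \<mu> by simp
  qed
  then have "(\<lambda>k. e k / v x0) \<longlonglongrightarrow> 0" using tendsto_divide_zero by blast
  moreover have "norm (G k x0 / \<mu> ^ k) \<le> e k / v x0" for k
  proof -
    have "v x0 * \<bar>G k x0\<bar> \<le> (\<Sum>x\<in>X. v x * \<bar>G k x\<bar>)"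
      using fin x0 v by (intro member_le_sum) (auto simp: less_imp_le)
    then show ?thesis using v[OF x0] \<mu> by (simp add: e_def abs_mult field_simps)
  qed
  ultimately have "(\<lambda>k. G k x0 / \<mu> ^ k) \<longlonglongrightarrow> 0"
    by (intro Lim_null_comparison[of "\<lambda>k. G k x0 / \<mu> ^ k" "\<lambda>k. e k / v x0"]) auto
  then show ?thesis by (simp add: G_def)
qed

section \<open>The Vandermonde product as an alternating sum\<close>

lemma alternating_sum_compose:
  fixes Z :: "nat \<Rightarrow> 'a::comm_ring_1"
  assumes t: "t permutes {..<n}"
  shows "(\<Sum>\<sigma> | \<sigma> permutes {..<n}. of_int (sign \<sigma>) * (\<Prod>i<n. Z (t i) ^ \<sigma> i))
    = of_int (sign t) * (\<Sum>\<sigma> | \<sigma> permutes {..<n}. of_int (sign \<sigma>) * (\<Prod>i<n. Z i ^ \<sigma> i))"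
proof -
  have "(\<Sum>\<sigma> | \<sigma> permutes {..<n}. of_int (sign \<sigma>) * (\<Prod>i<n. Z (t i) ^ \<sigma> i))
      = (\<Sum>\<sigma> | \<sigma> permutes {..<n}. of_int (sign (\<sigma> \<circ> t)) * (\<Prod>i<n. Z (t i) ^ (\<sigma> \<circ> t) i))"
    by (subst sum_permutations_compose_right[OF t]) simp
  also have "\<dots> = (\<Sum>\<sigma> | \<sigma> permutes {..<n}. of_int (sign t) * (of_int (sign \<sigma>) * (\<Prod>i<n. Z i ^ \<sigma> i)))"
  proof (intro sum.cong refl)
    fix \<sigma> assume "\<sigma> \<in> {\<sigma>. \<sigma> permutes {..<n}}"
    then have \<sigma>: "permutation \<sigma>" by (auto simp: permutation_permutes)
    have tp: "permutation t" using t by (auto simp: permutation_permutes)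
    have "(\<Prod>i<n. Z (t i) ^ (\<sigma> \<circ> t) i) = (\<Prod>i<n. Z i ^ \<sigma> i)"
      using prod.reindex_bij_betw[OF permutes_imp_bij[OF t], of "\<lambda>i. Z i ^ \<sigma> i"] by simp
    then show "of_int (sign (\<sigma> \<circ> t)) * (\<Prod>i<n. Z (t i) ^ (\<sigma> \<circ> t) i)
        = of_int (sign t) * (of_int (sign \<sigma>) * (\<Prod>i<n. Z i ^ \<sigma> i))"
      by (simp add: sign_compose[OF \<sigma> tp] ac_simps)
  qed
  finally show ?thesis by (simp add: sum_distrib_left)
qed

lemma alternating_sum_zero:
  fixes Z :: "nat \<Rightarrow> 'a::{idom,ring_char_0}"
  assumes "p < n" "q < n" "p \<noteq> q" "Z p = Z q"
  shows "(\<Sum>\<sigma> | \<sigma> permutes {..<n}. of_int (sign \<sigma>) * (\<Prod>i<n. Z i ^ \<sigma> i)) = 0" (is "?D Z = 0")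
proof -
  let ?t = "Transposition.transpose p q"
  have t: "?t permutes {..<n}" using assms by (intro permutes_swap_id) auto
  have "Z (?t i) = Z i" for i using assms(4) by (auto simp: Transposition.transpose_def)
  then have "?D Z = - ?D Z"
    using alternating_sum_compose[OF t, of Z] assms(3) by (simp add: sign_swap_id)
  moreover have "d = - d \<Longrightarrow> d = 0" for d :: 'a
    by (metis add.right_inverse mult_2 mult_eq_0_iff zero_neq_numeral)
  ultimately show ?thesis by blast
qed

lemma permutes_lessThan_Suc_fix:
  "{\<sigma>. \<sigma> permutes {..<Suc n} \<and> \<sigma> n = n} = {\<sigma>. \<sigma> permutes {..<n}}"
proof -
  have "\<sigma> permutes {..<Suc n} \<and> \<sigma> n = n" if "\<sigma> permutes {..<n}" for \<sigma>
    using permutes_subset[OF that, of "{..<Suc n}"] permutes_not_in[OF that, of n] by simp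
  moreover have "\<sigma> permutes {..<n}" if "\<sigma> permutes {..<Suc n}" "\<sigma> n = n" for \<sigma>
    by (rule permutes_superset[OF that(1)]) (use that(2) less_antisym in blast)
  ultimately show ?thesis by blast
qed

text \<open>In the induction step both sides are polynomials of degree at most \<open>n\<close> in
  the last variable, with equal coefficients at degree \<open>n\<close>, and both vanish at the
  nodes \<open>Z h\<close>, where the alternating sum has a repeated entry. If the nodes are not
  distinct, both sides are 0.\<close>

theorem vandermonde_alternating_sum:
  fixes Z :: "nat \<Rightarrow> 'a::{idom,ring_char_0}"
  shows "(\<Sum>\<sigma> | \<sigma> permutes {..<n}. of_int (sign \<sigma>) * (\<Prod>i<n. Z i ^ \<sigma> i))
    = (\<Prod>t<n. \<Prod>h<t. Z t - Z h)"
proof (induction n)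
  case (Suc n)
  define D where "D n Z = (\<Sum>\<sigma> | \<sigma> permutes {..<n}. of_int (sign \<sigma>) * (\<Prod>i<n. Z i ^ \<sigma> i))"
    for n and Z :: "nat \<Rightarrow> 'a"
  have IH: "D n Z = (\<Prod>t<n. \<Prod>h<t. Z t - Z h)" using Suc by (simp add: D_def)
  have "D (Suc n) Z = D n Z * (\<Prod>h<n. Z n - Z h)"
  proof (cases "inj_on Z {..<n}")
    case False
    then obtain p q where pq: "p < n" "q < n" "p \<noteq> q" "Z p = Z q" by (auto simp: inj_on_def)
    then have "D n Z = 0" "D (Suc n) Z = 0"
      unfolding D_def by (intro alternating_sum_zero[of p _ q]; simp)+
    then show ?thesis by simp
  next
    case True
    define P where "P = (\<Sum>\<sigma> | \<sigma> permutes {..<Suc n}.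
        monom (of_int (sign \<sigma>) * (\<Prod>i<n. Z i ^ \<sigma> i)) (\<sigma> n))"
    define Q where "Q = smult (D n Z) (\<Prod>h<n. [:- Z h, 1:])"
    have polyP: "poly P w = D (Suc n) (Z(n := w))" for w
      unfolding P_def D_def poly_sum
      by (intro sum.cong refl) (simp add: poly_monom lessThan_Suc algebra_simps)
    have "P = Q"
    proof (rule poly_eqI_degree_lead_coeff[where n = n and A = "Z ` {..<n}"])
      have fin: "finite {\<sigma>. \<sigma> permutes {..<Suc n}}" by (intro finite_permutations) simp
      \<comment> \<open>Degree \<open>n\<close> is reached only by permutations fixing
        \<open>n\<close>, that is, by the permutations of the first \<open>n\<close>
        indices.\<close>
      have "poly.coeff P n = (\<Sum>\<sigma> | \<sigma> permutes {..<Suc n}.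
          if \<sigma> n = n then of_int (sign \<sigma>) * (\<Prod>i<n. Z i ^ \<sigma> i) else 0)"
        by (simp add: P_def coeff_sum)
      also have "\<dots> = (\<Sum>\<sigma> | \<sigma> permutes {..<Suc n} \<and> \<sigma> n = n. of_int (sign \<sigma>) * (\<Prod>i<n. Z i ^ \<sigma> i))"
        using sum.inter_filter[OF fin, of "\<lambda>\<sigma>. of_int (sign \<sigma>) * (\<Prod>i<n. Z i ^ \<sigma> i)" "\<lambda>\<sigma>. \<sigma> n = n"]
        by simp
      also have "\<dots> = D n Z" by (simp add: permutes_lessThan_Suc_fix D_def)
      finally have 1: "poly.coeff P n = D n Z" .
      have deg: "degree (\<Prod>h<n. [:- Z h, 1:]) = n"
        by (subst degree_prod_eq_sum_degree) auto
      have "lead_coeff (\<Prod>h<n. [:- Z h, 1:]) = 1" by (simp add: lead_coeff_prod)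
      then show "poly.coeff P n = poly.coeff Q n" using 1 deg by (simp add: Q_def)
      show "degree Q \<le> n" unfolding Q_def using degree_smult_le deg by metis
      show "degree P \<le> n" unfolding P_def
      proof (intro degree_sum_le fin)
        fix \<sigma> assume "\<sigma> \<in> {\<sigma>. \<sigma> permutes {..<Suc n}}"
        then have "\<sigma> n \<le> n" using permutes_in_image[of \<sigma> "{..<Suc n}" n] by auto
        then show "degree (monom (of_int (sign \<sigma>) * (\<Prod>i<n. Z i ^ \<sigma> i)) (\<sigma> n)) \<le> n"
          using degree_monom_le order_trans by blast
      qed
      show "n \<le> card (Z ` {..<n})" using True by (simp add: card_image)
      fix z assume "z \<in> Z ` {..<n}"
      then obtain h where h: "h < n" "z = Z h" by auto
      have "poly P z = 0" unfolding polyP D_def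
        by (rule alternating_sum_zero[of h _ n]) (use h in auto)
      moreover have "poly Q z = 0" using h by (auto simp: Q_def poly_prod)
      ultimately show "poly P z = poly Q z" by simp
    qed
    then have "poly P (Z n) = poly Q (Z n)" by simp
    then show ?thesis by (simp add: polyP Q_def poly_prod)
  qed
  then have "D (Suc n) Z = (\<Prod>t<Suc n. \<Prod>h<t. Z t - Z h)" by (simp add: IH)
  then show ?case unfolding D_def .
qed simp

corollary vandermonde_permute:
  fixes Z :: "nat \<Rightarrow> 'a::{idom,ring_char_0}"
  assumes "p permutes {..<n}"
  shows "(\<Prod>t<n. \<Prod>h<t. Z (p t) - Z (p h)) = of_int (sign p) * (\<Prod>t<n. \<Prod>h<t. Z t - Z h)"
  using alternating_sum_compose[OF assms, of Z] by (simp add: vandermonde_alternating_sum)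

section \<open>Pfaffian expansion of the sign of an ordering\<close>

text \<open>Ranks are counted from the top, so adjoining a new minimum leaves the other ranks
  unchanged and appends one alternating sign.\<close>

lemma sum_alternating_rank:
  fixes S :: "int set"
  assumes "finite S"
  shows "(\<Sum>y\<in>S. (-1) ^ card {z\<in>S. y < z}) = (if odd (card S) then 1 else 0 :: int)"
  using assms
proof (induction rule: finite_linorder_min_induct)
  case (insert b S)
  have *: "{z \<in> insert b S. y < z} = {z\<in>S. y < z}" if "y \<in> S" for y using insert(2) that by force
  have **: "{z \<in> insert b S. b < z} = S" using insert(2) by auto
  have "b \<notin> S" using insert(2) by auto
  then show ?case using insert * ** by (simp cong: sum.cong)
qed simp

text \<open>For odd \<open>card S\<close> the correction disappears and the product of the signs
  against \<open>a\<close> becomes a sum. This is the source of the Pfaffian expansion;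
  \<open>a\<close> may itself lie in \<open>S\<close>.\<close>

lemma sum_sgn_alternating_rank:
  fixes S :: "int set"
  assumes "finite S"
  shows "(\<Sum>y\<in>S. sgn (a - y) * (-1) ^ card {z\<in>S. y < z})
    = (\<Prod>y\<in>S. sgn (a - y)) - (if even (card S) then 1 else 0)"
  using assms
proof (induction rule: finite_linorder_min_induct)
  case (insert b S)
  have *: "{z \<in> insert b S. y < z} = {z\<in>S. y < z}" if "y \<in> S" for y using insert(2) that by force
  have **: "{z \<in> insert b S. b < z} = S" using insert(2) by auto
  have b: "b \<notin> S" using insert(2) by auto
  have "(\<Prod>y\<in>S. sgn (a - y)) = (-1) ^ card S" if "a \<le> b"
  proof -
    have "(\<Prod>y\<in>S. sgn (a - y)) = (\<Prod>y\<in>S. -1)"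
      using that insert(2) by (intro prod.cong) (auto simp: sgn_if)
    then show ?thesis by simp
  qed
  moreover have "sgn (a - b) = 1" if "\<not> a \<le> b" using that by simp
  ultimately show ?case using insert b * ** by (cases "a \<le> b") (auto cong: sum.cong)
qed simp

text \<open>Normalised to be 1 on decreasing tuples, in agreement with the sines of x_h - x_t for h
  < t, and 0 on ties. The index set is arbitrary because the expansions delete indices.\<close>

definition ord_sign :: "nat set \<Rightarrow> (nat \<Rightarrow> int) \<Rightarrow> int" where
  "ord_sign I x = (\<Prod>t\<in>I. \<Prod>h\<in>{h\<in>I. h < t}. sgn (x h - x t))"

lemma ord_sign_cong: "(\<And>i. i \<in> I \<Longrightarrow> x i = y i) \<Longrightarrow> ord_sign I x = ord_sign I y"
  by (auto simp: ord_sign_def intro!: prod.cong)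

lemma ord_sign_zero:
  assumes "finite I" "p \<in> I" "q \<in> I" "p \<noteq> q" "x p = x q"
  shows "ord_sign I x = 0"
proof -
  have "ord_sign I x = 0" if "p \<in> I" "q \<in> I" "p < q" "x p = x q" for p q
  proof -
    have "(\<Prod>h\<in>{h\<in>I. h < q}. sgn (x h - x q)) = 0"
      using that assms(1) by (intro prod_zero bexI[of _ p]) auto
    then show ?thesis unfolding ord_sign_def by (intro prod_zero assms(1)) (use that in blast)
  qed
  then show ?thesis using assms by (metis linorder_less_linear)
qed

text \<open>Moving \<open>j\<close> in front of all other indices reverses exactly the factors with
  h < j, which accounts for the power of -1.\<close>

lemma ord_sign_remove:
  assumes fin: "finite I" and j: "j \<in> I"
  shows "ord_sign I x = (-1) ^ card {h\<in>I. h < j} * (\<Prod>h\<in>I - {j}. sgn (x j - x h)) * ord_sign (I - {j}) x"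
proof -
  let ?R = "I - {j}" and ?L = "{h\<in>I. h < j}" and ?U = "{h\<in>I. j < h}"
  have "ord_sign I x = (\<Prod>h\<in>?L. sgn (x h - x j)) * (\<Prod>t\<in>?R. \<Prod>h\<in>{h\<in>I. h < t}. sgn (x h - x t))"
    unfolding ord_sign_def by (subst prod.remove[OF fin j]) simp
  also have "(\<Prod>t\<in>?R. \<Prod>h\<in>{h\<in>I. h < t}. sgn (x h - x t))
      = (\<Prod>t\<in>?R. (if j < t then sgn (x j - x t) else 1) * (\<Prod>h\<in>{h\<in>?R. h < t}. sgn (x h - x t)))"
  proof (intro prod.cong refl)
    fix t assume "t \<in> ?R"
    show "(\<Prod>h\<in>{h\<in>I. h < t}. sgn (x h - x t))
      = (if j < t then sgn (x j - x t) else 1) * (\<Prod>h\<in>{h\<in>?R. h < t}. sgn (x h - x t))"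
    proof (cases "j < t")
      case True
      then have "{h\<in>I. h < t} = insert j {h\<in>?R. h < t}" using j by auto
      then show ?thesis using fin True by simp
    next
      case False
      then have "{h\<in>I. h < t} = {h\<in>?R. h < t}" by auto
      then show ?thesis using False by simp
    qed
  qed
  also have "\<dots> = (\<Prod>t\<in>?R. if j < t then sgn (x j - x t) else 1) * ord_sign ?R x"
    by (simp add: prod.distrib ord_sign_def)
  also have "(\<Prod>t\<in>?R. if j < t then sgn (x j - x t) else 1) = (\<Prod>t\<in>?U. sgn (x j - x t))"
    using fin by (subst prod.inter_filter[symmetric]) (auto intro!: prod.cong)
  finally have 1: "ord_sign I x
      = (\<Prod>h\<in>?L. sgn (x h - x j)) * ((\<Prod>t\<in>?U. sgn (x j - x t)) * ord_sign ?R x)" .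
  have "(\<Prod>h\<in>?L. sgn (x h - x j)) = (\<Prod>h\<in>?L. (-1) * sgn (x j - x h))"
    by (intro prod.cong refl) (auto simp: sgn_if)
  also have "\<dots> = (-1) ^ card ?L * (\<Prod>h\<in>?L. sgn (x j - x h))" unfolding prod.distrib by simp
  finally have 2: "(\<Prod>h\<in>?L. sgn (x h - x j)) = (-1) ^ card ?L * (\<Prod>h\<in>?L. sgn (x j - x h))" .
  have "?R = ?L \<union> ?U" by auto
  moreover have "(\<Prod>h\<in>?L \<union> ?U. sgn (x j - x h))
      = (\<Prod>h\<in>?L. sgn (x j - x h)) * (\<Prod>h\<in>?U. sgn (x j - x h))"
    using fin by (intro prod.union_disjoint) auto
  ultimately show ?thesis unfolding 1 2 by simp
qed

text \<open>Common engine of both expansions. For distinct values, deleting \<open>j\<close> changes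
  the sign by the product of sgn(x_j - x_h), which is -1 to the rank of x_j from the top. Tuples
  with ties are included, since sums over all tuples are expanded later.\<close>

lemma sum_ord_sign_remove:
  fixes \<phi> :: "int \<Rightarrow> int"
  assumes fin: "finite J"
  shows "(\<Sum>j\<in>J. (-1) ^ card {h\<in>J. h < j} * \<phi> (x j) * ord_sign (J - {j}) x)
    = ord_sign J x * (\<Sum>y\<in>x ` J. \<phi> y * (-1) ^ card {z\<in>x ` J. y < z})"
proof (cases "inj_on x J")
  case True
  have "(\<Sum>j\<in>J. (-1) ^ card {h\<in>J. h < j} * \<phi> (x j) * ord_sign (J - {j}) x)
     = (\<Sum>j\<in>J. ord_sign J x * (\<phi> (x j) * (-1) ^ card {z\<in>x ` J. x j < z}))"
  proof (intro sum.cong refl)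
    fix j assume j: "j \<in> J"
    let ?s = "(-1) ^ card {h\<in>J. h < j} :: int" and ?P = "\<Prod>h\<in>J - {j}. sgn (x j - x h)"
    have nz: "x h \<noteq> x j" if "h \<in> J - {j}" for h using True j that by (auto simp: inj_on_def)
    have "?P * ?P = (\<Prod>h\<in>J - {j}. sgn (x j - x h) * sgn (x j - x h))"
      unfolding prod.distrib ..
    also have "\<dots> = 1"
    proof (intro prod.neutral ballI)
      show "sgn (x j - x h) * sgn (x j - x h) = 1" if "h \<in> J - {j}" for h
        using nz[OF that] by (simp add: sgn_if)
    qed
    finally have PP: "?P * ?P = 1" .
    have ss: "?s * ?s = 1" by (simp flip: power_add mult_2)
    have "{z\<in>x ` J. x j < z} = x ` {h\<in>J - {j}. x j < x h}" by auto
    moreover have "inj_on x {h\<in>J - {j}. x j < x h}" using True by (auto simp: inj_on_def)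
    ultimately have "card {z\<in>x ` J. x j < z} = card {h\<in>J - {j}. x j < x h}" by (simp add: card_image)
    moreover have "?P = (\<Prod>h\<in>J - {j}. if x j < x h then -1 else 1)"
      using nz by (intro prod.cong refl) (metis diff_gt_0_iff_gt diff_less_0_iff_less linorder_less_linear sgn_neg sgn_pos)
    moreover have "\<dots> = (-1) ^ card {h\<in>J - {j}. x j < x h}"
      using fin by (subst prod.inter_filter[symmetric]) auto
    ultimately have P: "?P = (-1) ^ card {z\<in>x ` J. x j < z}" by simp
    have "ord_sign J x * ?P = (?s * ord_sign (J - {j}) x) * (?P * ?P)"
      using ord_sign_remove[OF fin j, of x] by (simp add: ac_simps)
    then have "ord_sign J x * ?P = ?s * ord_sign (J - {j}) x" using PP by simp
    then show "?s * \<phi> (x j) * ord_sign (J - {j}) x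
      = ord_sign J x * (\<phi> (x j) * (-1) ^ card {z\<in>x ` J. x j < z})"
      unfolding P by (simp add: ac_simps)
  qed
  also have "\<dots> = ord_sign J x * (\<Sum>y\<in>x ` J. \<phi> y * (-1) ^ card {z\<in>x ` J. y < z})"
    by (simp add: sum_distrib_left sum.reindex[OF True])
  finally show ?thesis .
next
  case False
  then obtain p q where pq: "p \<in> J" "q \<in> J" "p < q" "x p = x q"
    unfolding inj_on_def by (metis linorder_less_linear)
  let ?f = "\<lambda>j. (-1) ^ card {h\<in>J. h < j} * \<phi> (x j) * ord_sign (J - {j}) x"
  let ?K = "J - {p} - {q}"
  have "ord_sign (J - {j}) x = 0" if "j \<in> J - {p} - {q}" for j
    by (rule ord_sign_zero[of _ p q]) (use that pq fin in auto)
  \<comment> \<open>Any other deletion leaves the tie of \<open>p\<close> and \<open>q\<close>. The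
    two surviving terms have the same remaining factors because x p = x q, and opposite signs
    because deleting \<open>p\<close> lowers the position of \<open>q\<close> by one.\<close>
  then have "(\<Sum>j\<in>J. ?f j) = ?f p + ?f q"
    using fin pq by (subst sum.remove[of J p], simp, simp, subst sum.remove[of "J - {p}" q]) auto
  also have "\<dots> = 0"
  proof -
    have 1: "ord_sign (J - {p}) x = (-1) ^ card {h\<in>J - {p}. h < q} * (\<Prod>h\<in>?K. sgn (x q - x h)) * ord_sign ?K x"
      by (rule ord_sign_remove) (use fin pq in auto)
    have 2: "ord_sign (J - {q}) x
       = (-1) ^ card {h\<in>J - {q}. h < p} * (\<Prod>h\<in>J - {q} - {p}. sgn (x p - x h)) * ord_sign (J - {q} - {p}) x"
      by (rule ord_sign_remove) (use fin pq in auto)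
    have 3: "J - {q} - {p} = ?K" by auto
    have 4: "{h\<in>J - {q}. h < p} = {h\<in>J. h < p}" using pq by auto
    have "{h\<in>J. h < q} = insert p {h\<in>J - {p}. h < q}" using pq by auto
    then have 5: "card {h\<in>J. h < q} = Suc (card {h\<in>J - {p}. h < q})" using fin by simp
    show ?thesis unfolding 1 2 3 4 5 pq(4) by (simp add: algebra_simps)
  qed
  also have "\<dots> = ord_sign J x * (\<Sum>y\<in>x ` J. \<phi> y * (-1) ^ card {z\<in>x ` J. y < z})"
    using ord_sign_zero[OF fin, of p q x] pq by simp
  finally show ?thesis .
qed

lemma ord_sign_expand_odd:
  assumes fin: "finite I" and "odd (card I)"
  shows "ord_sign I x = (\<Sum>j\<in>I. (-1) ^ card {h\<in>I. h < j} * ord_sign (I - {j}) x)"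
proof -
  have "ord_sign I x * (\<Sum>y\<in>x ` I. (-1) ^ card {z\<in>x ` I. y < z}) = ord_sign I x"
  proof (cases "inj_on x I")
    case True
    then show ?thesis using assms by (subst sum_alternating_rank) (auto simp: card_image)
  next
    case False
    then show ?thesis using ord_sign_zero[OF fin] by (fastforce simp: inj_on_def)
  qed
  then show ?thesis using sum_ord_sign_remove[OF fin, of "\<lambda>_. 1" x] by simp
qed

text \<open>The weight is sgn(x_a - y). As \<open>a\<close> is the least index, splitting it off
  costs no sign, and its product of signs is a sum because \<open>card J\<close> is odd.\<close>

lemma ord_sign_expand_even:
  assumes fin: "finite J" and odd: "odd (card J)" and a: "\<And>j. j \<in> J \<Longrightarrow> a < j"
  shows "ord_sign (insert a J) x
    = (\<Sum>j\<in>J. (-1) ^ card {h\<in>J. h < j} * sgn (x a - x j) * ord_sign (J - {j}) x)"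
proof -
  have 0: "{h. (h = a \<or> h \<in> J) \<and> h < a} = {}" and "a \<notin> J" using a by force+
  then have "insert a J - {a} = J" by simp
  then have "ord_sign (insert a J) x = ord_sign J x * (\<Prod>j\<in>J. sgn (x a - x j))"
    using ord_sign_remove[of "insert a J" a x] fin 0 by simp
  also have "\<dots> = ord_sign J x * (\<Sum>y\<in>x ` J. sgn (x a - y) * (-1) ^ card {z\<in>x ` J. y < z})"
  proof (cases "inj_on x J")
    case True
    then show ?thesis using fin odd
      by (subst sum_sgn_alternating_rank) (auto simp: card_image prod.reindex)
  next
    case False
    then show ?thesis using ord_sign_zero[OF fin] by (fastforce simp: inj_on_def)
  qed
  also have "\<dots> = (\<Sum>j\<in>J. (-1) ^ card {h\<in>J. h < j} * sgn (x a - x j) * ord_sign (J - {j}) x)"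
    by (rule sum_ord_sign_remove[OF fin, symmetric])
  finally show ?thesis .
qed

lemma sum_PiE_insert:
  assumes "i \<notin> K"
  shows "(\<Sum>x\<in>PiE (insert i K) B. F x) = (\<Sum>y\<in>B i. \<Sum>x\<in>PiE K B. F (x(i := y)))"
proof -
  have "(\<Sum>x\<in>PiE (insert i K) B. F x) = (\<Sum>(y, x)\<in>B i \<times> PiE K B. F (x(i := y)))"
    unfolding PiE_insert_eq
    by (subst sum.reindex) (use inj_combinator[OF assms] in \<open>auto simp: case_prod_unfold\<close>)
  then show ?thesis by (simp add: sum.cartesian_product)
qed

text \<open>For even \<open>card I\<close> the expansions below identify this with the Pfaffian of
  the skew matrix of \<open>pair_sum m (z i) (z j)\<close>, a discrete form of de Bruijn's
  formula.\<close>

definition ordered_sum :: "nat \<Rightarrow> nat set \<Rightarrow> (nat \<Rightarrow> complex) \<Rightarrow> complex" where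
  "ordered_sum m I z = (\<Sum>x\<in>I \<rightarrow>\<^sub>E {0..<int m}. of_int (ord_sign I x) * (\<Prod>i\<in>I. z i powi x i))"

definition pair_sum :: "nat \<Rightarrow> complex \<Rightarrow> complex \<Rightarrow> complex" where
  "pair_sum m z w = (\<Sum>x\<in>{0..<int m}. \<Sum>y\<in>{0..<int m}. of_int (sgn (x - y)) * z powi x * w powi y)"

lemma ordered_sum_odd:
  assumes fin: "finite I" and "odd (card I)"
  shows "ordered_sum m I z
    = (\<Sum>j\<in>I. (-1) ^ card {h\<in>I. h < j} * (\<Sum>y\<in>{0..<int m}. z j powi y) * ordered_sum m (I - {j}) z)"
proof -
  have "ordered_sum m I z = (\<Sum>j\<in>I. \<Sum>x\<in>I \<rightarrow>\<^sub>E {0..<int m}.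
      of_int ((-1) ^ card {h\<in>I. h < j} * ord_sign (I - {j}) x) * (\<Prod>i\<in>I. z i powi x i))"
    unfolding ordered_sum_def ord_sign_expand_odd[OF assms] of_int_sum sum_distrib_right
    by (rule sum.swap)
  also have "\<dots> = (\<Sum>j\<in>I. (-1) ^ card {h\<in>I. h < j} * (\<Sum>y\<in>{0..<int m}. z j powi y) * ordered_sum m (I - {j}) z)"
  proof (intro sum.cong refl)
    fix j assume j: "j \<in> I"
    let ?K = "I - {j}" and ?s = "(-1) ^ card {h\<in>I. h < j}"
    have I: "I = insert j ?K" using j by auto
    have "(\<Sum>x\<in>I \<rightarrow>\<^sub>E {0..<int m}. of_int (?s * ord_sign ?K x) * (\<Prod>i\<in>I. z i powi x i))
      = (\<Sum>x\<in>insert j ?K \<rightarrow>\<^sub>E {0..<int m}. ?s * of_int (ord_sign ?K x) * (z j powi x j * (\<Prod>i\<in>?K. z i powi x i)))"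
      using prod.remove[OF fin j] I by (intro sum.cong) auto
    also have "\<dots> = (\<Sum>y\<in>{0..<int m}. \<Sum>x\<in>?K \<rightarrow>\<^sub>E {0..<int m}.
        ?s * z j powi y * (of_int (ord_sign ?K x) * (\<Prod>i\<in>?K. z i powi x i)))"
    proof (subst sum_PiE_insert, simp, intro sum.cong refl, goal_cases)
      case (1 y x)
      have "ord_sign ?K (x(j := y)) = ord_sign ?K x" by (rule ord_sign_cong) auto
      moreover have "(\<Prod>i\<in>?K. z i powi (x(j := y)) i) = (\<Prod>i\<in>?K. z i powi x i)" by (rule prod.cong) auto
      ultimately show ?case by (simp only: fun_upd_same ac_simps)
    qed
    also have "\<dots> = ?s * (\<Sum>y\<in>{0..<int m}. z j powi y) * ordered_sum m ?K z"
      by (simp add: ordered_sum_def sum_distrib_left sum_distrib_right mult.assoc sum.swap[of _ "{0..<int m}"])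
    finally show "(\<Sum>x\<in>I \<rightarrow>\<^sub>E {0..<int m}. of_int (?s * ord_sign ?K x) * (\<Prod>i\<in>I. z i powi x i))
      = ?s * (\<Sum>y\<in>{0..<int m}. z j powi y) * ordered_sum m ?K z" .
  qed
  finally show ?thesis .
qed

lemma ordered_sum_even:
  assumes fin: "finite J" and "odd (card J)" and a: "\<And>j. j \<in> J \<Longrightarrow> a < j"
  shows "ordered_sum m (insert a J) z
    = (\<Sum>j\<in>J. (-1) ^ card {h\<in>J. h < j} * pair_sum m (z a) (z j) * ordered_sum m (J - {j}) z)"
proof -
  have aJ: "a \<notin> J" using a by auto
  have "ordered_sum m (insert a J) z = (\<Sum>j\<in>J. \<Sum>x\<in>insert a J \<rightarrow>\<^sub>E {0..<int m}.
      of_int ((-1) ^ card {h\<in>J. h < j} * sgn (x a - x j) * ord_sign (J - {j}) x) * (\<Prod>i\<in>insert a J. z i powi x i))"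
  proof -
    have e: "ord_sign (insert a J) x
        = (\<Sum>j\<in>J. (-1) ^ card {h\<in>J. h < j} * sgn (x a - x j) * ord_sign (J - {j}) x)" for x
      by (rule ord_sign_expand_even) (use assms in auto)
    show ?thesis unfolding ordered_sum_def e of_int_sum sum_distrib_right by (rule sum.swap)
  qed
  also have "\<dots> = (\<Sum>j\<in>J. (-1) ^ card {h\<in>J. h < j} * pair_sum m (z a) (z j) * ordered_sum m (J - {j}) z)"
  proof (intro sum.cong refl)
    fix j assume j: "j \<in> J"
    let ?K = "J - {j}" and ?s = "(-1) ^ card {h\<in>J. h < j}"
    have J: "insert a J = insert a (insert j ?K)" using j by auto
    have aj: "a \<noteq> j" "j \<notin> ?K" "a \<notin> insert j ?K" using aJ j by auto
    have "(\<Sum>x\<in>insert a J \<rightarrow>\<^sub>E {0..<int m}.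
        of_int (?s * sgn (x a - x j) * ord_sign ?K x) * (\<Prod>i\<in>insert a J. z i powi x i))
      = (\<Sum>x\<in>insert a (insert j ?K) \<rightarrow>\<^sub>E {0..<int m}. ?s * of_int (sgn (x a - x j)) * of_int (ord_sign ?K x)
          * (z a powi x a * (z j powi x j * (\<Prod>i\<in>?K. z i powi x i))))"
    proof (intro sum.cong)
      have "(\<Prod>i\<in>insert a J. f i) = f a * (f j * (\<Prod>i\<in>?K. f i))" for f :: "nat \<Rightarrow> complex"
        using aJ fin by (simp add: prod.remove[OF fin j])
      then show "of_int (?s * sgn (x a - x j) * ord_sign ?K x) * (\<Prod>i\<in>insert a J. z i powi x i)
        = ?s * of_int (sgn (x a - x j)) * of_int (ord_sign ?K x)
          * (z a powi x a * (z j powi x j * (\<Prod>i\<in>?K. z i powi x i)))" for x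
        by simp
    qed (use J in simp)
    also have "\<dots> = (\<Sum>v\<in>{0..<int m}. \<Sum>w\<in>{0..<int m}. \<Sum>x\<in>?K \<rightarrow>\<^sub>E {0..<int m}.
        ?s * (of_int (sgn (v - w)) * z a powi v * z j powi w) * (of_int (ord_sign ?K x) * (\<Prod>i\<in>?K. z i powi x i)))"
    proof (subst sum_PiE_insert[OF aj(3)], subst sum_PiE_insert[OF aj(2)], intro sum.cong refl, goal_cases)
      case (1 v w x)
      let ?x = "x(j := w, a := v)"
      have "ord_sign ?K ?x = ord_sign ?K x" by (rule ord_sign_cong) (use aj in auto)
      moreover have "(\<Prod>i\<in>?K. z i powi ?x i) = (\<Prod>i\<in>?K. z i powi x i)" by (rule prod.cong) (use aj in auto)
      moreover have "?x a = v" "?x j = w" using aj by auto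
      ultimately show ?case by (simp only: ac_simps)
    qed
    also have "\<dots> = ?s * pair_sum m (z a) (z j) * ordered_sum m ?K z"
      unfolding ordered_sum_def pair_sum_def sum_distrib_left sum_distrib_right
      by (simp add: mult.assoc sum.swap[of _ "{0..<int m}" "?K \<rightarrow>\<^sub>E {0..<int m}"])
    finally show "(\<Sum>x\<in>insert a J \<rightarrow>\<^sub>E {0..<int m}.
        of_int (?s * sgn (x a - x j) * ord_sign ?K x) * (\<Prod>i\<in>insert a J. z i powi x i))
      = ?s * pair_sum m (z a) (z j) * ordered_sum m ?K z" .
  qed
  finally show ?thesis .
qed

section \<open>Frequency sums of Vandermonde products of sines\<close>

lemma sum_powi_int_lessThan:
  fixes f :: "int \<Rightarrow> 'a::comm_monoid_add"
  shows "(\<Sum>x\<in>{0..<int m}. f x) = (\<Sum>x<m. f (int x))"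
  by (rule sum.reindex_bij_witness[of _ int nat]) auto

text \<open>Two geometric sums, below and above \<open>y\<close>, with the denominator cleared so
  that z = 1 is harmless. The branch m \<le> y carries the induction on \<open>m\<close>.\<close>

lemma sum_sgn_geometric:
  fixes z :: complex
  shows "(z - 1) * (\<Sum>x<m. of_int (sgn (int x - int y)) * z ^ x)
     = (if m \<le> y then 1 - z ^ m else z ^ m + 1 - z ^ y * (z + 1))"
proof (induction m)
  case (Suc m)
  consider "Suc m \<le> y" | "m = y" | "y < m" by linarith
  then show ?case using Suc by cases (auto simp: algebra_simps)
qed simp

lemma sum_root_of_unity:
  fixes w :: complex
  assumes "w ^ m = 1"
  shows "(\<Sum>y<m. w ^ y) = (if w = 1 then of_nat m else 0)"
  using assms by (simp add: geometric_sum)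

text \<open>The inner sum is a constant plus a multiple of z^y. The constant part is killed by the
  sum over \<open>y\<close>, and the other leaves the sum of (zw)^y, where zw is an m-th root of
  unity.\<close>

lemma pair_sum_eval:
  fixes z w :: complex
  assumes "z ^ m = s" "w ^ m = s" "s * s = 1" "z \<noteq> 1" "w \<noteq> 1"
  shows "pair_sum m z w = (if z * w = 1 then - of_nat m * ((z + 1) / (z - 1)) else 0)"
proof -
  have "pair_sum m z w = (\<Sum>y<m. w ^ y * (\<Sum>x<m. of_int (sgn (int x - int y)) * z ^ x))"
    unfolding pair_sum_def sum_powi_int_lessThan
    by (subst sum.swap) (simp add: sum_distrib_left ac_simps)
  also have "\<dots> = (\<Sum>y<m. w ^ y * ((s + 1 - z ^ y * (z + 1)) / (z - 1)))"
  proof (intro sum.cong refl arg_cong2[of _ _ _ _ "(*)"])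
    fix y assume "y \<in> {..<m}"
    then show "(\<Sum>x<m. of_int (sgn (int x - int y)) * z ^ x) = (s + 1 - z ^ y * (z + 1)) / (z - 1)"
      using sum_sgn_geometric[where z = z and m = m and y = y] assms(1,4) by (auto simp: eq_divide_eq mult.commute)
  qed
  also have "\<dots> = (s + 1) / (z - 1) * (\<Sum>y<m. w ^ y) - (z + 1) / (z - 1) * (\<Sum>y<m. (z * w) ^ y)"
    unfolding sum_distrib_left sum_subtractf[symmetric]
    by (intro sum.cong refl) (simp add: power_mult_distrib diff_divide_distrib add_divide_distrib algebra_simps)
  \<comment> \<open>The geometric sum is (s - 1)/(w - 1), and (s + 1)(s - 1) = 0.\<close>
  also have "(s + 1) * (\<Sum>y<m. w ^ y) = 0"
    using assms by (simp add: geometric_sum algebra_simps)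
  then have "(s + 1) / (z - 1) * (\<Sum>y<m. w ^ y) = 0" by simp
  also have "(\<Sum>y<m. (z * w) ^ y) = (if z * w = 1 then of_nat m else 0)"
    by (rule sum_root_of_unity) (use assms in \<open>simp add: power_mult_distrib\<close>)
  finally show ?thesis by (auto split: if_splits)
qed

text \<open>The window from \<open>r\<close> to n - r shrinks symmetrically, so its least index
  \<open>r\<close> has exactly one possible partner, its largest index n - 1 - r. The Pfaffian thus
  reduces to a single product; the middle index of an odd \<open>n\<close> is left out.\<close>

lemma ordered_sum_pairing:
  assumes "\<And>i j. i < j \<Longrightarrow> j < n \<Longrightarrow> 2 * i + 1 \<noteq> n \<Longrightarrow> 2 * j + 1 \<noteq> n \<Longrightarrow> i + j + 1 \<noteq> n
      \<Longrightarrow> pair_sum m (z i) (z j) = 0"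
    and "r \<le> n div 2"
  defines "I \<equiv> \<lambda>r. {i\<in>{r..<n - r}. 2 * i + 1 \<noteq> n}"
  shows "even (card (I r)) \<and> ordered_sum m (I r) z = (\<Prod>i\<in>{r..<n div 2}. pair_sum m (z i) (z (n - 1 - i)))"
  using assms(2)
proof (induction r rule: inc_induct)
  case base
  have "I (n div 2) = {}" by (auto simp: I_def)
  then show ?case by (simp add: ordered_sum_def ord_sign_def)
next
  case (step r)
  define b where "b = n - 1 - r"
  define K where "K = I (Suc r)"
  define J where "J = insert b K"
  have r: "r < n div 2" "r < n" using step by auto
  have b: "r < b" "b < n" "2 * b + 1 \<noteq> n" using r by (auto simp: b_def)
  have bK: "b \<notin> K" and fin: "finite K" by (auto simp: K_def I_def b_def)
  have Kb: "r < j" "j < b" if "j \<in> K" for j using that r by (auto simp: K_def I_def b_def)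
  have Ir: "I r = insert r J" using r by (auto simp: I_def J_def K_def b_def)
  have K0: "{h. (h = b \<or> h \<in> K) \<and> h < b} = K" using Kb by auto
  have ev: "even (card K)" using step by (simp add: K_def)
  have rJ: "r < j" if "j \<in> J" for j using that b Kb by (auto simp: J_def)
  have zero: "pair_sum m (z r) (z j) = 0" if "j \<in> K" for j
  proof (rule assms(1))
    show "r < j" "j < n" "2 * j + 1 \<noteq> n" "2 * r + 1 \<noteq> n" "r + j + 1 \<noteq> n"
      using that r by (auto simp: K_def I_def)
  qed
  have "ordered_sum m (insert r J) z
    = (\<Sum>j\<in>J. (-1) ^ card {h\<in>J. h < j} * pair_sum m (z r) (z j) * ordered_sum m (J - {j}) z)"
    by (rule ordered_sum_even) (use fin ev bK rJ in \<open>auto simp: J_def\<close>)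
  \<comment> \<open>The sign is -1 to the number of indices strictly between the partners; that
    number is even, as they are themselves paired.\<close>
  also have "\<dots> = pair_sum m (z r) (z b) * ordered_sum m K z"
    using fin bK zero ev by (simp add: J_def K0)
  also have "\<dots> = pair_sum m (z r) (z (n - 1 - r)) * (\<Prod>i\<in>{Suc r..<n div 2}. pair_sum m (z i) (z (n - 1 - i)))"
    using step by (simp add: K_def b_def)
  also have "\<dots> = (\<Prod>i\<in>{r..<n div 2}. pair_sum m (z i) (z (n - 1 - i)))"
    using r by (simp add: prod.atLeast_Suc_lessThan)
  finally have "ordered_sum m (I r) z = (\<Prod>i\<in>{r..<n div 2}. pair_sum m (z i) (z (n - 1 - i)))"
    by (simp add: Ir)
  moreover have "even (card (I r))"
  proof -
    have "r \<notin> J" using rJ by auto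
    then show ?thesis using fin bK ev by (simp add: Ir J_def)
  qed
  ultimately show ?case by simp
qed

section \<open>Character expansion of the sine Vandermonde product and its first two moments\<close>

lemma sgn_prod: "sgn (prod f A) = (\<Prod>x\<in>A. sgn (f x :: 'a::linordered_idom))"
  by (induction A rule: infinite_finite_induct) (auto simp: sgn_mult)

text \<open>\<open>ord_sign\<close> is the sign of the Vandermonde product of the negated values,
  which is alternating.\<close>

lemma ord_sign_permute:
  assumes "p permutes {..<n}"
  shows "ord_sign {..<n} (x \<circ> p) = sign p * ord_sign {..<n} x"
proof -
  have *: "ord_sign {..<n} x = sgn (\<Prod>t<n. \<Prod>h<t. - x t - - x h)" for x
  proof -
    have "{h \<in> {..<n}. h < t} = {..<t}" if "t < n" for t using that by auto
    then show ?thesis by (simp add: ord_sign_def sgn_prod)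
  qed
  have "sgn (sign p) = sign p" by (rule sign_cases[of p]) auto
  then show ?thesis
    unfolding * using vandermonde_permute[OF assms, of "\<lambda>i. - x i"] by (simp add: sgn_mult)
qed

definition sin_vand :: "nat \<Rightarrow> nat \<Rightarrow> (nat \<Rightarrow> int) \<Rightarrow> real" where
  "sin_vand n m x = (\<Prod>t<n. \<Prod>h<t. sin (pi * real_of_int (x h - x t) / real m))"

text \<open>The frequencies are centred, so \<open>j\<close> and n - 1 - j give conjugate numbers.
  All are m-th roots of (-1)^(n - 1), and the middle one for odd \<open>n\<close> is 1.\<close>

definition spec_root :: "nat \<Rightarrow> nat \<Rightarrow> nat \<Rightarrow> complex" where
  "spec_root n m j = cis (pi * (real n - 1 - 2 * real j) / real m)"

lemma prod_pairs_const: "(\<Prod>t<n. \<Prod>h<t. c) = (c::'a::comm_monoid_mult) ^ (n choose 2)"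
  by (induction n) (simp_all add: numeral_2_eq_2 power_add mult.commute)

lemma prod_pairs_mult:
  fixes f :: "nat \<Rightarrow> 'a::comm_monoid_mult"
  shows "(\<Prod>t<n. \<Prod>h<t. f t * f h) = (\<Prod>i<n. f i ^ (n - 1))"
proof (induction n)
  case (Suc n)
  have "(\<Prod>t<Suc n. \<Prod>h<t. f t * f h) = (\<Prod>i<n. f i ^ (n - 1)) * (f n ^ n * (\<Prod>h<n. f h))"
    by (simp only: prod.lessThan_Suc Suc.IH) (simp add: prod.distrib)
  also have "\<dots> = (\<Prod>i<n. f i ^ (n - 1) * f i) * f n ^ n"
    by (simp add: prod.distrib ac_simps)
  also have "(\<Prod>i<n. f i ^ (n - 1) * f i) = (\<Prod>i<n. f i ^ n)"
    by (intro prod.cong refl power_minus_mult) auto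
  finally show ?case by simp
qed simp

text \<open>Up to the half-angle phases \<open>f\<close>, each sine is a difference of the unit
  numbers \<open>Z\<close>. Every index occurs in n - 1 pairs, and the resulting phase
  \<open>f i ^ (n - 1)\<close> shifts the frequency -2\<sigma>(i) to the centred n - 1 -
  2\<sigma>(i).\<close>

lemma sin_vand_alternating_sum:
  assumes "m > 0"
  shows "(2 * \<i>) ^ (n choose 2) * of_real (sin_vand n m x)
    = (\<Sum>\<sigma> | \<sigma> permutes {..<n}. of_int (sign \<sigma>) * (\<Prod>i<n. spec_root n m (\<sigma> i) powi x i))"
proof -
  define \<theta> where "\<theta> = pi / real m"
  define Z where "Z i = cis (- 2 * \<theta> * x i)" for i
  define f where "f i = cis (\<theta> * x i)" for i
  have factor: "2 * \<i> * of_real (sin (pi * real_of_int (x h - x t) / real m)) = f t * f h * (Z t - Z h)" for h t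
  proof -
    have "f t * f h * (Z t - Z h) = cis (\<theta> * (x h - x t)) - cis (- (\<theta> * (x h - x t)))"
      by (simp add: f_def Z_def right_diff_distrib cis_mult algebra_simps)
    also have "\<dots> = 2 * \<i> * of_real (sin (\<theta> * (x h - x t)))"
      by (simp add: complex_eq_iff)
    finally show ?thesis by (simp add: \<theta>_def)
  qed
  have "(2 * \<i>) ^ (n choose 2) * of_real (sin_vand n m x)
      = (\<Prod>t<n. \<Prod>h<t. 2 * \<i> * of_real (sin (pi * real_of_int (x h - x t) / real m)))"
    unfolding prod.distrib prod_pairs_const[symmetric] sin_vand_def by simp
  also have "\<dots> = (\<Prod>t<n. \<Prod>h<t. f t * f h) * (\<Prod>t<n. \<Prod>h<t. Z t - Z h)"
    unfolding factor prod.distrib by simp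
  also have "\<dots> = (\<Sum>\<sigma> | \<sigma> permutes {..<n}. of_int (sign \<sigma>) * (\<Prod>i<n. f i ^ (n - 1) * Z i ^ \<sigma> i))"
    by (simp only: prod_pairs_mult vandermonde_alternating_sum[symmetric])
       (simp add: sum_distrib_left prod.distrib ac_simps)
  also have "\<dots> = (\<Sum>\<sigma> | \<sigma> permutes {..<n}. of_int (sign \<sigma>) * (\<Prod>i<n. spec_root n m (\<sigma> i) powi x i))"
  proof (intro sum.cong refl arg_cong2[of _ _ _ _ "(*)"] prod.cong)
    fix \<sigma> i assume "i \<in> {..<n}"
    then have "real (n - 1) = real n - 1" by auto
    then show "f i ^ (n - 1) * Z i ^ \<sigma> i = spec_root n m (\<sigma> i) powi x i"
      by (simp add: f_def Z_def spec_root_def Complex.DeMoivre cis_mult cis_power_int \<theta>_def algebra_simps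
            diff_divide_distrib add_divide_distrib)
  qed
  finally show ?thesis .
qed

lemma cis_eq_1_small:
  assumes "cis a = 1" "\<bar>a\<bar> < 2 * pi"
  shows "a = 0"
proof -
  have "cos a = 1" using assms(1) by (metis Re_complex_of_real cis.sel(1) one_complex.sel(1))
  then obtain k :: int where k: "a = 2 * pi * of_int k" by (auto simp: cos_one_2pi_int)
  then have "2 * pi * \<bar>real_of_int k\<bar> < 2 * pi * 1" using assms(2) by (simp add: abs_mult)
  then have "\<bar>real_of_int k\<bar> < 1" by simp
  then have "k = 0" by linarith
  then show ?thesis using k by simp
qed

lemma spec_root_power:
  assumes "m > 0" "n > 0"
  shows "spec_root n m j ^ m = (-1) ^ (n - 1)"
proof -
  have "real n - 1 - 2 * real j = real (n - 1) - 2 * real j" using assms by auto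
  then have "real m * (pi * (real n - 1 - 2 * real j) / real m) = real (n - 1) * pi + - (2 * pi * real j)"
    using assms by (subst times_divide_eq_right, subst nonzero_mult_div_cancel_left) (auto simp: algebra_simps)
  then have "spec_root n m j ^ m = cis (real (n - 1) * pi) * cis (- (2 * pi * real j))"
    by (simp only: spec_root_def Complex.DeMoivre cis_mult)
  also have "cis (real (n - 1) * pi) = (-1) ^ (n - 1)" by (simp flip: Complex.DeMoivre)
  also have "cis (- (2 * pi * real j)) = 1"
    using cis_multiple_2pi[of "- real j"] by simp
  finally show ?thesis by simp
qed

text \<open>The ratio of two roots is an m-th root of unity with exponent b - a; n \<le> m keeps
  \<bar>b - a\<bar> < m, so it is 1 only for a = b.\<close>

lemma sum_powi_spec_root:
  assumes m: "m > 0" and "n \<le> m" "a < n" "b < n"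
  shows "(\<Sum>y\<in>{0..<int m}. spec_root n m a powi y * cnj (spec_root n m b powi y)) = (if a = b then of_nat m else 0)"
proof -
  define w where "w = cis (2 * pi * (real b - real a) / real m)"
  have w: "spec_root n m a powi int y * cnj (spec_root n m b powi int y) = w ^ y" for y
    by (simp add: spec_root_def w_def cis_power_int Complex.DeMoivre cis_cnj cis_mult algebra_simps
         diff_divide_distrib add_divide_distrib)
  have "w ^ m = cis (2 * pi * real_of_int (int b - int a))" using m by (simp add: w_def Complex.DeMoivre)
  then have "w ^ m = 1" using cis_multiple_2pi[of "real_of_int (int b - int a)"] by simp
  moreover have "w = 1 \<longleftrightarrow> a = b"
  proof
    assume "w = 1"
    moreover have "\<bar>real b - real a\<bar> / real m < 1" using assms by (auto simp: divide_less_eq abs_if)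
    then have "2 * pi * (\<bar>real b - real a\<bar> / real m) < 2 * pi * 1" by (intro mult_strict_left_mono) auto
    then have "\<bar>2 * pi * (real b - real a) / real m\<bar> < 2 * pi" by (simp add: abs_mult abs_divide)
    ultimately have "2 * pi * (real b - real a) / real m = 0" unfolding w_def by (rule cis_eq_1_small)
    then show "a = b" using m by simp
  qed (simp add: w_def)
  ultimately show ?thesis
    unfolding sum_powi_int_lessThan w by (simp add: sum_root_of_unity)
qed

text \<open>Each product of two terms of the alternating sum factorises over the coordinates, so
  only the \<open>fact n\<close> diagonal terms survive, each equal to m^n. The power of 4 is the
  squared modulus of the prefactor 2\<i>.\<close>

theorem sum_sin_vand_square:
  assumes "0 < n" "n \<le> m"
  shows "4 ^ (n choose 2) * (\<Sum>x\<in>{..<n} \<rightarrow>\<^sub>E {0..<int m}. (sin_vand n m x)\<^sup>2) = fact n * real m ^ n"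
proof -
  let ?P = "{\<sigma>. \<sigma> permutes {..<n}}" and ?X = "{..<n} \<rightarrow>\<^sub>E {0..<int m}" and ?z = "spec_root n m"
  let ?C = "n choose 2"
  have m: "m > 0" using assms by simp
  have "of_real (4 ^ ?C * (sin_vand n m x)\<^sup>2)
    = (\<Sum>\<sigma>\<in>?P. \<Sum>\<tau>\<in>?P. of_int (sign \<sigma> * sign \<tau>) * (\<Prod>i<n. ?z (\<sigma> i) powi x i * cnj (?z (\<tau> i) powi x i)))" for x
  proof -
    let ?L = "(2 * \<i>) ^ ?C * of_real (sin_vand n m x)"
    have "of_real (4 ^ ?C * (sin_vand n m x)\<^sup>2) = ?L * cnj ?L"
    proof -
      have "((2::real) ^ ?C)\<^sup>2 = 4 ^ ?C" by (simp add: power2_eq_square flip: power_mult_distrib)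
      then have "(norm ?L)\<^sup>2 = 4 ^ ?C * (sin_vand n m x)\<^sup>2"
        by (simp add: norm_mult norm_power power_mult_distrib)
      then show ?thesis by (metis complex_norm_square)
    qed
    also have "\<dots> = (\<Sum>\<sigma>\<in>?P. of_int (sign \<sigma>) * (\<Prod>i<n. ?z (\<sigma> i) powi x i))
        * (\<Sum>\<tau>\<in>?P. of_int (sign \<tau>) * (\<Prod>i<n. cnj (?z (\<tau> i) powi x i)))"
      unfolding sin_vand_alternating_sum[OF m] cnj_sum complex_cnj_mult cnj_prod by simp
    finally show ?thesis
      by (simp add: sum_product prod.distrib ac_simps)
  qed
  then have "of_real (4 ^ ?C * (\<Sum>x\<in>?X. (sin_vand n m x)\<^sup>2))
    = (\<Sum>x\<in>?X. \<Sum>\<sigma>\<in>?P. \<Sum>\<tau>\<in>?P. of_int (sign \<sigma> * sign \<tau>) * (\<Prod>i<n. ?z (\<sigma> i) powi x i * cnj (?z (\<tau> i) powi x i)))"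
    by (simp add: sum_distrib_left)
  also have "\<dots> = (\<Sum>\<sigma>\<in>?P. \<Sum>\<tau>\<in>?P. of_int (sign \<sigma> * sign \<tau>) *
      (\<Sum>x\<in>?X. \<Prod>i<n. ?z (\<sigma> i) powi x i * cnj (?z (\<tau> i) powi x i)))"
    unfolding sum_distrib_left by (subst sum.swap, subst (2) sum.swap) simp
  also have "\<dots> = (\<Sum>\<sigma>\<in>?P. \<Sum>\<tau>\<in>?P. if \<sigma> = \<tau> then of_nat m ^ n else 0)"
  proof (intro sum.cong refl)
    fix \<sigma> \<tau> assume st: "\<sigma> \<in> ?P" "\<tau> \<in> ?P"
    have "(\<Sum>x\<in>?X. \<Prod>i<n. ?z (\<sigma> i) powi x i * cnj (?z (\<tau> i) powi x i))
      = (\<Prod>i<n. \<Sum>y\<in>{0..<int m}. ?z (\<sigma> i) powi y * cnj (?z (\<tau> i) powi y))"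
      by (rule prod_sum_PiE[symmetric]) auto
    also have "\<dots> = (\<Prod>i<n. if \<sigma> i = \<tau> i then of_nat m else 0)"
    proof (intro prod.cong refl)
      fix i assume "i \<in> {..<n}"
      then have "\<sigma> i < n" "\<tau> i < n" using st permutes_in_image[of _ "{..<n}" i] by auto
      then show "(\<Sum>y\<in>{0..<int m}. ?z (\<sigma> i) powi y * cnj (?z (\<tau> i) powi y)) = (if \<sigma> i = \<tau> i then of_nat m else 0)"
        by (rule sum_powi_spec_root[OF m assms(2)])
    qed
    also have "\<dots> = (if \<sigma> = \<tau> then of_nat m ^ n else 0)"
    proof (cases "\<sigma> = \<tau>")
      case False
      then obtain i where i: "\<sigma> i \<noteq> \<tau> i" by auto
      have "i < n"
      proof (rule ccontr)
        assume "\<not> i < n"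
        then have "i \<notin> {..<n}" by simp
        then show False using st i permutes_not_in[of \<sigma> "{..<n}" i] permutes_not_in[of \<tau> "{..<n}" i] by simp
      qed
      then have "(\<Prod>i<n. if \<sigma> i = \<tau> i then of_nat m else (0::complex)) = 0"
        using i by (intro prod_zero bexI[of _ i]) auto
      then show ?thesis using False by simp
    qed simp
    finally show "of_int (sign \<sigma> * sign \<tau>) * (\<Sum>x\<in>?X. \<Prod>i<n. ?z (\<sigma> i) powi x i * cnj (?z (\<tau> i) powi x i))
      = (if \<sigma> = \<tau> then of_nat m ^ n else 0)"
      by (cases "\<sigma> = \<tau>") simp_all
  qed
  also have "\<dots> = of_real (fact n * real m ^ n)"
    by (simp add: finite_permutations card_permutations)
  finally show ?thesis by (simp only: of_real_eq_iff)
qed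

text \<open>Representatives in 0..<m differ by less than \<open>m\<close>, and there the sine of
  \<pi>d/m has the sign of \<open>d\<close>.\<close>

lemma abs_sin_vand:
  assumes "m > 0" and "x \<in> {..<n} \<rightarrow>\<^sub>E {0..<int m}"
  shows "\<bar>sin_vand n m x\<bar> = of_int (ord_sign {..<n} x) * sin_vand n m x"
proof -
  have *: "{h \<in> {..<n}. h < t} = {..<t}" if "t < n" for t using that by auto
  have s: "of_int (sgn d) * sin (pi * real_of_int d / real m) = \<bar>sin (pi * real_of_int d / real m)\<bar>"
    if "\<bar>d\<bar> < int m" for d
  proof -
    have "0 < sin (pi * e / real m)" if "0 < e" "e < real m" for e
      using that assms(1) by (intro sin_gt_zero) (auto simp: field_simps)
    from this[of d] this[of "-d"] show ?thesis
      using that by (cases d "0::int" rule: linorder_cases) auto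
  qed
  have "\<bar>sin_vand n m x\<bar> = (\<Prod>t<n. \<Prod>h<t. of_int (sgn (x h - x t)) * sin (pi * real_of_int (x h - x t) / real m))"
    unfolding sin_vand_def abs_prod
  proof (intro prod.cong refl)
    fix t h assume "t \<in> {..<n}" "h \<in> {..<t}"
    then have "x t \<in> {0..<int m}" "x h \<in> {0..<int m}" using assms(2) by (auto simp: PiE_iff)
    then show "\<bar>sin (pi * real_of_int (x h - x t) / real m)\<bar>
      = of_int (sgn (x h - x t)) * sin (pi * real_of_int (x h - x t) / real m)"
      by (intro s[symmetric]) auto
  qed
  also have "\<dots> = of_int (ord_sign {..<n} x) * sin_vand n m x"
  proof -
    have "ord_sign {..<n} x = (\<Prod>t<n. \<Prod>h<t. sgn (x h - x t))"
      unfolding ord_sign_def by (intro prod.cong) (auto simp: *)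
    then show ?thesis by (simp add: prod.distrib sin_vand_def)
  qed
  finally show ?thesis .
qed

text \<open>All permutations contribute equally: relabelling the coordinates multiplies
  \<open>ord_sign\<close> by the sign of \<sigma>, which cancels the sign in the alternating sum.
  The values \<xi> = 1 and \<xi> = -1 give the plain and the signed sum.\<close>

theorem sum_abs_sin_vand:
  fixes \<xi> :: complex
  assumes "m > 0"
  shows "(2 * \<i>) ^ (n choose 2) * (\<Sum>x\<in>{..<n} \<rightarrow>\<^sub>E {0..<int m}. (\<Prod>i<n. \<xi> powi x i) * of_real \<bar>sin_vand n m x\<bar>)
    = fact n * ordered_sum m {..<n} (\<lambda>j. \<xi> * spec_root n m j)"
proof -
  let ?P = "{\<sigma>. \<sigma> permutes {..<n}}" and ?X = "{..<n} \<rightarrow>\<^sub>E {0..<int m}"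
  let ?z = "\<lambda>j. \<xi> * spec_root n m j"
  have "(2 * \<i>) ^ (n choose 2) * (\<Sum>x\<in>?X. (\<Prod>i<n. \<xi> powi x i) * of_real \<bar>sin_vand n m x\<bar>)
    = (\<Sum>x\<in>?X. \<Sum>\<sigma>\<in>?P. of_int (sign \<sigma>) * (of_int (ord_sign {..<n} x) * (\<Prod>i<n. ?z (\<sigma> i) powi x i)))"
    unfolding sum_distrib_left
  proof (intro sum.cong refl, goal_cases)
    case (1 x)
    have "(2 * \<i>) ^ (n choose 2) * ((\<Prod>i<n. \<xi> powi x i) * of_real \<bar>sin_vand n m x\<bar>)
      = of_int (ord_sign {..<n} x) * (\<Prod>i<n. \<xi> powi x i) * ((2 * \<i>) ^ (n choose 2) * of_real (sin_vand n m x))"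
      by (simp add: abs_sin_vand[OF assms 1])
    also have "\<dots> = (\<Sum>\<sigma>\<in>?P. of_int (sign \<sigma>) * (of_int (ord_sign {..<n} x) * (\<Prod>i<n. ?z (\<sigma> i) powi x i)))"
      unfolding sin_vand_alternating_sum[OF assms] power_int_mult_distrib prod.distrib sum_distrib_left
      by (simp add: ac_simps)
    finally show ?case by (simp add: sum_distrib_left)
  qed
  also have "\<dots> = (\<Sum>\<sigma>\<in>?P. \<Sum>x\<in>?X. of_int (sign \<sigma>) * (of_int (ord_sign {..<n} x) * (\<Prod>i<n. ?z (\<sigma> i) powi x i)))"
    by (rule sum.swap)
  also have "\<dots> = (\<Sum>\<sigma>\<in>?P. ordered_sum m {..<n} ?z)"
  proof (intro sum.cong refl)
    fix \<sigma> assume "\<sigma> \<in> ?P"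
    then have \<sigma>: "\<sigma> permutes {..<n}" by simp
    have \<sigma>': "inv \<sigma> permutes {..<n}" by (rule permutes_inv[OF \<sigma>])
    have in_X: "x \<circ> p \<in> ?X" if "p permutes {..<n}" "x \<in> ?X" for x p
      using that permutes_in_image[OF that(1)] permutes_not_in[OF that(1)]
      by (auto simp: PiE_iff extensional_def)
    show "(\<Sum>x\<in>?X. of_int (sign \<sigma>) * (of_int (ord_sign {..<n} x) * (\<Prod>i<n. ?z (\<sigma> i) powi x i)))
      = ordered_sum m {..<n} ?z"
      unfolding ordered_sum_def
    proof (rule sum.reindex_bij_witness[where i = "\<lambda>x. x \<circ> \<sigma>" and j = "\<lambda>x. x \<circ> inv \<sigma>"], goal_cases)
      case (5 x)
      have "(\<Prod>i<n. ?z i powi (x \<circ> inv \<sigma>) i) = (\<Prod>i<n. ?z (\<sigma> i) powi x i)"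
        using prod.reindex_bij_betw[OF permutes_imp_bij[OF \<sigma>], of "\<lambda>i. ?z i powi (x \<circ> inv \<sigma>) i"]
        by (simp add: permutes_inverses(2)[OF \<sigma>])
      moreover have "ord_sign {..<n} (x \<circ> inv \<sigma>) = sign \<sigma> * ord_sign {..<n} x"
        using ord_sign_permute[OF \<sigma>'] sign_inverse[of \<sigma>] \<sigma> by (auto simp: permutation_permutes)
      ultimately show ?case by simp
    qed (use in_X \<sigma> \<sigma>' permutes_inv_o[OF \<sigma>] in \<open>auto simp: o_assoc[symmetric]\<close>)
  qed
  also have "\<dots> = fact n * ordered_sum m {..<n} ?z" by (simp add: card_permutations)
  finally show ?thesis .
qed

section \<open>Cayley transforms of the frequencies and closed forms of the sums\<close>

lemma cis_half_angle:
  "cis a + 1 = 2 * of_real (cos (a / 2)) * cis (a / 2)" "cis a - 1 = 2 * \<i> * of_real (sin (a / 2)) * cis (a / 2)"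
  using cos_double_cos[of "a / 2"] cos_double_sin[of "a / 2"] sin_double[of "a / 2"]
  by (simp_all add: complex_eq_iff power2_eq_square)

text \<open>No side condition: at a zero of the sine both sides are 0 by the convention on division
  by 0.\<close>

lemma cayley_cis: "(cis a + 1) / (cis a - 1) = - \<i> * of_real (cot (a / 2))"
  unfolding cis_half_angle cot_def by (cases "sin (a / 2) = 0") (simp_all add: field_simps)

lemma cayley_minus_cis: "(- cis a + 1) / (- cis a - 1) = \<i> * of_real (tan (a / 2))"
proof -
  have "(- cis a + 1) / (- cis a - 1) = (- (cis a - 1)) / (- (cis a + 1))" by simp
  also have "\<dots> = (cis a - 1) / (cis a + 1)" by (rule minus_divide_divide)
  also have "\<dots> = \<i> * of_real (tan (a / 2))" 
    unfolding cis_half_angle tan_def by (cases "cos (a / 2) = 0") (simp_all add: field_simps)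
  finally show ?thesis .
qed

lemma cis_small:
  assumes "\<bar>a\<bar> < pi"
  shows "cis a = 1 \<longleftrightarrow> a = 0" "cis a \<noteq> -1"
proof -
  show "cis a = 1 \<longleftrightarrow> a = 0" using cis_eq_1_small[of a] assms by auto
  show "cis a \<noteq> -1"
  proof
    assume "cis a = -1"
    then have "cis (a + pi) = 1" by (simp flip: cis_mult)
    then have "a + pi = 0" by (rule cis_eq_1_small) (use assms in linarith)
    then show False using assms by linarith
  qed
qed

lemma spec_root_mult:
  "spec_root n m i * spec_root n m j = cis (2 * pi * (real n - 1 - real i - real j) / real m)"
  by (simp add: spec_root_def cis_mult add_divide_distrib[symmetric] algebra_simps)

lemma spec_root_mult_eq_1:
  assumes "m > 0" "n \<le> m" "i < n" "j < n"
  shows "spec_root n m i * spec_root n m j = 1 \<longleftrightarrow> i + j + 1 = n"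
proof
  assume 1: "spec_root n m i * spec_root n m j = 1"
  have "\<bar>real n - 1 - real i - real j\<bar> / real m < 1" using assms by (auto simp: divide_less_eq abs_if)
  then have "2 * pi * (\<bar>real n - 1 - real i - real j\<bar> / real m) < 2 * pi * 1" by (intro mult_strict_left_mono) auto
  then have "\<bar>2 * pi * (real n - 1 - real i - real j) / real m\<bar> < 2 * pi" by (simp add: abs_mult abs_divide)
  with 1 have "2 * pi * (real n - 1 - real i - real j) / real m = 0"
    unfolding spec_root_mult by (intro cis_eq_1_small)
  then show "i + j + 1 = n" using assms(1) by simp
next
  assume "i + j + 1 = n"
  then have "real n = real i + real j + 1" by linarith
  then show "spec_root n m i * spec_root n m j = 1" by (simp add: spec_root_mult)
qed

lemma spec_root_angle_bound:
  assumes "m > 0" "n \<le> m" "j < n"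
  shows "\<bar>pi * (real n - 1 - 2 * real j) / real m\<bar> < pi"
proof -
  have "\<bar>real n - 1 - 2 * real j\<bar> / real m < 1" using assms by (auto simp: divide_less_eq abs_if)
  then have "pi * (\<bar>real n - 1 - 2 * real j\<bar> / real m) < pi * 1" by (intro mult_strict_left_mono) auto
  then show ?thesis by (simp add: abs_mult abs_divide)
qed

lemma spec_root_eq_1:
  assumes "m > 0" "n \<le> m" "j < n"
  shows "spec_root n m j = 1 \<longleftrightarrow> 2 * j + 1 = n"
proof -
  have "spec_root n m j = 1 \<longleftrightarrow> real n - 1 - 2 * real j = 0"
    unfolding spec_root_def cis_small(1)[OF spec_root_angle_bound[OF assms]] using assms(1) by simp
  then show ?thesis by linarith
qed

lemma spec_root_neq_minus_1:
  assumes "m > 0" "n \<le> m" "j < n"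
  shows "spec_root n m j \<noteq> -1"
  unfolding spec_root_def by (rule cis_small(2)[OF spec_root_angle_bound[OF assms]])

lemma minus_spec_root_neq_1:
  assumes "m > 0" "n \<le> m" "j < n"
  shows "- spec_root n m j \<noteq> 1"
  using spec_root_neq_minus_1[OF assms] by (metis minus_minus)

text \<open>The prefactor (2\<i>)^(n choose 2) must match one factor \<i> per conjugate pair. For
  odd \<open>n\<close> the extra (-1)^a is the sign of deleting the middle index. The first identity
  rests on (2a choose 2) = a + 4 (a choose 2).\<close>

lemma imaginary_power_choose_2:
  "\<i> ^ (2 * a choose 2) = \<i> ^ a" "\<i> ^ (Suc (2 * a) choose 2) = (-1) ^ a * \<i> ^ a"
proof -
  have two: "2 * (a choose 2) + a = a * a"
    by (induction a) (auto simp: numeral_2_eq_2)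
  have "2 * (2 * a choose 2) + 2 * a = 2 * a * (2 * a)"
    by (induction a) (auto simp: numeral_2_eq_2)
  then have even: "2 * a choose 2 = a + 4 * (a choose 2)" using two by simp
  then show "\<i> ^ (2 * a choose 2) = \<i> ^ a" by (simp add: power_add power_mult)
  have "Suc (2 * a) choose 2 = 2 * a + (2 * a choose 2)" by (simp add: numeral_2_eq_2)
  then have "Suc (2 * a) choose 2 = 3 * a + 4 * (a choose 2)" using even by simp
  then have "\<i> ^ (Suc (2 * a) choose 2) = (\<i> ^ 3) ^ a" by (simp add: power_add power_mult)
  also have "\<dots> = ((-1) * \<i>) ^ a" by (simp add: eval_nat_numeral)
  finally show "\<i> ^ (Suc (2 * a) choose 2) = (-1) ^ a * \<i> ^ a" by (simp only: power_mult_distrib)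
qed

text \<open>Twisting by \<xi> = -1 leaves the pairing unchanged because \<xi>^2 = 1, and leaves the
  common m-th power unchanged because \<open>m\<close> is even; only the Cayley factors
  differ.\<close>

lemma ordered_sum_spec_root_pairs:
  assumes n: "0 < n" "n \<le> m" and \<xi>: "\<xi> = 1 \<or> (\<xi> = -1 \<and> even m \<and> even n)"
  defines "w \<equiv> \<lambda>j. \<xi> * spec_root n m j"
  shows "ordered_sum m {i\<in>{0..<n}. 2 * i + 1 \<noteq> n} w = (\<Prod>i<n div 2. - of_nat m * ((w i + 1) / (w i - 1)))"
proof -
  have m: "m > 0" using n by simp
  have \<xi>2: "\<xi> * \<xi> = 1" using \<xi> by auto
  have ww: "w i * w j = spec_root n m i * spec_root n m j" for i j
  proof -
    have "w i * w j = (\<xi> * \<xi>) * (spec_root n m i * spec_root n m j)" unfolding w_def by (simp only: ac_simps)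
    then show ?thesis by (simp only: \<xi>2 mult_1)
  qed
  have \<xi>m: "\<xi> ^ m = 1" using \<xi> by auto
  then have wm: "w j ^ m = (-1) ^ (n - 1)" for j
    by (simp add: w_def power_mult_distrib spec_root_power[OF m n(1)])
  have w1: "w j \<noteq> 1" if "j < n" "2 * j + 1 \<noteq> n" for j
    using \<xi> spec_root_eq_1[OF m n(2) that(1)] minus_spec_root_neq_1[OF m n(2) that(1)] that(2)
    by (auto simp: w_def)
  have pair: "pair_sum m (w i) (w j)
      = (if w i * w j = 1 then - of_nat m * ((w i + 1) / (w i - 1)) else 0)"
    if "i < n" "j < n" "2 * i + 1 \<noteq> n" "2 * j + 1 \<noteq> n" for i j
    by (rule pair_sum_eval[OF wm wm]) (use w1 that in \<open>auto simp flip: power_mult_distrib\<close>)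
  have "ordered_sum m {i\<in>{0..<n - 0}. 2 * i + 1 \<noteq> n} w
      = (\<Prod>i\<in>{0..<n div 2}. pair_sum m (w i) (w (n - 1 - i)))"
    by (rule ordered_sum_pairing[THEN conjunct2])
       (auto simp: pair ww spec_root_mult_eq_1[OF m n(2)])
  also have "\<dots> = (\<Prod>i<n div 2. - of_nat m * ((w i + 1) / (w i - 1)))"
  proof (intro prod.cong)
    fix i assume "i \<in> {..<n div 2}"
    then have i: "i < n" "n - 1 - i < n" "2 * i + 1 \<noteq> n" "2 * (n - 1 - i) + 1 \<noteq> n" "i + (n - 1 - i) + 1 = n"
      by auto
    then have "w i * w (n - 1 - i) = 1" unfolding ww by (subst spec_root_mult_eq_1[OF m n(2)])
    then show "pair_sum m (w i) (w (n - 1 - i)) = - of_nat m * ((w i + 1) / (w i - 1))"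
      using pair[OF i(1-4)] by simp
  qed auto
  finally show ?thesis by simp
qed

lemma spec_root_cayley:
  "- of_nat m * ((spec_root n m i + 1) / (spec_root n m i - 1))
     = of_real (real m * cot (pi * (real n - 1 - 2 * real i) / (2 * real m))) * \<i>"
  "- of_nat m * ((- spec_root n m i + 1) / (- spec_root n m i - 1))
     = of_real (- (real m * tan (pi * (real n - 1 - 2 * real i) / (2 * real m)))) * \<i>"
  unfolding spec_root_def cayley_cis cayley_minus_cis by (simp_all add: mult.commute)

lemma prod_reverse_odd:
  "(\<Prod>i<a. f (real (2 * a) - 1 - 2 * real i)) = (\<Prod>h=1..a. f (2 * real h - 1))"
  by (rule prod.reindex_bij_witness[of _ "\<lambda>h. a - h" "\<lambda>i. a - i"]) (auto simp: of_nat_diff algebra_simps)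

lemma prod_reverse_even:
  "(\<Prod>i<a. f (real (Suc (2 * a)) - 1 - 2 * real i)) = (\<Prod>h=1..a. f (2 * real h))"
  by (rule prod.reindex_bij_witness[of _ "\<lambda>h. a - h" "\<lambda>i. a - i"]) (auto simp: of_nat_diff algebra_simps)

context
  fixes n m :: nat
  assumes n: "0 < n" "n \<le> m"
begin

lemma m_pos: "m > 0" using n by simp

lemma sum_sin_vand_complex_imp_real:
  assumes "(2 * \<i>) ^ (n choose 2) * of_real s = c * \<i> ^ (n choose 2) * of_real r" "c = of_real c'"
  shows "2 ^ (n choose 2) * s = c' * r"
proof -
  have "\<i> ^ (n choose 2) * (2 ^ (n choose 2) * of_real s) = \<i> ^ (n choose 2) * (of_real c' * of_real r)"
    using assms by (simp add: power_mult_distrib ac_simps)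
  then have "2 ^ (n choose 2) * complex_of_real s = of_real c' * of_real r" by simp
  then have "complex_of_real (2 ^ (n choose 2) * s) = of_real (c' * r)" by simp
  then show ?thesis by (simp only: of_real_eq_iff)
qed

theorem sum_abs_sin_vand_even:
  assumes "even n"
  shows "2 ^ (n choose 2) * (\<Sum>x\<in>{..<n} \<rightarrow>\<^sub>E {0..<int m}. \<bar>sin_vand n m x\<bar>)
    = fact n * (real m ^ (n div 2) * (\<Prod>h=1..n div 2. cot ((2 * real h - 1) * pi / (2 * real m))))"
proof -
  obtain a where a: "n = 2 * a" using assms by auto
  have I: "{i\<in>{0..<n}. 2 * i + 1 \<noteq> n} = {..<n}" using a by auto presburger
  let ?K = "\<Prod>h=1..a. cot ((2 * real h - 1) * pi / (2 * real m))"
  have "(2 * \<i>) ^ (n choose 2) * of_real (\<Sum>x\<in>{..<n} \<rightarrow>\<^sub>E {0..<int m}. \<bar>sin_vand n m x\<bar>)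
      = fact n * ordered_sum m {..<n} (\<lambda>j. 1 * spec_root n m j)"
    using sum_abs_sin_vand[OF m_pos, of n 1] by simp
  also have "ordered_sum m {..<n} (\<lambda>j. 1 * spec_root n m j)
      = (\<Prod>i<a. of_real (real m * cot (pi * (real n - 1 - 2 * real i) / (2 * real m))) * \<i>)"
    using ordered_sum_spec_root_pairs[OF n, of 1] unfolding I mult_1 spec_root_cayley by (simp add: a)
  also have "\<dots> = of_real (real m ^ a * (\<Prod>i<a. cot (pi * (real (2 * a) - 1 - 2 * real i) / (2 * real m)))) * \<i> ^ a"
    by (simp add: prod.distrib a)
  also have "(\<Prod>i<a. cot (pi * (real (2 * a) - 1 - 2 * real i) / (2 * real m))) = ?K"
    by (subst prod_reverse_odd) (simp add: mult.commute)
  finally have "(2 * \<i>) ^ (n choose 2) * of_real (\<Sum>x\<in>{..<n} \<rightarrow>\<^sub>E {0..<int m}. \<bar>sin_vand n m x\<bar>)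
      = fact n * \<i> ^ (n choose 2) * of_real (real m ^ a * ?K)"
    using imaginary_power_choose_2(1)[of a] by (simp add: a)
  then have "2 ^ (n choose 2) * (\<Sum>x\<in>{..<n} \<rightarrow>\<^sub>E {0..<int m}. \<bar>sin_vand n m x\<bar>) = fact n * (real m ^ a * ?K)"
    by (rule sum_sin_vand_complex_imp_real) simp
  then show ?thesis by (simp add: a)
qed

theorem sum_signed_sin_vand_even:
  assumes "even n" "even m"
  shows "2 ^ (n choose 2) * (\<Sum>x\<in>{..<n} \<rightarrow>\<^sub>E {0..<int m}. (\<Prod>i<n. (-1) powi x i) * \<bar>sin_vand n m x\<bar>)
    = fact n * (real m ^ (n div 2) * ((-1) ^ (n div 2) * (\<Prod>h=1..n div 2. tan ((2 * real h - 1) * pi / (2 * real m)))))"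
proof -
  obtain a where a: "n = 2 * a" using assms by auto
  have I: "{i\<in>{0..<n}. 2 * i + 1 \<noteq> n} = {..<n}" using a by auto presburger
  let ?K = "\<Prod>h=1..a. tan ((2 * real h - 1) * pi / (2 * real m))"
  let ?S = "\<Sum>x\<in>{..<n} \<rightarrow>\<^sub>E {0..<int m}. (\<Prod>i<n. (-1) powi x i) * \<bar>sin_vand n m x\<bar>"
  have "(2 * \<i>) ^ (n choose 2) * of_real ?S = fact n * ordered_sum m {..<n} (\<lambda>j. - 1 * spec_root n m j)"
    using sum_abs_sin_vand[OF m_pos, of n "-1"] by (simp add: of_real_power_int)
  also have "ordered_sum m {..<n} (\<lambda>j. - 1 * spec_root n m j)
      = (\<Prod>i<a. of_real (- (real m * tan (pi * (real n - 1 - 2 * real i) / (2 * real m)))) * \<i>)"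
    using ordered_sum_spec_root_pairs[OF n, of "-1"] assms unfolding I mult_minus1 spec_root_cayley by (simp add: a)
  \<comment> \<open>Each Cayley factor now carries a minus sign; this is the origin of n/2 in the
    exponent of -1 of the final formula.\<close>
  also have "\<dots> = of_real (real m ^ a * ((-1) ^ a * (\<Prod>i<a. tan (pi * (real (2 * a) - 1 - 2 * real i) / (2 * real m))))) * \<i> ^ a"
    by (simp add: prod.distrib prod_uminus a)
  also have "(\<Prod>i<a. tan (pi * (real (2 * a) - 1 - 2 * real i) / (2 * real m))) = ?K"
    by (subst prod_reverse_odd) (simp add: mult.commute)
  finally have "(2 * \<i>) ^ (n choose 2) * of_real ?S = fact n * \<i> ^ (n choose 2) * of_real (real m ^ a * ((-1) ^ a * ?K))"
    using imaginary_power_choose_2(1)[of a] by (simp add: a)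
  then have "2 ^ (n choose 2) * ?S = fact n * (real m ^ a * ((-1) ^ a * ?K))"
    by (rule sum_sin_vand_complex_imp_real) simp
  then show ?thesis by (simp add: a)
qed

lemma sum_powi_signed_spec_root:
  assumes "j < n" "odd n" "\<xi> = 1 \<and> 2 * j + 1 \<noteq> n \<or> \<xi> = -1 \<and> even m"
  shows "(\<Sum>y\<in>{0..<int m}. (\<xi> * spec_root n m j) powi y) = 0"
proof -
  have "(\<xi> * spec_root n m j) ^ m = 1"
    using assms by (auto simp: power_mult_distrib spec_root_power[OF m_pos n(1)])
  moreover have "\<xi> * spec_root n m j \<noteq> 1"
    using assms spec_root_eq_1[OF m_pos n(2) assms(1)] minus_spec_root_neq_1[OF m_pos n(2) assms(1)]
    by auto
  ultimately show ?thesis unfolding sum_powi_int_lessThan by (simp add: sum_root_of_unity)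
qed

text \<open>The expansion for odd cardinality contains a one-variable sum in every term. With the
  twist the frequencies are m-th roots of unity different from 1, so all of these sums
  vanish.\<close>

theorem sum_signed_sin_vand_odd:
  assumes "odd n" "even m"
  shows "(\<Sum>x\<in>{..<n} \<rightarrow>\<^sub>E {0..<int m}. (\<Prod>i<n. (-1) powi x i) * \<bar>sin_vand n m x\<bar>) = 0" (is "?S = 0")
proof -
  have "(2 * \<i>) ^ (n choose 2) * of_real ?S = fact n * ordered_sum m {..<n} (\<lambda>j. - 1 * spec_root n m j)"
    using sum_abs_sin_vand[OF m_pos, of n "-1"] by (simp add: of_real_power_int)
  also have "ordered_sum m {..<n} (\<lambda>j. - 1 * spec_root n m j) = 0"
  proof -
    have "(\<Sum>y\<in>{0..<int m}. (- 1 * spec_root n m j) powi y) = 0" if "j \<in> {..<n}" for j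
      by (rule sum_powi_signed_spec_root) (use that assms in auto)
    then show ?thesis using assms by (subst ordered_sum_odd) simp_all
  qed
  finally show ?thesis by (simp only: mult_zero_right mult_eq_0_iff of_real_eq_0_iff power_eq_0_iff) simp
qed

theorem sum_abs_sin_vand_odd:
  assumes "odd n"
  shows "2 ^ (n choose 2) * (\<Sum>x\<in>{..<n} \<rightarrow>\<^sub>E {0..<int m}. \<bar>sin_vand n m x\<bar>)
    = fact n * (real m ^ ((n + 1) div 2) * (\<Prod>h=1..(n - 1) div 2. cot (real h * pi / real m)))"
proof -
  obtain a where a: "n = Suc (2 * a)" using assms by (auto elim: oddE)
  have I: "{i\<in>{0..<n}. 2 * i + 1 \<noteq> n} = {..<n} - {a}" using a by auto
  let ?K = "\<Prod>h=1..a. cot (real h * pi / real m)"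
  let ?z = "\<lambda>j. 1 * spec_root n m j"
  have "(2 * \<i>) ^ (n choose 2) * of_real (\<Sum>x\<in>{..<n} \<rightarrow>\<^sub>E {0..<int m}. \<bar>sin_vand n m x\<bar>)
      = fact n * ordered_sum m {..<n} ?z"
    using sum_abs_sin_vand[OF m_pos, of n 1] by simp
  also have "ordered_sum m {..<n} ?z
    = (\<Sum>j<n. (-1) ^ card {h\<in>{..<n}. h < j} * (\<Sum>y\<in>{0..<int m}. ?z j powi y) * ordered_sum m ({..<n} - {j}) ?z)"
    using assms by (intro ordered_sum_odd) auto
  \<comment> \<open>Only the middle index, of frequency 0, has a nonzero one-variable sum; that sum
    is \<open>m\<close>.\<close>
  also have "\<dots> = (-1) ^ card {h\<in>{..<n}. h < a} * (\<Sum>y\<in>{0..<int m}. ?z a powi y) * ordered_sum m ({..<n} - {a}) ?z"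
  proof (subst sum.remove[of "{..<n}" a])
    have "(\<Sum>y\<in>{0..<int m}. ?z j powi y) = 0" if "j \<in> {..<n} - {a}" for j
      by (rule sum_powi_signed_spec_root) (use that a in auto)
    then show "(-1) ^ card {h\<in>{..<n}. h < a} * (\<Sum>y\<in>{0..<int m}. ?z a powi y) * ordered_sum m ({..<n} - {a}) ?z
        + (\<Sum>j\<in>{..<n} - {a}. (-1) ^ card {h\<in>{..<n}. h < j} * (\<Sum>y\<in>{0..<int m}. ?z j powi y) * ordered_sum m ({..<n} - {j}) ?z)
      = (-1) ^ card {h\<in>{..<n}. h < a} * (\<Sum>y\<in>{0..<int m}. ?z a powi y) * ordered_sum m ({..<n} - {a}) ?z"
      by simp
  qed (auto simp: a)
  also have "{h\<in>{..<n}. h < a} = {..<a}" by (auto simp: a)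
  also have "(\<Sum>y\<in>{0..<int m}. ?z a powi y) = of_nat m"
    using spec_root_eq_1[OF m_pos n(2), of a] a by simp
  also have "ordered_sum m ({..<n} - {a}) ?z
      = (\<Prod>i<a. of_real (real m * cot (pi * (real n - 1 - 2 * real i) / (2 * real m))) * \<i>)"
    using ordered_sum_spec_root_pairs[OF n, of 1] unfolding I mult_1 spec_root_cayley by (simp add: a)
  also have "\<dots> = of_real (real m ^ a * (\<Prod>i<a. cot (pi * (real (Suc (2 * a)) - 1 - 2 * real i) / (2 * real m)))) * \<i> ^ a"
    by (simp add: prod.distrib a)
  also have "(\<Prod>i<a. cot (pi * (real (Suc (2 * a)) - 1 - 2 * real i) / (2 * real m))) = ?K"
    by (subst prod_reverse_even) (simp add: mult.commute)
  finally have "(2 * \<i>) ^ (n choose 2) * of_real (\<Sum>x\<in>{..<n} \<rightarrow>\<^sub>E {0..<int m}. \<bar>sin_vand n m x\<bar>)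
      = fact n * \<i> ^ (n choose 2) * of_real (real m ^ Suc a * ?K)"
    using imaginary_power_choose_2(2)[of a] by (simp add: a)
  then have "2 ^ (n choose 2) * (\<Sum>x\<in>{..<n} \<rightarrow>\<^sub>E {0..<int m}. \<bar>sin_vand n m x\<bar>) = fact n * (real m ^ Suc a * ?K)"
    by (rule sum_sin_vand_complex_imp_real) simp
  then show ?thesis by (simp add: a)
qed

end

section \<open>Configurations of particles on the circle\<close>

text \<open>The Dirichlet kernel: multiplication by the sine makes the sum telescope.\<close>

lemma sum_shifted_cos:
  "sin \<theta> * (\<Sum>j<n. 2 * cos (\<theta> * (real n - 1 - 2 * real j))) = 2 * sin (real n * \<theta>)"
proof -
  let ?f = "\<lambda>j. sin (\<theta> * (real n - 2 * real j))"
  have "sin \<theta> * (2 * cos (\<theta> * (real n - 1 - 2 * real j))) = ?f j - ?f (Suc j)" for j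
  proof -
    have "?f j = sin (\<theta> * (real n - 1 - 2 * real j) + \<theta>)" "?f (Suc j) = sin (\<theta> * (real n - 1 - 2 * real j) - \<theta>)"
      by (simp_all add: algebra_simps)
    then show ?thesis by (simp add: sin_add sin_diff)
  qed
  then have "sin \<theta> * (\<Sum>j<n. 2 * cos (\<theta> * (real n - 1 - 2 * real j))) = (\<Sum>j<n. ?f j - ?f (Suc j))"
    by (simp add: sum_distrib_left)
  also have "\<dots> = ?f 0 - ?f n" by (rule sum_lessThan_telescope')
  also have "\<dots> = 2 * sin (real n * \<theta>)"
    by (simp add: mult.commute flip: minus_mult_right)
  finally show ?thesis .
qed

lemma spec_root_add_inverse:
  "spec_root n m j + inverse (spec_root n m j) = of_real (2 * cos (pi / real m * (real n - 1 - 2 * real j)))"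
  by (simp add: spec_root_def complex_eq_iff)

lemma sum_spec_root_add_inverse:
  assumes "0 < n" "n \<le> m" "1 < m"
  shows "(\<Sum>j<n. spec_root n m j + inverse (spec_root n m j)) = of_real (2 * sin_quotient n m)"
proof -
  have s: "sin (pi / real m) > 0" using assms by (intro sin_gt_zero) (auto simp: divide_less_eq)
  have "(\<Sum>j<n. 2 * cos (pi / real m * (real n - 1 - 2 * real j))) = 2 * sin_quotient n m"
    using sum_shifted_cos[of "pi / real m" n] s by (auto simp: sin_quotient_def field_simps)
  then show ?thesis unfolding spec_root_add_inverse of_real_sum[symmetric] by (simp only:)
qed

text \<open>Every exponential term is an eigenfunction of the unrestricted step operator, with
  eigenvalue the sum of z + 1/z over all frequencies. That sum is symmetric in the frequencies,
  hence the same for every permutation.\<close>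

theorem sin_vand_eigen:
  assumes "0 < n" "n \<le> m" "1 < m"
  shows "(\<Sum>i<n. \<Sum>s\<in>{1, -1}. sin_vand n m (x(i := x i + s))) = 2 * sin_quotient n m * sin_vand n m x"
proof -
  let ?P = "{\<sigma>. \<sigma> permutes {..<n}}" and ?z = "spec_root n m" and ?c = "(2 * \<i>) ^ (n choose 2)"
  have m: "m > 0" using assms by simp
  have z0: "?z j \<noteq> 0" for j by (simp add: spec_root_def)
  have "?c * of_real (\<Sum>i<n. \<Sum>s\<in>{1, -1}. sin_vand n m (x(i := x i + s)))
      = (\<Sum>i<n. \<Sum>s\<in>{1, -1}. ?c * of_real (sin_vand n m (x(i := x i + s))))"
    unfolding of_real_sum sum_distrib_left ..
  also have "\<dots> = (\<Sum>i<n. \<Sum>s\<in>{1, -1}. \<Sum>\<sigma>\<in>?P. of_int (sign \<sigma>) * (\<Prod>k<n. ?z (\<sigma> k) powi x k) * ?z (\<sigma> i) powi s)"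
    unfolding sin_vand_alternating_sum[OF m]
  proof (intro sum.cong refl)
    fix i \<sigma> and s :: int assume i: "i \<in> {..<n}"
    have "(\<Prod>k<n. ?z (\<sigma> k) powi (x(i := x i + s)) k)
        = ?z (\<sigma> i) powi (x i + s) * (\<Prod>k\<in>{..<n} - {i}. ?z (\<sigma> k) powi x k)"
      using i by (subst prod.remove[of _ i]) (auto intro!: prod.cong)
    also have "\<dots> = (\<Prod>k<n. ?z (\<sigma> k) powi x k) * ?z (\<sigma> i) powi s"
      using i by (subst (2) prod.remove[of _ i]) (auto simp: power_int_add z0)
    finally show "of_int (sign \<sigma>) * (\<Prod>k<n. ?z (\<sigma> k) powi (x(i := x i + s)) k)
        = of_int (sign \<sigma>) * (\<Prod>k<n. ?z (\<sigma> k) powi x k) * ?z (\<sigma> i) powi s" by simp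
  qed
  also have "\<dots> = (\<Sum>i<n. \<Sum>\<sigma>\<in>?P. of_int (sign \<sigma>) * (\<Prod>k<n. ?z (\<sigma> k) powi x k) * (?z (\<sigma> i) + inverse (?z (\<sigma> i))))"
    by (simp add: sum.distrib distrib_left power_int_minus)
  also have "\<dots> = (\<Sum>\<sigma>\<in>?P. of_int (sign \<sigma>) * (\<Prod>k<n. ?z (\<sigma> k) powi x k) * (\<Sum>i<n. ?z (\<sigma> i) + inverse (?z (\<sigma> i))))"
    unfolding sum_distrib_left by (rule sum.swap)
  also have "\<dots> = (\<Sum>\<sigma>\<in>?P. of_int (sign \<sigma>) * (\<Prod>k<n. ?z (\<sigma> k) powi x k) * of_real (2 * sin_quotient n m))"
  proof (intro sum.cong refl arg_cong2[of _ _ _ _ "(*)"])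
    fix \<sigma> assume "\<sigma> \<in> ?P"
    then have "bij_betw \<sigma> {..<n} {..<n}" by (intro permutes_imp_bij) simp
    from sum.reindex_bij_betw[OF this, of "\<lambda>j. ?z j + inverse (?z j)"]
    show "(\<Sum>i<n. ?z (\<sigma> i) + inverse (?z (\<sigma> i))) = of_real (2 * sin_quotient n m)"
      using sum_spec_root_add_inverse[OF assms] by simp
  qed
  also have "\<dots> = ?c * of_real (2 * sin_quotient n m * sin_vand n m x)"
    unfolding sum_distrib_right[symmetric] sin_vand_alternating_sum[OF m, symmetric] by simp
  finally show ?thesis by (subst (asm) mult_cancel_left) (auto simp only: of_real_eq_iff, simp)
qed

lemma sin_pi_int_div_zero:
  assumes "m > 0" "d mod int m = 0"
  shows "sin (pi * real_of_int d / real m) = 0"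
proof -
  obtain k where "d = int m * k" using assms(2) by (auto elim: dvdE)
  then have "pi * real_of_int d / real m = of_int k * pi" using assms(1) by simp
  then show ?thesis by (simp add: sin_zero_iff_int2)
qed

lemma sin_vand_zero:
  assumes "m > 0" "p < n" "q < n" "p \<noteq> q" "x p mod int m = x q mod int m"
  shows "sin_vand n m x = 0"
proof -
  have "sin_vand n m x = 0" if "p < q" "q < n" "x p mod int m = x q mod int m" for p q
  proof -
    have "(x p - x q) mod int m = 0" using that(3) by (simp add: mod_eq_dvd_iff mod_eq_0_iff_dvd)
    then have "(\<Prod>h<q. sin (pi * real_of_int (x h - x q) / real m)) = 0"
      using that(1) by (intro prod_zero bexI[of _ p] sin_pi_int_div_zero assms) auto
    then show ?thesis unfolding sin_vand_def by (intro prod_zero) (use that(2) in blast)+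
  qed
  then show ?thesis using assms by (metis linorder_less_linear)
qed

lemma abs_sin_mod:
  assumes "m > 0" "a mod int m = b mod int m"
  shows "\<bar>sin (pi * real_of_int a / real m)\<bar> = \<bar>sin (pi * real_of_int b / real m)\<bar>"
proof -
  obtain k where "a = b + int m * k" using assms(2) by (metis mod_eqE)
  then have "pi * real_of_int a / real m = pi * real_of_int b / real m + of_int k * pi"
    using assms(1) by (simp add: field_simps)
  moreover have "sin (of_int k * pi) = 0" by (simp add: sin_zero_iff_int2)
  moreover have "\<bar>cos (of_int k * pi)\<bar> = 1"
    using \<open>sin (of_int k * pi) = 0\<close> sin_cos_squared_add[of "of_int k * pi"] by (simp add: abs_square_eq_1)
  ultimately show ?thesis by (simp add: sin_add abs_mult)
qed

lemma abs_sin_vand_mod: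
  assumes "m > 0" "\<And>i. i < n \<Longrightarrow> x i mod int m = y i mod int m"
  shows "\<bar>sin_vand n m x\<bar> = \<bar>sin_vand n m y\<bar>"
  unfolding sin_vand_def abs_prod
proof (intro prod.cong refl abs_sin_mod assms(1))
  fix t h assume "t \<in> {..<n}" "h \<in> {..<t}"
  then show "(x h - x t) mod int m = (y h - y t) mod int m"
    using assms(2)[of h] assms(2)[of t] by (intro mod_diff_cong) auto
qed

lemma sin_pi_int_div_flip:
  "sin (pi * real_of_int (a - b) / real m) = - sin (pi * real_of_int (b - a) / real m)"
  unfolding sin_minus[symmetric] by (rule arg_cong[of _ _ sin]) (simp add: minus_divide_left right_diff_distrib)

lemma sin_pi_div_pos:
  assumes "0 < d" "d < int m"
  shows "0 < sin (pi * real_of_int d / real m)"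
proof -
  have "real_of_int d < real m" using assms by linarith
  then show ?thesis using assms by (intro sin_gt_zero) (auto simp: field_simps)
qed

text \<open>A unit change of \<open>d\<close> can reach a zero of the sine, at 0 or at
  \<open>m\<close> up to sign, but cannot pass it.\<close>

lemma sin_neighbours_same_sign:
  assumes "d \<noteq> 0" "\<bar>d\<bar> < int m" "\<bar>d' - d\<bar> \<le> 1"
  shows "0 \<le> sin (pi * real_of_int d / real m) * sin (pi * real_of_int d' / real m)"
proof -
  have nonneg: "0 \<le> sin (pi * real_of_int e / real m)" if "0 \<le> e" "e \<le> int m" for e
  proof -
    have "real_of_int e \<le> real m" using that by linarith
    then show ?thesis using that assms(2) by (intro sin_ge_zero) (auto simp: field_simps)
  qed
  show ?thesis
  proof (cases "d > 0")
    case True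
    then show ?thesis using assms by (intro mult_nonneg_nonneg nonneg) auto
  next
    case False
    then have "0 \<le> sin (pi * real_of_int (-d) / real m) * sin (pi * real_of_int (-d') / real m)"
      using assms by (intro mult_nonneg_nonneg nonneg) auto
    then show ?thesis by simp
  qed
qed

lemma sin_vand_step_same_sign:
  assumes "inj_on x {..<n}" "\<And>i. i < n \<Longrightarrow> x i \<in> {0..<int m}" "\<bar>s\<bar> \<le> 1"
  shows "0 \<le> sin_vand n m x * sin_vand n m (x(i := x i + s))"
  unfolding sin_vand_def prod.distrib[symmetric]
proof (intro prod_nonneg sin_neighbours_same_sign)
  fix t h assume th: "t \<in> {..<n}" "h \<in> {..<t}"
  then show "x h - x t \<noteq> 0" using assms(1) by (auto simp: inj_on_def)
  show "\<bar>x h - x t\<bar> < int m" using assms(2)[of h] assms(2)[of t] th by auto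
  show "\<bar>(x(i := x i + s)) h - (x(i := x i + s)) t - (x h - x t)\<bar> \<le> 1" using assms(3) th by auto
qed

lemma sin_vand_nonzero:
  assumes "inj_on x {..<n}" "\<And>i. i < n \<Longrightarrow> x i \<in> {0..<int m}"
  shows "sin_vand n m x \<noteq> 0"
proof -
  have "sin (pi * real_of_int (x h - x t) / real m) \<noteq> 0" if "t < n" "h < t" for t h
  proof -
    have "x h \<noteq> x t" using assms(1) that by (auto simp: inj_on_def)
    moreover have "\<bar>x h - x t\<bar> < int m" using assms(2)[of h] assms(2)[of t] that by auto
    ultimately show ?thesis
      using sin_pi_div_pos[of "x h - x t" m] sin_pi_div_pos[of "x t - x h" m]
        sin_pi_int_div_flip[of "x h" "x t" m]
      by (cases "x t < x h") auto
  qed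
  then show ?thesis by (simp add: sin_vand_def)
qed

section \<open>Hopping dynamics of particle configurations\<close>

definition configs :: "nat \<Rightarrow> nat \<Rightarrow> int set set" where
  "configs n m = {T. T \<subseteq> {0..<int m} \<and> card T = n}"

text \<open>The product runs over ordered pairs, so each pair occurs twice and the root undoes this.
  No enumeration of \<open>T\<close> has to be chosen.\<close>

definition config_weight :: "nat \<Rightarrow> int set \<Rightarrow> real" where
  "config_weight m T = sqrt (\<Prod>x\<in>T. \<Prod>y\<in>T - {x}. \<bar>sin (pi * real_of_int (x - y) / real m)\<bar>)"

lemma finite_configs: "finite (configs n m)"
  by (rule finite_subset[of _ "Pow {0..<int m}"]) (auto simp: configs_def)

lemma configs_finite: "T \<in> configs n m \<Longrightarrow> finite T"
  unfolding configs_def using finite_subset by blast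

lemma prod_distinct_pairs_symmetric:
  fixes g :: "nat \<Rightarrow> nat \<Rightarrow> 'a::comm_semiring_1"
  assumes "\<And>i j. g i j = g j i"
  shows "(\<Prod>i<n. \<Prod>j\<in>{..<n} - {i}. g i j) = (\<Prod>t<n. \<Prod>h<t. g h t)\<^sup>2"
proof (induction n)
  case (Suc n)
  have "(\<Prod>i<Suc n. \<Prod>j\<in>{..<Suc n} - {i}. g i j)
      = (\<Prod>i<n. \<Prod>j\<in>{..<Suc n} - {i}. g i j) * (\<Prod>j\<in>{..<Suc n} - {n}. g n j)" by simp
  also have "{..<Suc n} - {n} = {..<n}" by auto
  also have "(\<Prod>i<n. \<Prod>j\<in>{..<Suc n} - {i}. g i j) = (\<Prod>i<n. g i n * (\<Prod>j\<in>{..<n} - {i}. g i j))"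
  proof (intro prod.cong refl)
    fix i assume "i \<in> {..<n}"
    then have "{..<Suc n} - {i} = insert n ({..<n} - {i})" by auto
    then show "(\<Prod>j\<in>{..<Suc n} - {i}. g i j) = g i n * (\<Prod>j\<in>{..<n} - {i}. g i j)" by simp
  qed
  also have "\<dots> = (\<Prod>i<n. g i n) * (\<Prod>t<n. \<Prod>h<t. g h t)\<^sup>2" by (simp add: prod.distrib Suc.IH)
  also have "(\<Prod>j<n. g n j) = (\<Prod>i<n. g i n)" using assms by (intro prod.cong) auto
  finally show ?case by (simp add: power2_eq_square ac_simps)
qed simp

lemma config_weight_enum:
  assumes "bij_betw e {..<n} T"
  shows "config_weight m T = \<bar>sin_vand n m e\<bar>"
proof -
  let ?g = "\<lambda>x y. \<bar>sin (pi * real_of_int (x - y) / real m)\<bar>"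
  have sym: "?g x y = ?g y x" for x y
    by (subst sin_pi_int_div_flip) simp
  have "(\<Prod>x\<in>T. \<Prod>y\<in>T - {x}. ?g x y) = (\<Prod>i<n. \<Prod>y\<in>T - {e i}. ?g (e i) y)"
    by (rule prod.reindex_bij_betw[OF assms, symmetric])
  also have "\<dots> = (\<Prod>i<n. \<Prod>j\<in>{..<n} - {i}. ?g (e i) (e j))"
  proof (intro prod.cong refl)
    fix i assume "i \<in> {..<n}"
    then have "bij_betw e ({..<n} - {i}) (T - {e i})"
      using assms by (intro bij_betw_DiffI) (auto simp: bij_betw_def)
    then show "(\<Prod>y\<in>T - {e i}. ?g (e i) y) = (\<Prod>j\<in>{..<n} - {i}. ?g (e i) (e j))"
      by (rule prod.reindex_bij_betw[symmetric])
  qed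
  also have "\<dots> = (\<Prod>t<n. \<Prod>h<t. ?g (e h) (e t))\<^sup>2"
    by (rule prod_distinct_pairs_symmetric) (rule sym)
  also have "(\<Prod>t<n. \<Prod>h<t. ?g (e h) (e t)) = \<bar>sin_vand n m e\<bar>" by (simp add: sin_vand_def abs_prod)
  finally show ?thesis by (simp add: config_weight_def)
qed

lemma config_enum:
  assumes "T \<in> configs n m"
  obtains e where "bij_betw e {..<n} T" "inj_on e {..<n}" "\<And>i. i < n \<Longrightarrow> e i \<in> T"
    "\<And>i. i < n \<Longrightarrow> e i \<in> {0..<int m}"
proof -
  obtain e where e: "bij_betw e {0..<card T} T"
    using ex_bij_betw_nat_finite configs_finite[OF assms] by blast
  then have e: "bij_betw e {..<n} T" using assms by (simp add: configs_def lessThan_atLeast0)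
  have eT: "e i \<in> T" if "i < n" for i using e that by (auto simp: bij_betw_def)
  have "T \<subseteq> {0..<int m}" using assms by (simp add: configs_def)
  then have "e i \<in> {0..<int m}" if "i < n" for i using eT[OF that] by blast
  then show ?thesis using that[OF e bij_betw_imp_inj_on[OF e] eT] by blast
qed

lemma config_weight_pos: "T \<in> configs n m \<Longrightarrow> 0 < config_weight m T"
  by (erule config_enum) (simp add: config_weight_enum sin_vand_nonzero)

definition hop :: "nat \<Rightarrow> int set \<Rightarrow> int \<Rightarrow> int \<Rightarrow> int set" where
  "hop m T x s = insert ((x + s) mod int m) (T - {x})"

text \<open>Moves are counted, not adjacency: for m = 2 the steps 1 and -1 lead to the same
  configuration and both count, as they do for walks.\<close>

definition hop_matrix :: "nat \<Rightarrow> int set \<Rightarrow> int set \<Rightarrow> real" where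
  "hop_matrix m T T' = (\<Sum>x\<in>T. \<Sum>s\<in>{1, -1}. of_bool ((x + s) mod int m \<notin> T \<and> hop m T x s = T'))"

lemma hop_configs:
  assumes "T \<in> configs n m" "0 < m" "x \<in> T" "(x + s) mod int m \<notin> T"
  shows "hop m T x s \<in> configs n m"
proof -
  have "finite T" using assms(1) by (rule configs_finite)
  moreover have "card T > 0" using assms(3) \<open>finite T\<close> card_gt_0_iff by blast
  ultimately show ?thesis using assms by (auto simp: configs_def hop_def)
qed

lemma mat_op_hop:
  assumes "T \<in> configs n m" "0 < m"
  shows "mat_op (hop_matrix m) (configs n m) f T
    = (\<Sum>x\<in>T. \<Sum>s\<in>{1, -1}. if (x + s) mod int m \<in> T then 0 else f (hop m T x s))"
proof -
  have "mat_op (hop_matrix m) (configs n m) f T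
    = (\<Sum>x\<in>T. \<Sum>s\<in>{1, -1}. \<Sum>T'\<in>configs n m. of_bool ((x + s) mod int m \<notin> T \<and> hop m T x s = T') * f T')"
    unfolding mat_op_def hop_matrix_def sum_distrib_right
    by (subst sum.swap, rule sum.cong[OF refl], rule sum.swap)
  also have "\<dots> = (\<Sum>x\<in>T. \<Sum>s\<in>{1, -1}. if (x + s) mod int m \<in> T then 0 else f (hop m T x s))"
  proof (intro sum.cong refl)
    fix x s assume "x \<in> T"
    show "(\<Sum>T'\<in>configs n m. of_bool ((x + s) mod int m \<notin> T \<and> hop m T x s = T') * f T')
      = (if (x + s) mod int m \<in> T then 0 else f (hop m T x s))"
    proof (cases "(x + s) mod int m \<in> T")
      case False
      have "(\<Sum>T'\<in>configs n m. of_bool ((x + s) mod int m \<notin> T \<and> hop m T x s = T') * f T')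
          = (\<Sum>T'\<in>configs n m. if T' = hop m T x s then f T' else 0)"
        using False by (intro sum.cong) auto
      then show ?thesis
        using False hop_configs[OF assms \<open>x \<in> T\<close> False] by (simp add: finite_configs)
    qed simp
  qed
  finally show ?thesis .
qed

lemma hop_back:
  assumes "T \<in> configs n m" "0 < m" "x \<in> T" "(x + s) mod int m \<notin> T"
  shows "(x + s) mod int m \<in> hop m T x s" "((x + s) mod int m + - s) mod int m = x"
    "((x + s) mod int m + - s) mod int m \<notin> hop m T x s"
    "hop m (hop m T x s) ((x + s) mod int m) (- s) = T"
proof -
  have "x \<in> {0..<int m}" using assms by (auto simp: configs_def)
  then show x: "((x + s) mod int m + - s) mod int m = x"
    by (simp add: mod_diff_left_eq)
  show "(x + s) mod int m \<in> hop m T x s" by (simp add: hop_def)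
  have "(x + s) mod int m \<noteq> x" using assms by auto
  then show "((x + s) mod int m + - s) mod int m \<notin> hop m T x s"
    unfolding x using assms by (auto simp: hop_def)
  show "hop m (hop m T x s) ((x + s) mod int m) (- s) = T"
    unfolding hop_def[of m "hop m T x s"] x using assms by (auto simp: hop_def)
qed

text \<open>Reversing a move sends (x, s) to ((x + s) mod m, -s) and is an involution between the
  moves in the two directions.\<close>

lemma hop_matrix_sym:
  assumes "T \<in> configs n m" "T' \<in> configs n m" "0 < m"
  shows "hop_matrix m T T' = hop_matrix m T' T"
proof -
  let ?M = "\<lambda>T T'. {(x, s). x \<in> T \<and> s \<in> {1, -1} \<and> (x + s) mod int m \<notin> T \<and> hop m T x s = T'}"
  have fin: "finite T" "finite T'" using assms configs_finite by auto
  have card: "hop_matrix m T T' = real (card (?M T T'))" if "finite T" for T T'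
  proof -
    have "hop_matrix m T T'
      = (\<Sum>(x, s)\<in>T \<times> {1, -1}. of_bool ((x + s) mod int m \<notin> T \<and> hop m T x s = T'))"
      unfolding hop_matrix_def by (rule sum.cartesian_product)
    also have "\<dots> = (\<Sum>p\<in>{p\<in>T \<times> {1, -1}. (fst p + snd p) mod int m \<notin> T \<and> hop m T (fst p) (snd p) = T'}. 1)"
      using that by (subst sum.inter_filter) (auto intro!: sum.cong)
    also have "{p\<in>T \<times> {1, -1}. (fst p + snd p) mod int m \<notin> T \<and> hop m T (fst p) (snd p) = T'} = ?M T T'"
      by auto
    finally show ?thesis by simp
  qed
  let ?b = "\<lambda>(x, s). ((x + s) mod int m, - s)"
  have b: "?b p \<in> ?M T' T \<and> ?b (?b p) = p" if "p \<in> ?M T T'" "T \<in> configs n m" for p T T'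
  proof -
    obtain x s where p0: "p = (x, s)" by (cases p)
    with that(1) have p: "p = (x, s)" "x \<in> T" "s \<in> {1, -1}" "(x + s) mod int m \<notin> T" "hop m T x s = T'"
      by simp_all
    note hb = hop_back[OF that(2) assms(3) p(2,4)]
    have "- s \<in> {1, -1}" using p(3) by auto
    then have 1: "((x + s) mod int m, - s) \<in> ?M T' T"
      unfolding mem_Collect_eq case_prod_conv using hb(1,3,4)[unfolded p(5)] by blast
    have 2: "?b p = ((x + s) mod int m, - s)" and 3: "?b ((x + s) mod int m, - s) = p"
      by (simp_all only: p(1) case_prod_conv hb(2) minus_minus)
    show ?thesis unfolding 2 using 1 3 by (rule conjI)
  qed
  have "bij_betw ?b (?M T T') (?M T' T)"
  proof (rule bij_betw_byWitness[where f' = ?b])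
    show "\<forall>p\<in>?M T T'. ?b (?b p) = p" by (rule ballI, rule conjunct2[OF b[OF _ assms(1)]], assumption)
    show "?b ` ?M T T' \<subseteq> ?M T' T" by (rule image_subsetI, rule conjunct1[OF b[OF _ assms(1)]], assumption)
    show "\<forall>p\<in>?M T' T. ?b (?b p) = p" by (rule ballI, rule conjunct2[OF b[OF _ assms(2)]], assumption)
    show "?b ` ?M T' T \<subseteq> ?M T T'" by (rule image_subsetI, rule conjunct1[OF b[OF _ assms(2)]], assumption)
  qed
  then have "card (?M T T') = card (?M T' T)" by (rule bij_betw_same_card)
  then show ?thesis by (simp add: card fin)
qed

text \<open>The unrestricted eigenvalue equation for tuples descends to configurations: a forbidden
  hop meets a zero of the Vandermonde product, and for all others the sign is that of the starting
  tuple, so \<open>?S\<close> can be pulled out.\<close>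

theorem config_weight_eigen:
  assumes T: "T \<in> configs n m" and n: "0 < n" "n \<le> m" "1 < m"
  shows "mat_op (hop_matrix m) (configs n m) (config_weight m) T = 2 * sin_quotient n m * config_weight m T"
proof -
  have m: "0 < m" using n by simp
  obtain e where e: "bij_betw e {..<n} T" "inj_on e {..<n}" "\<And>i. i < n \<Longrightarrow> e i \<in> T"
    "\<And>i. i < n \<Longrightarrow> e i \<in> {0..<int m}" using config_enum[OF T] by blast
  let ?S = "sgn (sin_vand n m e)"
  have "mat_op (hop_matrix m) (configs n m) (config_weight m) T
    = (\<Sum>i<n. \<Sum>s\<in>{1, -1}. if (e i + s) mod int m \<in> T then 0 else config_weight m (hop m T (e i) s))"
    unfolding mat_op_hop[OF T m] by (rule sum.reindex_bij_betw[OF e(1), symmetric])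
  also have "\<dots> = (\<Sum>i<n. \<Sum>s\<in>{1, -1}. ?S * sin_vand n m (e(i := e i + s)))"
  proof (intro sum.cong refl)
    fix i and s :: int assume "i \<in> {..<n}" and s: "s \<in> {1, -1}"
    then have i: "i < n" by simp
    let ?b = "(e i + s) mod int m"
    have b_ne: "?b \<noteq> e i"
    proof
      assume "?b = e i"
      then have "(e i + s) mod int m = e i mod int m" using e(4)[OF i] by simp
      then have "int m dvd s" by (simp add: mod_eq_dvd_iff)
      then show False using s n by (auto dest: zdvd_imp_le)
    qed
    have "(if ?b \<in> T then 0 else config_weight m (hop m T (e i) s)) = \<bar>sin_vand n m (e(i := ?b))\<bar>"
    proof (cases "?b \<in> T")
      case True
      then obtain k where "k < n" "?b = e k" using e(1) by (auto simp: bij_betw_def)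
      moreover from this have "k \<noteq> i" using b_ne by auto
      ultimately have "sin_vand n m (e(i := ?b)) = 0"
        using i by (intro sin_vand_zero[OF m, of i _ k]) auto
      then show ?thesis using True by simp
    next
      case False
      have "e ` ({..<n} - {i}) = T - {e i}"
        using e(1,2) i by (auto simp: bij_betw_def inj_on_image_set_diff[of e "{..<n}"])
      moreover have "e ` ({..<n} - {i}) = (e(i := ?b)) ` ({..<n} - {i})" by (intro image_cong) auto
      moreover have "{..<n} = insert i ({..<n} - {i})" using i by auto
      ultimately have im: "(e(i := ?b)) ` {..<n} = hop m T (e i) s"
        unfolding hop_def by (metis fun_upd_same image_insert)
      have "inj_on (e(i := ?b)) {..<n}"
        using e(1,2) False by (intro inj_on_fun_updI) (auto simp: bij_betw_def)
      then have "bij_betw (e(i := ?b)) {..<n} (hop m T (e i) s)" using im by (simp add: bij_betw_def)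
      then show ?thesis using False by (simp add: config_weight_enum)
    qed
    \<comment> \<open>Reduction modulo \<open>m\<close> may flip the sign of
      \<open>sin_vand\<close>. Hence absolute values are compared first, and the bars are removed at
      the unreduced tuple.\<close>
    also have "\<dots> = \<bar>sin_vand n m (e(i := e i + s))\<bar>"
      by (rule abs_sin_vand_mod[OF m]) auto
    also have "\<dots> = ?S * sin_vand n m (e(i := e i + s))"
    proof -
      have "0 \<le> sin_vand n m e * sin_vand n m (e(i := e i + s))"
        by (rule sin_vand_step_same_sign) (use e s in auto)
      then show ?thesis using sin_vand_nonzero[of e n m] e(2,4)
        by (auto simp: zero_le_mult_iff sgn_if abs_if)
    qed
    finally show "(if ?b \<in> T then 0 else config_weight m (hop m T (e i) s)) = ?S * sin_vand n m (e(i := e i + s))" .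
  qed
  also have "\<dots> = ?S * (2 * sin_quotient n m * sin_vand n m e)"
    unfolding sum_distrib_left[symmetric] sin_vand_eigen[OF n] ..
  also have "\<dots> = 2 * sin_quotient n m * config_weight m T"
    by (simp add: config_weight_enum[OF e(1)] abs_sgn ac_simps)
  finally show ?thesis .
qed

text \<open>Parity of a position makes sense modulo \<open>m\<close> only for even \<open>m\<close>.
  The constant 1 for odd \<open>m\<close> lets both cases share one limit argument.\<close>

definition config_sign :: "nat \<Rightarrow> int set \<Rightarrow> real" where
  "config_sign m T = (if even m then (\<Prod>x\<in>T. (-1) powi x) else 1)"

lemma config_sign_cases: "config_sign m T = 1 \<or> config_sign m T = -1"
proof -
  have "(\<Prod>x\<in>T. (-1) powi x :: real) = 1 \<or> (\<Prod>x\<in>T. (-1) powi x :: real) = -1"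
    by (induction T rule: infinite_finite_induct) (auto simp: power_int_minus_left)
  then show ?thesis by (simp add: config_sign_def)
qed

lemma config_sign_hop:
  assumes "T \<in> configs n m" "even m" "x \<in> T" "(x + s) mod int m \<notin> T" "s \<in> {1, -1}"
  shows "config_sign m (hop m T x s) = - config_sign m T"
proof -
  have fin: "finite T" using assms configs_finite by auto
  have "even ((x + s) mod int m) \<longleftrightarrow> even (x + s)" using assms(2) by (simp add: dvd_mod_iff)
  then have "even ((x + s) mod int m) \<longleftrightarrow> odd x" using assms(5) by auto
  then have "(-1) powi ((x + s) mod int m) = - ((-1) powi x :: real)"
    by (auto simp: power_int_minus_left)
  then show ?thesis using assms fin
    by (simp add: config_sign_def hop_def prod.remove[OF fin assms(3)])
qed

text \<open>For even \<open>m\<close> every hop flips the sign, so multiplication by it anticommutes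
  with the operator.\<close>

lemma config_sign_eigen:
  assumes T: "T \<in> configs n m" and n: "0 < n" "n \<le> m" "1 < m"
  shows "mat_op (hop_matrix m) (configs n m) (\<lambda>T. config_sign m T * config_weight m T) T
    = (if even m then -1 else 1) * (2 * sin_quotient n m) * (config_sign m T * config_weight m T)"
proof (cases "even m")
  case True
  have m: "0 < m" using n by simp
  have "mat_op (hop_matrix m) (configs n m) (\<lambda>T. config_sign m T * config_weight m T) T
    = - config_sign m T * mat_op (hop_matrix m) (configs n m) (config_weight m) T"
    unfolding mat_op_hop[OF T m] sum_distrib_left
    by (intro sum.cong refl) (use config_sign_hop[OF T True] in auto)
  then show ?thesis using True by (simp add: config_weight_eigen[OF assms])
next
  case False
  then have "(\<lambda>T. config_sign m T * config_weight m T) = config_weight m" by (simp add: config_sign_def)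
  then show ?thesis using False config_weight_eigen[OF assms] by (simp add: config_sign_def)
qed

section \<open>Paths between configurations\<close>

definition hop_rel :: "nat \<Rightarrow> nat \<Rightarrow> int set \<Rightarrow> int set \<Rightarrow> bool" where
  "hop_rel n m T T' \<longleftrightarrow> T \<in> configs n m \<and>
     (\<exists>x\<in>T. \<exists>s\<in>{1, -1}. (x + s) mod int m \<notin> T \<and> T' = hop m T x s)"

lemma hop_matrix_nonneg: "0 \<le> hop_matrix m T T'"
  unfolding hop_matrix_def by (intro sum_nonneg) auto

lemma hop_matrix_ge_1:
  assumes "hop_rel n m T T'"
  shows "1 \<le> hop_matrix m T T'"
proof -
  obtain x s where xs: "x \<in> T" "s \<in> {1, -1}" "(x + s) mod int m \<notin> T" "T' = hop m T x s"
    using assms unfolding hop_rel_def by blast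
  have fin: "finite T" using assms configs_finite by (auto simp: hop_rel_def)
  let ?f = "\<lambda>x s. of_bool ((x + s) mod int m \<notin> T \<and> hop m T x s = T') :: real"
  have "1 = ?f x s" using xs by simp
  also have "\<dots> \<le> (\<Sum>s\<in>{1, -1}. ?f x s)" using xs(2) by (intro member_le_sum) auto
  also have "\<dots> \<le> hop_matrix m T T'"
    unfolding hop_matrix_def using xs(1) fin by (intro member_le_sum) (auto intro: sum_nonneg)
  finally show ?thesis .
qed

lemma hop_rel_configs: "hop_rel n m T T' \<Longrightarrow> 0 < m \<Longrightarrow> T' \<in> configs n m"
  by (auto simp: hop_rel_def hop_configs)

lemma hop_rel_sym:
  assumes "hop_rel n m T T'" "0 < m"
  shows "hop_rel n m T' T"
proof -
  obtain x s where xs: "T \<in> configs n m" "x \<in> T" "s \<in> {1, -1}" "(x + s) mod int m \<notin> T" "T' = hop m T x s"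
    using assms(1) unfolding hop_rel_def by blast
  note hb = hop_back[OF xs(1) assms(2) xs(2,4)]
  have "- s \<in> {1, -1}" using xs(3) by auto
  then show ?thesis
    unfolding hop_rel_def using hop_rel_configs[OF assms] hb(1,3,4) xs(5) by metis
qed

lemma relpowp_sym: "(\<And>x y. R x y \<Longrightarrow> R y x) \<Longrightarrow> (R ^^ k) x y \<Longrightarrow> (R ^^ k) y x"
proof (induction k arbitrary: y)
  case (Suc k)
  from Suc.prems(2) obtain z where "(R ^^ k) x z" "R z y" by (rule relpowp_Suc_E)
  then show ?case using Suc.IH[OF Suc.prems(1)] Suc.prems(1) by (intro relpowp_Suc_I2[of R y z]) blast+
qed auto

lemma mat_op_power_path:
  assumes f: "\<And>T. T \<in> configs n m \<Longrightarrow> 0 \<le> f T" and m: "0 < m"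
    and "T \<in> configs n m" "(hop_rel n m ^^ k) T T'"
  shows "f T' \<le> (mat_op (hop_matrix m) (configs n m) ^^ k) f T"
  using assms(3,4)
proof (induction k arbitrary: T)
  case (Suc k)
  let ?A = "mat_op (hop_matrix m) (configs n m)"
  obtain S where S: "hop_rel n m T S" "(hop_rel n m ^^ k) S T'"
    using Suc.prems(2) by (meson relpowp_Suc_D2)
  have S_in: "S \<in> configs n m" using S(1) m by (rule hop_rel_configs)
  have nonneg: "0 \<le> (?A ^^ k) f U" if "U \<in> configs n m" for U
  proof -
    have "(?A ^^ j) (\<lambda>_. 0) U = 0" for j U by (induction j arbitrary: U) (simp_all add: mat_op_def[of _ _ "(?A ^^ _) _"])
    moreover have "(?A ^^ k) (\<lambda>_. 0) U \<le> (?A ^^ k) f U"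
      by (rule mat_op_power_mono) (use that f hop_matrix_nonneg in auto)
    ultimately show ?thesis by simp
  qed
  have "f T' \<le> (?A ^^ k) f S" by (rule Suc.IH[OF S_in S(2)])
  also have "\<dots> \<le> hop_matrix m T S * (?A ^^ k) f S"
    using mult_right_mono[OF hop_matrix_ge_1[OF S(1)] nonneg[OF S_in]] by simp
  also have "\<dots> \<le> (\<Sum>U\<in>configs n m. hop_matrix m T U * (?A ^^ k) f U)"
    using S_in finite_configs nonneg hop_matrix_nonneg by (intro member_le_sum) auto
  also have "\<dots> = (?A ^^ Suc k) f T" by (simp add: mat_op_def[of _ _ "(?A ^^ _) _"])
  finally show ?case .
qed simp

text \<open>If no particle can move down without crossing 0, the set is closed downwards and hence
  an initial segment.\<close>

lemma hop_down_exists: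
  assumes T: "T \<in> configs n m" and ne: "T \<noteq> {0..<int n}"
  obtains x where "x \<in> T" "0 < x" "x - 1 \<notin> T"
proof -
  have "\<exists>x\<in>T. 0 < x \<and> x - 1 \<notin> T"
  proof (rule ccontr)
    assume "\<not> ?thesis"
    then have down: "x - 1 \<in> T" if "x \<in> T" "0 < x" for x using that by auto
    have fin: "finite T" using T by (rule configs_finite)
    have "int k \<in> T" if "x \<in> T" "int k \<le> x" for x k
      using that
    proof (induction "nat (x - int k)" arbitrary: x)
      case 0
      then show ?case by simp
    next
      case (Suc d)
      then show ?case using down[of x] by (intro Suc.hyps(1)[of "x - 1"]) auto
    qed
    then have closed: "y \<in> T" if "x \<in> T" "0 \<le> y" "y \<le> x" for x y
      using that by (metis nonneg_int_cases)
    have "T = {0..<int (card T)}"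
    proof (cases "T = {}")
      case False
      define M where "M = Max T"
      have M: "M \<in> T" using False fin by (simp add: M_def)
      then have M0: "0 \<le> M" using T by (auto simp: configs_def)
      have "{0..M} \<subseteq> T" using closed[OF M] by auto
      moreover have "T \<subseteq> {0..M}" using T fin by (auto simp: configs_def M_def)
      ultimately have TM: "T = {0..M}" by blast
      then have "int (card T) = M + 1" using M0 by simp
      then show ?thesis using TM by (simp add: atLeastLessThanPlusOne_atLeastAtMost_int)
    qed simp
    then show False using T ne by (simp add: configs_def)
  qed
  then show ?thesis using that by auto
qed

text \<open>Each downward hop lowers the sum of positions by exactly 1. This proves termination and
  fixes the path length, whose parity matters below.\<close>

lemma path_to_packed:
  assumes T: "T \<in> configs n m"
  shows "\<exists>l. (hop_rel n m ^^ l) T {0..<int n} \<and> \<Sum>T = \<Sum>{0..<int n} + int l"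
  using assms
proof (induction "nat (\<Sum>T)" arbitrary: T rule: less_induct)
  case less
  show ?case
  proof (cases "T = {0..<int n}")
    case True
    then show ?thesis by (intro exI[of _ 0]) simp
  next
    case False
    obtain x where x: "x \<in> T" "0 < x" "x - 1 \<notin> T" using hop_down_exists[OF less.prems False] .
    have fin: "finite T" by (rule configs_finite[OF less.prems])
    have "T \<subseteq> {0..<int m}" using less.prems by (simp add: configs_def)
    then have xb: "x < int m" using x(1) by auto
    have xm: "(x + - 1) mod int m = x - 1" using xb x(2) by (simp add: mod_pos_pos_trivial)
    let ?T = "hop m T x (- 1)"
    have rel: "hop_rel n m T ?T"
      unfolding hop_rel_def using x less.prems
      by (intro conjI bexI[of _ x] bexI[of _ "-1"]) (simp_all only: xm insertI1 insertI2 simp_thms)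
    have m: "0 < m" using xb x(2) by simp
    have T': "?T \<in> configs n m" by (rule hop_rel_configs[OF rel m])
    have sumT: "\<Sum>T = \<Sum>?T + 1"
      using fin x(1,3) by (simp add: hop_def xm[simplified] sum.remove[OF fin x(1)])
    have "0 \<le> \<Sum>?T" using T' by (intro sum_nonneg) (auto simp: configs_def)
    then obtain l where l: "(hop_rel n m ^^ l) ?T {0..<int n}" "\<Sum>?T = \<Sum>{0..<int n} + int l"
      using less.hyps[OF _ T'] sumT by auto
    have "(hop_rel n m ^^ Suc l) T {0..<int n}" using rel l(1) by (rule relpowp_Suc_I2)
    then show ?thesis using l(2) sumT by (intro exI[of _ "Suc l"]) simp
  qed
qed

lemma packed_configs: "n \<le> m \<Longrightarrow> {0..<int n} \<in> configs n m"
  by (auto simp: configs_def)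

lemma hop_rel_intro:
  assumes "T \<in> configs n m" "x \<in> T" "s \<in> {1, -1}" "y = (x + s) mod int m" "y \<notin> T" "T' = insert y (T - {x})"
  shows "hop_rel n m T T'"
  using assms unfolding hop_rel_def hop_def by blast

lemma packed_loop_2:
  assumes "0 < n" "n < m"
  shows "(hop_rel n m ^^ 2) {0..<int n} {0..<int n}"
proof -
  have "hop_rel n m {0..<int n} (insert (int n) ({0..<int n} - {int n - 1}))"
    by (rule hop_rel_intro[where x = "int n - 1" and s = 1]) (use assms packed_configs in auto)
  moreover from this have "hop_rel n m (insert (int n) ({0..<int n} - {int n - 1})) {0..<int n}"
    by (rule hop_rel_sym) (use assms in simp)
  ultimately show ?thesis unfolding numeral_2_eq_2 by (metis relpowp_Suc_I relpowp_0_I)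
qed

text \<open>The last particle travels up to position \<open>m - 1\<close>, the others move up by one, and the
  last particle closes the loop by stepping from \<open>m - 1\<close> to \<open>0\<close>.\<close>

lemma packed_loop_around:
  assumes "0 < n" "n < m"
  shows "(hop_rel n m ^^ m) {0..<int n} {0..<int n}"
proof -
  \<comment> \<open>\<open>h\<close> is the hole in the packed block and \<open>j\<close> the place
    of the displaced particle; j = h gives back the packed block.\<close>
  define Q where "Q h j = insert j ({0..<int n} - {h})" for h j :: int
  have Q: "Q h j \<in> configs n m" if "0 \<le> h" "h < int n" "j = h \<or> int n \<le> j" "j < int m" for h j
  proof -
    have "card (Q h j) = n" using that assms by (cases "j = h") (auto simp: Q_def insert_absorb)
    then show ?thesis using that assms by (auto simp: configs_def Q_def)
  qed
  have up: "(hop_rel n m ^^ k) {0..<int n} (Q (int n - 1) (int n - 1 + int k))" if "n + k \<le> m" for k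
    using that
  proof (induction k)
    case 0
    have "Q (int n - 1) (int n - 1 + int 0) = {0..<int n}" using assms by (auto simp: Q_def)
    then show ?case by simp
  next
    case (Suc k)
    have "hop_rel n m (Q (int n - 1) (int n - 1 + int k)) (Q (int n - 1) (int n - 1 + int (Suc k)))"
      by (rule hop_rel_intro[where x = "int n - 1 + int k" and s = 1])
         (use Suc.prems assms in \<open>auto simp: Q_def intro!: Q[unfolded Q_def]\<close>)
    then show ?case using Suc by (intro relpowp_Suc_I[OF Suc.IH]) auto
  qed
  have down: "(hop_rel n m ^^ k) (Q (int n - 1) (int m - 1)) (Q (int n - 1 - int k) (int m - 1))" if "k < n" for k
    using that
  proof (induction k)
    case 0
    then show ?case by simp
  next
    case (Suc k)
    have "hop_rel n m (Q (int n - 1 - int k) (int m - 1)) (Q (int n - 1 - int (Suc k)) (int m - 1))"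
      by (rule hop_rel_intro[where x = "int n - 1 - int (Suc k)" and s = 1 and y = "int n - 1 - int k"])
         (use Suc.prems assms in \<open>auto simp: Q_def intro!: Q[unfolded Q_def]\<close>)
    then show ?case using Suc by (intro relpowp_Suc_I[OF Suc.IH]) auto
  qed
  have "(hop_rel n m ^^ (m - n)) {0..<int n} (Q (int n - 1) (int m - 1))"
    using up[of "m - n"] assms by (simp add: of_nat_diff)
  moreover have "(hop_rel n m ^^ (n - 1)) (Q (int n - 1) (int m - 1)) (Q 0 (int m - 1))"
    using down[of "n - 1"] assms by (simp add: of_nat_diff)
  ultimately have "(hop_rel n m ^^ (m - n + (n - 1))) {0..<int n} (Q 0 (int m - 1))"
    by (auto simp: relpowp_add)
  moreover have "hop_rel n m (Q 0 (int m - 1)) {0..<int n}"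
  proof (rule hop_rel_intro[where x = "int m - 1" and s = 1 and y = 0])
    show "Q 0 (int m - 1) \<in> configs n m" by (rule Q) (use assms in auto)
  qed (use assms in \<open>auto simp: Q_def\<close>)
  ultimately have "(hop_rel n m ^^ Suc (m - n + (n - 1))) {0..<int n} {0..<int n}" by (rule relpowp_Suc_I)
  \<comment> \<open>m - n steps of the last particle, n - 1 steps filling the block, and one step
    across from m - 1 to 0.\<close>
  moreover have "Suc (m - n + (n - 1)) = m" using assms by simp
  ultimately show ?thesis by simp
qed

lemma relpowp_trans: "(R ^^ k) x y \<Longrightarrow> (R ^^ l) y z \<Longrightarrow> (R ^^ (k + l)) x z"
  by (auto simp: relpowp_add)

lemma packed_loop_even:
  assumes "0 < n" "n < m" "even k"
  shows "(hop_rel n m ^^ k) {0..<int n} {0..<int n}"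
proof -
  have "(hop_rel n m ^^ (2 * j)) {0..<int n} {0..<int n}" for j
  proof (induction j)
    case (Suc j)
    have "(hop_rel n m ^^ (2 * j + 2)) {0..<int n} {0..<int n}"
      by (rule relpowp_trans[OF Suc packed_loop_2[OF assms(1,2)]])
    then show ?case by simp
  qed simp
  then show ?thesis using assms(3) by (auto elim: evenE)
qed

lemma config_sign_eq_sum:
  "even m \<Longrightarrow> finite T \<Longrightarrow> config_sign m T = (-1) powi (\<Sum>T)"
proof -
  have "(\<Prod>x\<in>T. (-1) powi x) = ((-1) powi (\<Sum>T) :: real)" if "finite T" for T :: "int set"
    using that by (induction T) (simp_all add: power_int_add)
  then show "even m \<Longrightarrow> finite T \<Longrightarrow> config_sign m T = (-1) powi (\<Sum>T)"
    by (simp add: config_sign_def)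
qed

text \<open>One length serves all pairs: go down to the packed block, wait there, and go up again.
  Each of the two legs has length at most \<open>B\<close>, and 2m leaves room for a loop round the
  circle while keeping the total even.\<close>

lemma configs_connected:
  assumes n: "0 < n" "n < m"
  obtains N where "\<And>T T'. T \<in> configs n m \<Longrightarrow> T' \<in> configs n m \<Longrightarrow> config_sign m T' = config_sign m T \<Longrightarrow>
    (hop_rel n m ^^ N) T T'"
proof -
  define B where "B = nat (Max (Sum ` configs n m))"
  let ?P = "{0..<int n}"
  have m: "0 < m" using n by simp
  show ?thesis
  proof (rule that[of "2 * B + 2 * m"])
    fix T T' assume T: "T \<in> configs n m" and T': "T' \<in> configs n m"
      and sign: "config_sign m T' = config_sign m T"
    obtain l where l: "(hop_rel n m ^^ l) T ?P" "\<Sum>T = \<Sum>?P + int l"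
      using path_to_packed[OF T] by auto
    obtain l' where l': "(hop_rel n m ^^ l') T' ?P" "\<Sum>T' = \<Sum>?P + int l'"
      using path_to_packed[OF T'] by auto
    have l'_rev: "(hop_rel n m ^^ l') ?P T'"
      by (rule relpowp_sym[OF hop_rel_sym[OF _ m] l'(1)])
    have bound: "\<Sum>U \<le> int B" if "U \<in> configs n m" for U
    proof -
      have "\<Sum>U \<le> Max (Sum ` configs n m)" using that finite_configs by (intro Max_ge) auto
      then show ?thesis by (simp add: B_def)
    qed
    have P0: "0 \<le> \<Sum>?P" by (intro sum_nonneg) auto
    have lB: "l \<le> B" "l' \<le> B" using bound[OF T] bound[OF T'] l(2) l'(2) P0 by auto
    define N where "N = 2 * B + 2 * m"
    have "(hop_rel n m ^^ (N - l - l')) ?P ?P"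
    proof (cases "even (l + l')")
      case True
      then have "even (N - l - l')" using lB by (simp add: N_def)
      then show ?thesis by (rule packed_loop_even[OF n])
    next
      case False
      \<comment> \<open>Waiting in steps of two cannot repair an odd l + l'; a loop of odd length
        \<open>m\<close> can. For even \<open>m\<close> the equality of signs already forces
        \<open>l\<close> and \<open>l'\<close> to have the same parity.\<close>
      have "odd m"
      proof
        assume "even m"
        then have "(-1) powi (\<Sum>?P + int l') = ((-1) powi (\<Sum>?P + int l) :: real)"
          using sign T T' configs_finite by (simp add: config_sign_eq_sum l(2) l'(2))
        then have "(-1) ^ l' = ((-1) ^ l :: real)" by (simp add: power_int_add)
        then show False using False by (auto simp: minus_one_power_iff split: if_splits)
      qed
      then have "even (N - l - l' - m)" using False lB by (auto simp: N_def)
      then have "(hop_rel n m ^^ (m + (N - l - l' - m))) ?P ?P"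
        by (intro relpowp_trans[OF packed_loop_around[OF n]] packed_loop_even[OF n])
      moreover have "m + (N - l - l' - m) = N - l - l'" using lB by (simp add: N_def)
      ultimately show ?thesis by simp
    qed
    then have "(hop_rel n m ^^ (l + (N - l - l') + l')) T T'"
      by (intro relpowp_trans[OF relpowp_trans[OF l(1)] l'_rev])
    moreover have "l + (N - l - l') + l' = N" using lB by (simp add: N_def)
    ultimately show "(hop_rel n m ^^ (2 * B + 2 * m)) T T'" by (simp add: N_def)
  qed
qed

section \<open>Walks and configurations\<close>

lemma sum_injective_tuples:
  fixes H :: "int set \<Rightarrow> real"
  shows "(\<Sum>x\<in>{x\<in>{..<n} \<rightarrow>\<^sub>E {0..<int m}. inj_on x {..<n}}. H (x ` {..<n})) = fact n * (\<Sum>T\<in>configs n m. H T)"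
proof -
  let ?I = "{x\<in>{..<n} \<rightarrow>\<^sub>E {0..<int m}. inj_on x {..<n}}"
  have fin: "finite ?I" by (intro finite_subset[OF _ finite_PiE[of "{..<n}" "\<lambda>_. {0..<int m}"]]) auto
  have "(\<lambda>x. x ` {..<n}) ` ?I \<subseteq> configs n m" by (auto simp: configs_def PiE_iff card_image)
  then have "(\<Sum>x\<in>?I. H (x ` {..<n})) = (\<Sum>T\<in>configs n m. \<Sum>x\<in>{x\<in>?I. x ` {..<n} = T}. H (x ` {..<n}))"
    by (intro sum.group[symmetric] fin finite_configs)
  also have "\<dots> = (\<Sum>T\<in>configs n m. fact n * H T)"
  proof (intro sum.cong refl)
    fix T assume T: "T \<in> configs n m"
    then have finT: "finite T" by (rule configs_finite)
    have "{x\<in>?I. x ` {..<n} = T} = {x\<in>{..<n} \<rightarrow>\<^sub>E T. inj_on x {..<n}}"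
    proof (intro set_eqI iffI)
      fix x assume "x \<in> {x\<in>{..<n} \<rightarrow>\<^sub>E T. inj_on x {..<n}}"
      then have x: "x \<in> {..<n} \<rightarrow>\<^sub>E T" "inj_on x {..<n}" by auto
      have "x ` {..<n} = T"
        using x T finT by (intro card_subset_eq) (auto simp: card_image configs_def)
      then show "x \<in> {x\<in>?I. x ` {..<n} = T}" using x T by (auto simp: configs_def PiE_iff)
    qed (auto simp: PiE_iff)
    then have "card {x\<in>?I. x ` {..<n} = T} = fact n"
      using card_inj_on_subset_funcset[of "{..<n}" T "{..<n}"] finT T
      by (simp add: configs_def fact_prod_rev)
    then show "(\<Sum>x\<in>{x\<in>?I. x ` {..<n} = T}. H (x ` {..<n})) = fact n * H T" by simp
  qed
  finally show ?thesis by (simp add: sum_distrib_left)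
qed

text \<open>Transfers the tuple moments to configurations: tuples with a repeated entry contribute
  0, and each configuration has \<open>fact n\<close> orderings.\<close>

lemma sum_tuples_eq_sum_configs:
  assumes m: "0 < m" and F: "\<And>x. inj_on x {..<n} \<Longrightarrow> F x = H (x ` {..<n})"
    and F0: "\<And>x. sin_vand n m x = 0 \<Longrightarrow> F x = 0"
  shows "(\<Sum>x\<in>{..<n} \<rightarrow>\<^sub>E {0..<int m}. F x) = fact n * (\<Sum>T\<in>configs n m. H T :: real)"
proof -
  have "(\<Sum>x\<in>{..<n} \<rightarrow>\<^sub>E {0..<int m}. F x) = (\<Sum>x\<in>{x\<in>{..<n} \<rightarrow>\<^sub>E {0..<int m}. inj_on x {..<n}}. F x)"
  proof (rule sum.mono_neutral_right)
    show "\<forall>x\<in>({..<n} \<rightarrow>\<^sub>E {0..<int m}) - {x\<in>{..<n} \<rightarrow>\<^sub>E {0..<int m}. inj_on x {..<n}}. F x = 0"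
    proof
      fix x assume "x \<in> ({..<n} \<rightarrow>\<^sub>E {0..<int m}) - {x\<in>{..<n} \<rightarrow>\<^sub>E {0..<int m}. inj_on x {..<n}}"
      then obtain p q where "p < n" "q < n" "p \<noteq> q" "x p = x q" by (auto simp: inj_on_def)
      then have "sin_vand n m x = 0" by (intro sin_vand_zero[OF m, of p n q]) auto
      then show "F x = 0" by (rule F0)
    qed
  qed (auto intro: finite_PiE)
  also have "\<dots> = (\<Sum>x\<in>{x\<in>{..<n} \<rightarrow>\<^sub>E {0..<int m}. inj_on x {..<n}}. H (x ` {..<n}))"
    by (intro sum.cong refl F) auto
  finally show ?thesis by (simp only: sum_injective_tuples)
qed

lemma abs_sin_vand_image:
  "inj_on x {..<n} \<Longrightarrow> \<bar>sin_vand n m x\<bar> = config_weight m (x ` {..<n})"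
  by (rule config_weight_enum[symmetric]) (simp add: bij_betw_def)

lemma sum_config_weight_square:
  assumes "0 < n" "n \<le> m"
  shows "4 ^ (n choose 2) * (\<Sum>T\<in>configs n m. (config_weight m T)\<^sup>2) = real m ^ n"
proof -
  have "(\<Sum>x\<in>{..<n} \<rightarrow>\<^sub>E {0..<int m}. (sin_vand n m x)\<^sup>2) = fact n * (\<Sum>T\<in>configs n m. (config_weight m T)\<^sup>2)"
    by (rule sum_tuples_eq_sum_configs) (use assms in \<open>auto simp flip: abs_sin_vand_image\<close>)
  then show ?thesis using sum_sin_vand_square[OF assms] by simp
qed

lemma sum_tuples_config_weight:
  assumes "0 < m"
  shows "(\<Sum>x\<in>{..<n} \<rightarrow>\<^sub>E {0..<int m}. \<bar>sin_vand n m x\<bar>) = fact n * (\<Sum>T\<in>configs n m. config_weight m T)"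
  by (rule sum_tuples_eq_sum_configs) (use assms in \<open>auto simp: abs_sin_vand_image\<close>)

lemma sum_tuples_signed_config_weight:
  assumes "0 < m" "even m"
  shows "(\<Sum>x\<in>{..<n} \<rightarrow>\<^sub>E {0..<int m}. (\<Prod>i<n. (-1) powi x i) * \<bar>sin_vand n m x\<bar>)
    = fact n * (\<Sum>T\<in>configs n m. config_sign m T * config_weight m T)"
  by (rule sum_tuples_eq_sum_configs)
     (use assms in \<open>auto simp: abs_sin_vand_image config_sign_def prod.reindex\<close>)

section \<open>Recursive count of walks\<close>

lemma standard_step_image:
  "{q. standard_step p q} = (\<lambda>(i, s). p[i := p ! i + s]) ` ({..<length p} \<times> {1, -1})"
  by (force simp: standard_step_def image_iff)

text \<open>Points live in Z^n, so the moved coordinate and its direction can be read off from the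
  new point; modulo 2 the direction would be lost.\<close>

lemma inj_standard_step:
  "inj_on (\<lambda>(i, s). p[i := p ! i + s]) ({..<length p} \<times> {1, - 1 :: int})"
proof (rule inj_onI)
  fix a b assume a: "a \<in> {..<length p} \<times> {1, - 1 :: int}" and b: "b \<in> {..<length p} \<times> {1, - 1 :: int}"
    and eq: "(case a of (i, s) \<Rightarrow> p[i := p ! i + s]) = (case b of (i, s) \<Rightarrow> p[i := p ! i + s])"
  obtain i s j t where ab: "a = (i, s)" "b = (j, t)" by (cases a, cases b)
  have "i < length p" "j < length p" "s \<noteq> 0" using a b ab by auto
  moreover have "p[i := p ! i + s] ! i = p[j := p ! j + t] ! i" using eq ab by simp
  ultimately show "a = b" using ab by (auto simp: nth_list_update split: if_splits)
qed

lemma circle_walks_0: "circle_walks m 0 p = (if distinct_mod m p then {[p]} else {})"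
  by (auto simp: circle_walks_def length_Suc_conv)

lemma circle_walks_not_distinct: "\<not> distinct_mod m p \<Longrightarrow> circle_walks m k p = {}"
  by (auto simp: circle_walks_def)

lemma circle_walks_Suc:
  assumes "distinct_mod m p"
  shows "circle_walks m (Suc k) p = (\<Union>q\<in>{q. standard_step p q}. (#) p ` circle_walks m k q)"
proof (intro set_eqI iffI)
  fix w assume w: "w \<in> circle_walks m (Suc k) p"
  then obtain w' where w': "w = p # w'" "length w' = Suc k"
    by (cases w) (auto simp: circle_walks_def)
  have "standard_step p (w' ! 0)" using w w' by (auto simp: circle_walks_def dest!: spec[of _ 0])
  moreover have "w' \<in> circle_walks m k (w' ! 0)"
    unfolding circle_walks_def
  proof (intro CollectI conjI allI impI)
    show "standard_step (w' ! i) (w' ! (i + 1))" if "i < k" for i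
      using w w' that by (auto simp: circle_walks_def dest!: spec[of _ "Suc i"])
    show "distinct_mod m (w' ! i)" if "i \<le> k" for i
    proof -
      have "distinct_mod m (w ! Suc i)" using w that by (simp add: circle_walks_def)
      then show ?thesis using w' by simp
    qed
  qed (use w' in auto)
  ultimately show "w \<in> (\<Union>q\<in>{q. standard_step p q}. (#) p ` circle_walks m k q)" using w' by blast
next
  fix w assume "w \<in> (\<Union>q\<in>{q. standard_step p q}. (#) p ` circle_walks m k q)"
  then obtain q w' where w': "standard_step p q" "w' \<in> circle_walks m k q" "w = p # w'" by blast
  show "w \<in> circle_walks m (Suc k) p"
    unfolding circle_walks_def
  proof (intro CollectI conjI allI impI)
    show "standard_step (w ! i) (w ! (i + 1))" if "i < Suc k" for i
      using w' that by (cases i) (auto simp: circle_walks_def)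
    show "distinct_mod m (w ! i)" if "i \<le> Suc k" for i
      using w' that assms by (cases i) (auto simp: circle_walks_def)
  qed (use w' in \<open>auto simp: circle_walks_def\<close>)
qed

lemma finite_circle_walks: "finite (circle_walks m k p)"
proof (induction k arbitrary: p)
  case (Suc k)
  then show ?case
    by (cases "distinct_mod m p") (auto simp: circle_walks_Suc standard_step_image circle_walks_not_distinct)
qed (simp add: circle_walks_0)

lemma card_circle_walks_Suc:
  assumes "distinct_mod m p"
  shows "card (circle_walks m (Suc k) p) = (\<Sum>i<length p. \<Sum>s\<in>{1, -1}. card (circle_walks m k (p[i := p ! i + s])))"
proof -
  have "card (circle_walks m (Suc k) p) = (\<Sum>q\<in>{q. standard_step p q}. card ((#) p ` circle_walks m k q))"
    unfolding circle_walks_Suc[OF assms]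
  proof (rule card_UN_disjoint)
    show "\<forall>q\<in>{q. standard_step p q}. \<forall>q'\<in>{q. standard_step p q}.
        q \<noteq> q' \<longrightarrow> (#) p ` circle_walks m k q \<inter> (#) p ` circle_walks m k q' = {}"
      by (auto simp: circle_walks_def)
  qed (auto simp: standard_step_image finite_circle_walks)
  also have "\<dots> = (\<Sum>q\<in>{q. standard_step p q}. card (circle_walks m k q))"
    by (simp add: card_image)
  also have "\<dots> = (\<Sum>(i, s)\<in>{..<length p} \<times> {1, -1}. card (circle_walks m k (p[i := p ! i + s])))"
    unfolding standard_step_image by (subst sum.reindex[OF inj_standard_step]) (simp add: case_prod_unfold)
  finally show ?thesis by (simp only: sum.cartesian_product)
qed

lemma distinct_mod_iff_inj: "distinct_mod m p \<longleftrightarrow> inj_on (\<lambda>i. p ! i mod int m) {..<length p}"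
  by (auto simp: distinct_mod_def inj_on_def)

lemma residues_config:
  assumes "distinct_mod m p" "0 < m"
  shows "(\<lambda>i. p ! i mod int m) ` {..<length p} \<in> configs (length p) m"
  using assms by (auto simp: distinct_mod_iff_inj configs_def card_image)

text \<open>As long as the residues are distinct, coordinates correspond to particles, so the 2n
  steps correspond to the 2n attempted hops. A step onto an occupied residue leaves no admissible
  walk, matching the 0 of a blocked hop.\<close>

theorem card_circle_walks_eq:
  assumes "distinct_mod m p" "1 < m"
  shows "real (card (circle_walks m k p))
    = (mat_op (hop_matrix m) (configs (length p) m) ^^ k) (\<lambda>_. 1) ((\<lambda>i. p ! i mod int m) ` {..<length p})"
  using assms(1)
proof (induction k arbitrary: p)
  case 0
  then show ?case by (simp add: circle_walks_0)
next
  case (Suc k)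
  let ?n = "length p" and ?f = "\<lambda>i. p ! i mod int m"
  let ?T = "?f ` {..<?n}"
  let ?D = "(mat_op (hop_matrix m) (configs ?n m) ^^ k) (\<lambda>_. 1)"
  have m: "0 < m" using assms(2) by simp
  have inj: "inj_on ?f {..<?n}" using Suc.prems by (simp add: distinct_mod_iff_inj)
  have "real (card (circle_walks m (Suc k) p))
      = (\<Sum>i<?n. \<Sum>s\<in>{1, -1}. real (card (circle_walks m k (p[i := p ! i + s]))))"
    by (simp add: card_circle_walks_Suc[OF Suc.prems])
  also have "\<dots> = (\<Sum>i<?n. \<Sum>s\<in>{1, -1}. if (?f i + s) mod int m \<in> ?T then 0 else ?D (hop m ?T (?f i) s))"
  proof (intro sum.cong refl)
    fix i and s :: int assume i: "i \<in> {..<?n}" and s: "s \<in> {1, -1}"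
    let ?q = "p[i := p ! i + s]" and ?b = "(?f i + s) mod int m"
    have b: "?b = (p ! i + s) mod int m" by (simp add: mod_add_left_eq)
    have b_ne: "?b \<noteq> ?f i"
    proof
      assume "?b = ?f i"
      then have "int m dvd s" unfolding b by (simp add: mod_eq_dvd_iff)
      then show False using s assms(2) by (auto dest: zdvd_imp_le)
    qed
    have q: "?q ! j mod int m = (?f(i := ?b)) j" if "j < ?n" for j
      using that i b by (auto simp: nth_list_update)
    show "real (card (circle_walks m k ?q)) = (if ?b \<in> ?T then 0 else ?D (hop m ?T (?f i) s))"
    proof (cases "?b \<in> ?T")
      case True
      then obtain j where j: "j < ?n" "?b = ?f j" by auto
      then have "j \<noteq> i" using b_ne by auto
      then have ji: "j \<noteq> i" .
      have iq: "?q ! i mod int m = ?b" using q[of i] i by (simp only: fun_upd_same lessThan_iff)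
      have jq: "?q ! j mod int m = ?f j" using q[of j] j(1) ji by (simp only: fun_upd_other not_False_eq_True)
      have "\<not> inj_on (\<lambda>i. ?q ! i mod int m) {..<?n}"
      proof
        assume "inj_on (\<lambda>i. ?q ! i mod int m) {..<?n}"
        then have "j = i" by (rule inj_onD) (use iq jq j i in simp_all)
        then show False using ji by simp
      qed
      then show ?thesis using True by (simp add: circle_walks_not_distinct distinct_mod_iff_inj)
    next
      case False
      have "inj_on (?f(i := ?b)) {..<?n}" using inj False by (intro inj_on_fun_updI)
      moreover have "inj_on (\<lambda>i. ?q ! i mod int m) {..<?n} = inj_on (?f(i := ?b)) {..<?n}"
        by (intro inj_on_cong q) (simp only: lessThan_iff)
      ultimately have "inj_on (\<lambda>i. ?q ! i mod int m) {..<?n}" by (simp only:)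
      then have "distinct_mod m ?q" by (simp add: distinct_mod_iff_inj)
      then have "real (card (circle_walks m k ?q)) = ?D ((\<lambda>i. ?q ! i mod int m) ` {..<?n})"
        using Suc.IH[of ?q] by simp
      also have "(\<lambda>i. ?q ! i mod int m) ` {..<?n} = (?f(i := ?b)) ` {..<?n}"
        using q by (intro image_cong) auto
      also have "\<dots> = hop m ?T (?f i) s"
      proof -
        have "{..<?n} = insert i ({..<?n} - {i})" using i by auto
        moreover have "?f ` ({..<?n} - {i}) = ?T - {?f i}"
          using inj i by (subst inj_on_image_set_diff[of ?f "{..<?n}"]) auto
        moreover have "(?f(i := ?b)) ` ({..<?n} - {i}) = ?f ` ({..<?n} - {i})" by (intro image_cong) auto
        ultimately show ?thesis unfolding hop_def by (metis fun_upd_same image_insert)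
      qed
      finally show ?thesis using False by simp
    qed
  qed
  also have "\<dots> = (\<Sum>x\<in>?T. \<Sum>s\<in>{1, -1}. if (x + s) mod int m \<in> ?T then 0 else ?D (hop m ?T x s))"
    by (simp only: sum.reindex[OF inj] o_def)
  also have "\<dots> = mat_op (hop_matrix m) (configs ?n m) ?D ?T"
    by (rule mat_op_hop[OF residues_config[OF Suc.prems m] m, symmetric])
  finally show ?case by simp
qed

section \<open>Asymptotics\<close>

lemma sin_quotient_pos:
  assumes "0 < n" "n < m"
  shows "0 < sin_quotient n m"
proof -
  have "0 < sin (real n * pi / real m)" "0 < sin (pi / real m)"
    using assms by (intro sin_gt_zero; simp add: field_simps)+
  then show ?thesis by (simp add: sin_quotient_def)
qed

text \<open>n < m guarantees a free place, hence the positivity of \<mu> and the loops used for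
  connectedness.\<close>

locale hopping =
  fixes n m :: nat
  assumes n: "0 < n" "n < m"
begin

abbreviation "A \<equiv> mat_op (hop_matrix m) (configs n m)"
abbreviation "\<mu> \<equiv> 2 * sin_quotient n m"
abbreviation "v \<equiv> config_weight m"
abbreviation "\<epsilon> \<equiv> config_sign m"

text \<open>Coefficient of \<open>v\<close> in the orthogonal projection of the constant 1;
  \<open>signed_mean\<close> is the one of \<epsilon>v, whose norm is the same because \<epsilon>^2
  = 1.\<close>

definition plain_mean :: real where
  "plain_mean = (\<Sum>T\<in>configs n m. v T) / (\<Sum>T\<in>configs n m. (v T)\<^sup>2)"

definition signed_mean :: real where
  "signed_mean = (if even m then (\<Sum>T\<in>configs n m. \<epsilon> T * v T) / (\<Sum>T\<in>configs n m. (v T)\<^sup>2) else 0)"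

lemma bounds: "0 < m" "1 < m" "n \<le> m" using n by auto

lemma configs_nonempty: "configs n m \<noteq> {}"
  using packed_configs[OF bounds(3)] by auto

lemma sum_weight_square_pos: "0 < (\<Sum>T\<in>configs n m. (v T)\<^sup>2)"
  by (intro sum_pos zero_less_power config_weight_pos finite_configs configs_nonempty)

lemma sign_square: "\<epsilon> T * \<epsilon> T = 1"
  using config_sign_cases[of m T] by auto

text \<open>Eigenfunctions for the distinct eigenvalues \<open>\<plusminus>\<mu>\<close> are orthogonal.\<close>

lemma sum_sign_weight_square:
  assumes "even m"
  shows "(\<Sum>T\<in>configs n m. \<epsilon> T * (v T)\<^sup>2) = 0" (is "?S = 0")
proof -
  have "(\<Sum>T\<in>configs n m. v T * A (\<lambda>T. \<epsilon> T * v T) T) = (\<Sum>T\<in>configs n m. A v T * (\<epsilon> T * v T))"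
    by (rule mat_op_adjoint) (rule hop_matrix_sym[OF _ _ bounds(1)])
  moreover have "(\<Sum>T\<in>configs n m. v T * A (\<lambda>T. \<epsilon> T * v T) T) = - \<mu> * ?S"
    unfolding sum_distrib_left using assms
    by (intro sum.cong refl) (simp add: config_sign_eigen[OF _ n(1) bounds(3,2)] power2_eq_square)
  moreover have "(\<Sum>T\<in>configs n m. A v T * (\<epsilon> T * v T)) = \<mu> * ?S"
    unfolding sum_distrib_left
    by (intro sum.cong refl) (simp add: config_weight_eigen[OF _ n(1) bounds(3,2)] power2_eq_square)
  ultimately show ?thesis using sin_quotient_pos[OF n] by auto
qed

text \<open>\<open>g\<close> is the constant 1 minus its projection onto the span of
  \<open>v\<close> and \<epsilon>v. The projection evolves explicitly and the rest is negligible
  against \<mu>^k.\<close>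

lemma hop_power_limit:
  assumes T: "T \<in> configs n m"
  shows "(\<lambda>k. (A ^^ k) (\<lambda>_. 1) T / \<mu> ^ k - v T * (plain_mean + (-1) ^ k * \<epsilon> T * signed_mean)) \<longlonglongrightarrow> 0"
proof -
  define g where "g T = 1 - plain_mean * v T - signed_mean * (\<epsilon> T * v T)" for T
  let ?X = "configs n m"
  let ?Q = "\<Sum>T\<in>?X. (v T)\<^sup>2" and ?R = "\<Sum>T\<in>?X. \<epsilon> T * (v T)\<^sup>2"
  have Q: "0 < ?Q" by (rule sum_weight_square_pos)
  have pos: "0 < \<mu>" using sin_quotient_pos[OF n] by simp
  have R: "signed_mean * ?R = 0" using sum_sign_weight_square by (simp add: signed_mean_def)
  have "(\<Sum>T\<in>?X. v T * g T)
      = (\<Sum>T\<in>?X. v T - plain_mean * (v T)\<^sup>2 - signed_mean * (\<epsilon> T * (v T)\<^sup>2))"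
    by (intro sum.cong refl) (simp add: g_def algebra_simps power2_eq_square)
  also have "\<dots> = (\<Sum>T\<in>?X. v T) - plain_mean * ?Q - signed_mean * ?R"
    by (simp add: sum_subtractf sum_distrib_left)
  finally have orth1: "(\<Sum>T\<in>?X. v T * g T) = 0" using Q R by (simp add: plain_mean_def)
  have "(\<Sum>T\<in>?X. \<epsilon> T * v T * g T)
      = (\<Sum>T\<in>?X. \<epsilon> T * v T - plain_mean * (\<epsilon> T * (v T)\<^sup>2) - signed_mean * (\<epsilon> T * \<epsilon> T) * (v T)\<^sup>2)"
    by (intro sum.cong refl) (simp add: g_def algebra_simps power2_eq_square)
  also have "\<dots> = (\<Sum>T\<in>?X. \<epsilon> T * v T) - plain_mean * ?R - signed_mean * ?Q"
    by (simp add: sign_square sum_subtractf sum_distrib_left)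
  also have "\<dots> = 0"
  proof (cases "even m")
    case True
    then show ?thesis using Q sum_sign_weight_square by (simp add: signed_mean_def)
  next
    case False
    then have "\<epsilon> = (\<lambda>_. 1)" by (auto simp: config_sign_def)
    then show ?thesis using False Q by (simp add: signed_mean_def plain_mean_def)
  qed
  finally have orth2: "(\<Sum>T\<in>?X. \<epsilon> T * v T * g T) = 0" .
  obtain N where N: "\<And>T T'. T \<in> ?X \<Longrightarrow> T' \<in> ?X \<Longrightarrow> \<epsilon> T' = \<epsilon> T \<Longrightarrow> (hop_rel n m ^^ N) T T'"
    using configs_connected[OF n] by blast
  have "(\<lambda>k. (A ^^ k) g T / \<mu> ^ k) \<longlonglongrightarrow> 0"
  proof (rule mat_op_power_negligible[where v = v and \<epsilon> = \<epsilon> and N = N])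
    show "f y \<le> (A ^^ N) f x" if "x \<in> ?X" "y \<in> ?X" "\<epsilon> y = \<epsilon> x" "\<And>y. y \<in> ?X \<Longrightarrow> 0 \<le> f y" for f x y
      using that by (intro mat_op_power_path bounds N)
    show "A v x = \<mu> * v x" if "x \<in> ?X" for x by (rule config_weight_eigen[OF that n(1) bounds(3,2)])
    show "A (\<lambda>x. \<epsilon> x * v x) x = (if even m then -1 else 1) * \<mu> * (\<epsilon> x * v x)" if "x \<in> ?X" for x
      by (rule config_sign_eigen[OF that n(1) bounds(3,2)])
    show "hop_matrix m x y = hop_matrix m y x" if "x \<in> ?X" "y \<in> ?X" for x y
      by (rule hop_matrix_sym[OF that bounds(1)])
  qed (use T pos orth1 orth2 finite_configs hop_matrix_nonneg config_weight_pos config_sign_cases in auto)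
  moreover have "(A ^^ k) g T / \<mu> ^ k = (A ^^ k) (\<lambda>_. 1) T / \<mu> ^ k - v T * (plain_mean + (-1) ^ k * \<epsilon> T * signed_mean)" for k
  proof -
    have g: "g = (\<lambda>T. 1 * 1 + -1 * (plain_mean * v T + signed_mean * (\<epsilon> T * v T)))"
      by (simp add: g_def fun_eq_iff)
    have v: "(A ^^ k) v T = \<mu> ^ k * v T"
      by (rule mat_op_power_eigen[OF config_weight_eigen[OF _ n(1) bounds(3,2)] T])
    have "(A ^^ k) (\<lambda>T. \<epsilon> T * v T) T = ((if even m then -1 else 1) * \<mu>) ^ k * (\<epsilon> T * v T)"
      by (rule mat_op_power_eigen[OF config_sign_eigen[OF _ n(1) bounds(3,2)] T])
    \<comment> \<open>For odd \<open>m\<close> the eigenvalue is \<mu> and not -\<mu>, but then both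
      sides vanish with \<open>signed_mean\<close>.\<close>
    then have \<epsilon>v: "signed_mean * (A ^^ k) (\<lambda>T. \<epsilon> T * v T) T = signed_mean * ((-1) ^ k * \<mu> ^ k * (\<epsilon> T * v T))"
      by (auto simp: signed_mean_def power_mult_distrib power_minus[of "2 * sin_quotient n m"])
    have "(A ^^ k) g T = (A ^^ k) (\<lambda>_. 1) T - \<mu> ^ k * (v T * (plain_mean + (-1) ^ k * \<epsilon> T * signed_mean))"
      unfolding g mat_op_power_linear v \<epsilon>v by (simp add: algebra_simps)
    then show ?thesis using pos by (simp add: diff_divide_distrib)
  qed
  ultimately show ?thesis by simp
qed

text \<open>Uniform lower bound of the oscillating bracket, needed to pass from differences to
  ratios. It is strict because both signs occur among the configurations and all weights are
  positive.\<close>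

lemma mean_bracket_pos: "0 < plain_mean - \<bar>signed_mean\<bar>"
proof (cases "even m")
  case True
  let ?X = "configs n m" and ?P = "{0..<int n}"
  have P: "?P \<in> ?X" by (rule packed_configs[OF bounds(3)])
  \<comment> \<open>The packed block with its last particle moved up by one, which n < m
    permits.\<close>
  obtain S where S: "S \<in> ?X" "\<epsilon> S = - \<epsilon> ?P"
  proof
    have *: "(int n - 1 + 1) mod int m = int n" using n by simp
    show "hop m ?P (int n - 1) 1 \<in> ?X" using P * n by (intro hop_configs) auto
    show "\<epsilon> (hop m ?P (int n - 1) 1) = - \<epsilon> ?P" using P * n True by (intro config_sign_hop) auto
  qed
  have "\<bar>\<Sum>T\<in>?X. \<epsilon> T * v T\<bar> < (\<Sum>T\<in>?X. v T)"
  proof -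
    have pos: "0 < (\<Sum>T\<in>?X. v T + c * (\<epsilon> T * v T))" if "c = 1 \<or> c = -1" for c
    proof -
      have c: "0 \<le> v T + c * (\<epsilon> T * v T)" if "T \<in> ?X" for T
        using config_sign_cases[of m T] config_weight_pos[OF that] \<open>c = 1 \<or> c = -1\<close> by auto
      have "\<exists>U\<in>?X. c * \<epsilon> U = 1" using S P config_sign_cases[of m ?P] that by force
      then obtain U where U: "U \<in> ?X" "c * \<epsilon> U = 1" by blast
      have "0 < v U + c * \<epsilon> U * v U" using config_weight_pos[OF U(1)] U(2) by simp
      then show ?thesis using U(1) c finite_configs
        by (intro sum_pos2[of _ U]) (auto simp: mult.assoc)
    qed
    show ?thesis using pos[of 1] pos[of "-1"] by (simp add: sum.distrib sum_subtractf sum_negf)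
  qed
  then show ?thesis using True sum_weight_square_pos
    by (simp add: plain_mean_def signed_mean_def abs_divide divide_strict_right_mono)
next
  case False
  have "0 < (\<Sum>T\<in>configs n m. v T)"
    using configs_nonempty finite_configs config_weight_pos by (intro sum_pos) auto
  then show ?thesis using False sum_weight_square_pos by (simp add: plain_mean_def signed_mean_def)
qed

lemma weight_square_sum: "(\<Sum>T\<in>configs n m. (v T)\<^sup>2) = real m ^ n / 4 ^ (n choose 2)"
  using sum_config_weight_square[OF n(1) bounds(3)] by (simp add: field_simps)

text \<open>Origin of the prefactor: dividing m^a / 2^(n choose 2) by m^n / 4^(n choose 2). Here
  \<open>a\<close> is n/2 for even \<open>n\<close> and (n + 1)/2 for odd \<open>n\<close>.\<close>

lemma mean_from_sum:
  assumes "2 ^ (n choose 2) * s = real m ^ a * r" "a \<le> n"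
  shows "s / (\<Sum>T\<in>configs n m. (v T)\<^sup>2) = 2 ^ (n choose 2) / real m ^ (n - a) * r"
proof -
  have "(4::real) ^ (n choose 2) = 2 ^ (n choose 2) * 2 ^ (n choose 2)" by (simp flip: power_mult_distrib)
  moreover have "real m ^ n = real m ^ a * real m ^ (n - a)" using assms(2) by (simp flip: power_add)
  ultimately have "s / (\<Sum>T\<in>configs n m. (v T)\<^sup>2)
      = 2 ^ (n choose 2) * (2 ^ (n choose 2) * s) / (real m ^ a * real m ^ (n - a))"
    by (simp add: weight_square_sum)
  then show ?thesis using assms(1) bounds(1) by simp
qed

lemma plain_mean_even:
  assumes "even n"
  shows "plain_mean = 2 ^ (n choose 2) / real m ^ (n div 2)
    * (\<Prod>h=1..n div 2. cot ((2 * real h - 1) * pi / (2 * real m)))"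
proof -
  have "n - n div 2 = n div 2" using assms by auto
  moreover have "2 ^ (n choose 2) * (\<Sum>T\<in>configs n m. v T)
      = real m ^ (n div 2) * (\<Prod>h=1..n div 2. cot ((2 * real h - 1) * pi / (2 * real m)))"
    using sum_abs_sin_vand_even[OF n(1) bounds(3) assms] by (simp add: sum_tuples_config_weight[OF bounds(1)])
  ultimately show ?thesis unfolding plain_mean_def using mean_from_sum[of _ "n div 2"] by simp
qed

lemma plain_mean_odd:
  assumes "odd n"
  shows "plain_mean = 2 ^ (n choose 2) / real m ^ ((n - 1) div 2) * (\<Prod>h=1..(n - 1) div 2. cot (real h * pi / real m))"
proof -
  have "n - (n + 1) div 2 = (n - 1) div 2" "(n + 1) div 2 \<le> n"
    using assms by (auto elim!: oddE)
  moreover have "2 ^ (n choose 2) * (\<Sum>T\<in>configs n m. v T)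
      = real m ^ ((n + 1) div 2) * (\<Prod>h=1..(n - 1) div 2. cot (real h * pi / real m))"
    using sum_abs_sin_vand_odd[OF n(1) bounds(3) assms] by (simp add: sum_tuples_config_weight[OF bounds(1)])
  ultimately show ?thesis unfolding plain_mean_def using mean_from_sum[of _ "(n + 1) div 2"] by simp
qed

lemma signed_mean_even:
  assumes "even n" "even m"
  shows "signed_mean = 2 ^ (n choose 2) / real m ^ (n div 2)
    * ((-1) ^ (n div 2) * (\<Prod>h=1..n div 2. tan ((2 * real h - 1) * pi / (2 * real m))))"
proof -
  have "n - n div 2 = n div 2" using assms by auto
  moreover have "2 ^ (n choose 2) * (\<Sum>T\<in>configs n m. \<epsilon> T * v T)
      = real m ^ (n div 2) * ((-1) ^ (n div 2) * (\<Prod>h=1..n div 2. tan ((2 * real h - 1) * pi / (2 * real m))))"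
    using sum_signed_sin_vand_even[OF n(1) bounds(3) assms] assms(2)
    by (simp add: sum_tuples_signed_config_weight[OF bounds(1)])
  ultimately show ?thesis unfolding signed_mean_def using mean_from_sum[of _ "n div 2"] assms(2) by simp
qed

lemma signed_mean_zero:
  assumes "odd n \<or> odd m"
  shows "signed_mean = 0"
  using sum_signed_sin_vand_odd[OF n(1) bounds(3)] assms
  by (auto simp: signed_mean_def sum_tuples_signed_config_weight[OF bounds(1)])

end

lemma asymp_equiv_of_scaled_limit:
  fixes f c :: "nat \<Rightarrow> real"
  assumes lim: "(\<lambda>k. f k / l ^ k - c k) \<longlonglongrightarrow> 0" and "0 < l" and "0 < d" and c: "\<And>k. d \<le> c k"
  shows "f \<sim>[at_top] (\<lambda>k. l ^ k * c k)"
proof (rule asymp_equivI')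
  have "(\<lambda>k. (f k / l ^ k - c k) / c k) \<longlonglongrightarrow> 0"
  proof (rule Lim_null_comparison)
    show "(\<lambda>k. \<bar>f k / l ^ k - c k\<bar> / d) \<longlonglongrightarrow> 0"
      using tendsto_divide[OF tendsto_rabs[OF lim] tendsto_const[of d]] assms(3) by simp
    show "\<forall>\<^sub>F k in at_top. norm ((f k / l ^ k - c k) / c k) \<le> \<bar>f k / l ^ k - c k\<bar> / d"
    proof (rule always_eventually, rule allI)
      fix k
      have "0 < c k" using c[of k] assms(3) by linarith
      then show "norm ((f k / l ^ k - c k) / c k) \<le> \<bar>f k / l ^ k - c k\<bar> / d"
        using c[of k] assms(3) by (simp add: abs_divide frac_le)
    qed
  qed
  then have "(\<lambda>k. (f k / l ^ k - c k) / c k + 1) \<longlonglongrightarrow> 0 + 1" by (intro tendsto_add tendsto_const)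
  moreover have "(f k / l ^ k - c k) / c k + 1 = f k / (l ^ k * c k)" for k
    using c[of k] assms(2,3) by (simp add: field_simps)
  ultimately show "(\<lambda>k. f k / (l ^ k * c k)) \<longlonglongrightarrow> 1" by simp
qed

lemma decreasing_config:
  assumes "\<forall>i<n. 0 \<le> \<eta> ! i \<and> \<eta> ! i < int m" "\<forall>h t. h < t \<and> t < n \<longrightarrow> \<eta> ! h > \<eta> ! t" "length \<eta> = n"
  shows "distinct_mod m \<eta>" "(\<lambda>i. \<eta> ! i mod int m) ` {..<n} = set \<eta>" "set \<eta> \<in> configs n m"
    "config_weight m (set \<eta>) = (\<Prod>t<n. \<Prod>h<t. sin (pi * real_of_int (\<eta> ! h - \<eta> ! t) / real m))"
proof -
  have mod: "\<eta> ! i mod int m = \<eta> ! i" if "i < n" for i using assms(1) that by (auto intro: mod_pos_pos_trivial)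
  have dist: "\<eta> ! i \<noteq> \<eta> ! j" if "i < n" "j < n" "i \<noteq> j" for i j
    using assms(2) that by (metis less_irrefl linorder_less_linear)
  then show "distinct_mod m \<eta>" using mod assms(3) by (simp add: distinct_mod_def)
  show "(\<lambda>i. \<eta> ! i mod int m) ` {..<n} = set \<eta>"
    using mod assms(3) by (auto simp: set_conv_nth image_iff)
  have "distinct \<eta>" using dist assms(3) by (simp add: distinct_conv_nth)
  then have "card (set \<eta>) = n" using assms(3) by (simp add: distinct_card)
  then show "set \<eta> \<in> configs n m" using assms(1,3) by (auto simp: configs_def in_set_conv_nth)
  have "bij_betw ((!) \<eta>) {..<n} (set \<eta>)"
    using \<open>distinct \<eta>\<close> assms(3) by (intro bij_betw_nth) auto
  then have "config_weight m (set \<eta>) = \<bar>sin_vand n m ((!) \<eta>)\<bar>" by (rule config_weight_enum)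
  also have "\<dots> = sin_vand n m ((!) \<eta>)"
    unfolding sin_vand_def
  proof (intro abs_of_nonneg prod_nonneg less_imp_le sin_pi_div_pos)
    fix t h assume "t \<in> {..<n}" "h \<in> {..<t}"
    then have "\<eta> ! t < \<eta> ! h" "0 \<le> \<eta> ! t" "\<eta> ! h < int m" using assms(1,2) by auto
    then show "0 < \<eta> ! h - \<eta> ! t" "\<eta> ! h - \<eta> ! t < int m" by auto
  qed
  finally show "config_weight m (set \<eta>) = (\<Prod>t<n. \<Prod>h<t. sin (pi * real_of_int (\<eta> ! h - \<eta> ! t) / real m))"
    by (simp add: sin_vand_def)
qed

text \<open>A single coordinate never collides, so the count is exact for every \<open>m\<close>,
  including m = 1.\<close>

lemma card_circle_walks_single:
  assumes "length p = 1"
  shows "card (circle_walks m k p) = 2 ^ k"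
  using assms
proof (induction k arbitrary: p)
  case 0
  then show ?case by (simp add: circle_walks_0 distinct_mod_def)
next
  case (Suc k)
  then have "distinct_mod m p" by (simp add: distinct_mod_def)
  then show ?case using Suc by (simp add: card_circle_walks_Suc)
qed

lemma card_circle_walks_full:
  assumes "length p = m" "distinct_mod m p" "1 < m"
  shows "card (circle_walks m (Suc k) p) = 0"
proof -
  let ?T = "(\<lambda>i. p ! i mod int m) ` {..<length p}"
  have T: "?T \<in> configs m m" using residues_config[OF assms(2)] assms by simp
  then have "?T = {0..<int m}" by (intro card_subset_eq) (auto simp: configs_def)
  moreover have "(x + s) mod int m \<in> {0..<int m}" for x s using assms(3) by simp
  ultimately have "real (card (circle_walks m (Suc k) p)) = 0"
    unfolding card_circle_walks_eq[OF assms(2,3)] funpow.simps o_apply using T assms(1,3)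
    by (simp add: mat_op_hop)
  then show ?thesis by simp
qed

theorem theorem18:
  fixes n m :: nat and \<eta> :: "int list"
  assumes "n \<ge> 1" and "m \<ge> 1"
    and "length \<eta> = n"
    and "\<forall>i<n. 0 \<le> \<eta> ! i \<and> \<eta> ! i < int m"
    and "\<forall>h t. h < t \<and> t < n \<longrightarrow> \<eta> ! h > \<eta> ! t"
  shows
    "(even n \<and> even m \<longrightarrow>
       asymp_equiv (\<lambda>k. real (card (circle_walks m k \<eta>))) at_top
         (\<lambda>k. 2 ^ (n choose 2) / real m ^ (n div 2) * (2 * sin_quotient n m) ^ k
              * (\<Prod>t<n. \<Prod>h<t. sin (pi * real_of_int (\<eta> ! h - \<eta> ! t) / real m))
              * ((\<Prod>h=1..n div 2. cot ((2 * real h - 1) * pi / (2 * real m)))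
                 + (-1) powi (sum_list \<eta> + int k + int (n div 2))
                   * (\<Prod>h=1..n div 2. tan ((2 * real h - 1) * pi / (2 * real m))))))
     \<and> (even n \<and> odd m \<longrightarrow>
       asymp_equiv (\<lambda>k. real (card (circle_walks m k \<eta>))) at_top
         (\<lambda>k. 2 ^ (n choose 2) / real m ^ (n div 2) * (2 * sin_quotient n m) ^ k
              * (\<Prod>t<n. \<Prod>h<t. sin (pi * real_of_int (\<eta> ! h - \<eta> ! t) / real m))
              * (\<Prod>h=1..n div 2. cot ((2 * real h - 1) * pi / (2 * real m)))))
     \<and> (odd n \<longrightarrow>
       asymp_equiv (\<lambda>k. real (card (circle_walks m k \<eta>))) at_top
         (\<lambda>k. 2 ^ (n choose 2) / real m ^ ((n - 1) div 2) * (2 * sin_quotient n m) ^ k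
              * (\<Prod>t<n. \<Prod>h<t. sin (pi * real_of_int (\<eta> ! h - \<eta> ! t) / real m))
              * (\<Prod>h=1..(n - 1) div 2. cot (real h * pi / real m))))"
proof -
  note \<eta> = decreasing_config[OF assms(4,5,3)]
  have "n \<le> card {0..<int m}"
    using \<eta>(3) card_mono[of "{0..<int m}" "set \<eta>"] by (auto simp: configs_def)
  then have "n \<le> m" by simp
  then consider (single) "n = 1" | (full) "n = m" "1 < m" | (main) "n < m" "1 < m" using assms(1) by linarith
  then show ?thesis
  proof cases
    case single
    then show ?thesis
      using card_circle_walks_single[of \<eta> m] assms(3) by (simp add: sin_quotient_def numeral_2_eq_2)
  next
    case full
    \<comment> \<open>On the full circle sin(n\<pi>/m) = sin \<pi> = 0, so both sides are 0 for k >
      0, and \<open>asymp_equiv\<close> treats eventually equal functions as equivalent.\<close>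
    have "sin_quotient n m = 0" using full by (simp add: sin_quotient_def)
    moreover have "card (circle_walks m k \<eta>) = 0" if "0 < k" for k
      using card_circle_walks_full[OF _ \<eta>(1) full(2), of "k - 1"] full(1) assms(3) that by simp
    ultimately show ?thesis
      by (intro conjI impI asymp_equiv_refl_ev eventually_mono[OF eventually_gt_at_top[of 0]]) auto
  next
    case main
    interpret hopping n m using main assms(1) by unfold_locales auto
    let ?W = "\<Prod>t<n. \<Prod>h<t. sin (pi * real_of_int (\<eta> ! h - \<eta> ! t) / real m)"
    let ?c = "\<lambda>k. ?W * (plain_mean + (-1) ^ k * config_sign m (set \<eta>) * signed_mean)"
    have W: "0 < ?W" using config_weight_pos[OF \<eta>(3)] \<eta>(4) by simp
    have abs_bound: "p - \<bar>q\<bar> \<le> p + x * q" if "x = 1 \<or> x = -1" for p q x :: real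
      using that by auto
    have "(\<lambda>k. real (card (circle_walks m k \<eta>))) \<sim>[at_top] (\<lambda>k. (2 * sin_quotient n m) ^ k * ?c k)"
    proof (rule asymp_equiv_of_scaled_limit)
      show "(\<lambda>k. real (card (circle_walks m k \<eta>)) / (2 * sin_quotient n m) ^ k - ?c k) \<longlonglongrightarrow> 0"
        using hop_power_limit[OF \<eta>(3)]
        unfolding card_circle_walks_eq[OF \<eta>(1) main(2)] assms(3) \<eta>(2) \<eta>(4) .
      show "0 < 2 * sin_quotient n m" using sin_quotient_pos[OF n] by simp
      show "0 < ?W * (plain_mean - \<bar>signed_mean\<bar>)" using W mean_bracket_pos by simp
      show "?W * (plain_mean - \<bar>signed_mean\<bar>) \<le> ?c k" for k
      proof (intro mult_left_mono)
        have "(-1) ^ k * config_sign m (set \<eta>) = 1 \<or> (-1) ^ k * config_sign m (set \<eta>) = -1"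
          using config_sign_cases[of m "set \<eta>"] by (cases "even k") auto
        then show "plain_mean - \<bar>signed_mean\<bar> \<le> plain_mean + (-1) ^ k * config_sign m (set \<eta>) * signed_mean"
          by (rule abs_bound)
      qed (use W in simp)
    qed
    note asymp = this
    show ?thesis
    proof (intro conjI impI)
      assume par: "even n \<and> even m"
      have "distinct \<eta>" using \<eta>(3) assms(3) by (simp add: configs_def card_distinct)
      then have sum: "\<Sum>(set \<eta>) = sum_list \<eta>" by (simp add: distinct_sum_list_conv_Sum)
      \<comment> \<open>The three summands of the exponent have three origins: the starting parity,
        the eigenvalue -\<mu>, and the minus signs of the tangent factors.\<close>
      have "(-1) ^ k * config_sign m (set \<eta>) * (-1) ^ (n div 2) = (-1::real) powi (sum_list \<eta> + int k + int (n div 2))" for k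
        using par by (simp add: config_sign_eq_sum sum power_int_add)
      then have "(\<lambda>k. (2 * sin_quotient n m) ^ k * ?c k)
        = (\<lambda>k. 2 ^ (n choose 2) / real m ^ (n div 2) * (2 * sin_quotient n m) ^ k * ?W
            * ((\<Prod>h=1..n div 2. cot ((2 * real h - 1) * pi / (2 * real m)))
               + (-1) powi (sum_list \<eta> + int k + int (n div 2))
                 * (\<Prod>h=1..n div 2. tan ((2 * real h - 1) * pi / (2 * real m)))))"
        using par by (auto simp: plain_mean_even signed_mean_even distrib_left mult_ac fun_eq_iff)
      then show "(\<lambda>k. real (card (circle_walks m k \<eta>))) \<sim>[at_top]
        (\<lambda>k. 2 ^ (n choose 2) / real m ^ (n div 2) * (2 * sin_quotient n m) ^ k * ?W
            * ((\<Prod>h=1..n div 2. cot ((2 * real h - 1) * pi / (2 * real m)))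
               + (-1) powi (sum_list \<eta> + int k + int (n div 2))
                 * (\<Prod>h=1..n div 2. tan ((2 * real h - 1) * pi / (2 * real m)))))"
        using asymp by simp
    next
      assume par: "even n \<and> odd m"
      then show "(\<lambda>k. real (card (circle_walks m k \<eta>))) \<sim>[at_top]
        (\<lambda>k. 2 ^ (n choose 2) / real m ^ (n div 2) * (2 * sin_quotient n m) ^ k * ?W
            * (\<Prod>h=1..n div 2. cot ((2 * real h - 1) * pi / (2 * real m))))"
        using asymp by (simp add: plain_mean_even signed_mean_zero mult_ac)
    next
      assume par: "odd n"
      then show "(\<lambda>k. real (card (circle_walks m k \<eta>))) \<sim>[at_top]
        (\<lambda>k. 2 ^ (n choose 2) / real m ^ ((n - 1) div 2) * (2 * sin_quotient n m) ^ k * ?W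
            * (\<Prod>h=1..(n - 1) div 2. cot (real h * pi / real m)))"
        using asymp by (simp add: plain_mean_odd signed_mean_zero mult_ac)
    qed
  qed
qed

end
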